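(* Let $1\le k\le n$. For each Fubini word $w\in W_{n,k}$ the map $f_w:C_k\times B_n\to\mathbb N$ is a quilt of type $(C_k,B_n)$, and the medium roast Fubini--Bruhat order on $W_{n,k}$ is the subposet of $\mathrm{Quilts}(C_k,B_n)$ defined by $$v\le w\iff f_v\ge f_w\qquad(v,w\in W_{n,k}),$$ where quilts are compared pointwise.
   Context: $\mathbb N=\{0,1,2,\dots\}$, $[h]=\{1,\dots,h\}$. $C_k$ is the chain $\{0<1<\dots<k\}$; $B_n$ is the Boolean lattice of subsets of $[n]$ ordered by inclusion. A quilt of type $(C_k,B_n)$ (with $k\le n$) is a map $f:C_k\times B_n\to\mathbb N$ with $f(0,J)=f(h,\emptyset)=0$ for all $h,J$, $f(k,[n])=k$, and $f(x',y')\in\{f(x,y),f(x,y)+1\}$ whenever $(x',y')$ covers $(x,y)$ in the product order. $\mathrm{Quilts}(C_k,B_n)$ is the set of these, ordered pointwise. $W_{n,k}$ is the set of Fubini words: surjective maps $w:[n]\to[k]$, written $w=w_1\cdots w_n$. Let $\mathcal F_{k\times n}(\mathbb C)$ be the set of rank-$k$ complex $k\times n$ matrices with no zero columns, $T$ the group of invertible diagonal $n\times n$ matrices acting by right multiplication, and $X_{n,k}=\mathcal F_{k\times n}(\mathbb C)/T$, i.e. the space of $n$-tuples $(l_1,\dots,l_n)\in(\mathbb P^{k-1})^n$ of lines with $l_1+\dots+l_n=\mathbb C^k$ (the $l_j$ being spanned by the columns). Pawlowski--Rhoades cells: $X_{n,k}=\bigsqcup_{w\in W_{n,k}}C_w$,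 where the class of $M\in\mathcal F_{k\times n}(\mathbb C)$ with columns $M_1,\dots,M_n$ lies in $C_w$ for the word $w$ determined as follows. Call $j$ initial if $M_j\notin\operatorname{span}(M_1,\dots,M_{j-1})$; there are exactly $k$ initial positions $j_1<\dots<j_k$. The values $w_{j_1},\dots,w_{j_k}$ form the permutation of $[k]$ determined by: for all $a,h\in[k]$, the rank of the submatrix of $M$ on rows $[h]$ and columns $j_1,\dots,j_a$ equals $\#\{b\le a: w_{j_b}\le h\}$. If $j$ is not initial, then $w_j=w_{j_m}$ where $m$ is minimal with $M_j\in\operatorname{span}(M_{j_1},\dots,M_{j_m})$. $\overline{C}_w$ denotes the (Zariski) closure of $C_w$ in $X_{n,k}$. For $M\in\mathcal F_{k\times n}(\mathbb C)$, $f_M(h,J)$ is the rank of the submatrix of $M$ on rows $[h]$ and columns $J$ (and $0$ if $h=0$ or $J=\emptyset$); it depends only on the class of $M$ in $X_{n,k}$. For $w\in W_{n,k}$, $f_w(h,J)=\max\{f_M(h,J): M\in C_w\}$. The medium roast Fubini--Bruhat order on $W_{n,k}$ is defined by $v\le w$ if and only if $\overline{C}_w\subseteq\overline{C}_v$. *)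

theory Defs
  imports
    "HOL-Analysis.Abstract_Topology"
    "HOL-Library.Poly_Mapping"
    "Jordan_Normal_Form.DL_Rank_Submatrix"
begin

text \<open>
  Positions, letters, rows and columns are numbered from 0, as in the matrix library:
  the set \<open>[h]\<close> of the first \<open>h\<close> indices is \<open>{..<h}\<close>. The first argument of a quilt is a
  number of rows, so the chain \<open>C\<^sub>k\<close> is \<open>{0..k}\<close> without any shift.
\<close>

section \<open>Quilts of type \<open>(C\<^sub>k, B\<^sub>n)\<close>\<close>

definition grid :: "nat \<Rightarrow> nat \<Rightarrow> (nat \<times> nat set) set" where
  "grid k n = {0..k} \<times> Pow {..<n}"

definition grid_le :: "nat \<times> nat set \<Rightarrow> nat \<times> nat set \<Rightarrow> bool" where
  "grid_le p q \<longleftrightarrow> fst p \<le> fst q \<and> snd p \<subseteq> snd q"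

text \<open>\<open>grid_covers k n p q\<close> says that \<open>q\<close> covers \<open>p\<close>.\<close>

definition grid_covers :: "nat \<Rightarrow> nat \<Rightarrow> nat \<times> nat set \<Rightarrow> nat \<times> nat set \<Rightarrow> bool" where
  "grid_covers k n p q \<longleftrightarrow>
     p \<in> grid k n \<and> q \<in> grid k n \<and> grid_le p q \<and> p \<noteq> q \<and>
     (\<forall>r\<in>grid k n. grid_le p r \<and> grid_le r q \<longrightarrow> r = p \<or> r = q)"

definition quilts :: "nat \<Rightarrow> nat \<Rightarrow> (nat \<times> nat set \<Rightarrow> nat) set" where
  "quilts k n = {f \<in> grid k n \<rightarrow>\<^sub>E UNIV.
     (\<forall>J. J \<subseteq> {..<n} \<longrightarrow> f (0, J) = 0) \<and>
     (\<forall>h\<le>k. f (h, {}) = 0) \<and>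
     f (k, {..<n}) = k \<and>
     (\<forall>p q. grid_covers k n p q \<longrightarrow> f q = f p \<or> f q = f p + 1)}"

definition quilt_le ::
  "nat \<Rightarrow> nat \<Rightarrow> (nat \<times> nat set \<Rightarrow> nat) \<Rightarrow> (nat \<times> nat set \<Rightarrow> nat) \<Rightarrow> bool" where
  "quilt_le k n f g \<longleftrightarrow> (\<forall>p\<in>grid k n. f p \<le> g p)"


section \<open>The space of line configurations\<close>

definition fubini_words :: "nat \<Rightarrow> nat \<Rightarrow> nat list set" where
  "fubini_words n k = {w. length w = n \<and> set w = {..<k}}"

definition full_mats :: "nat \<Rightarrow> nat \<Rightarrow> complex mat set" where
  "full_mats k n = {M \<in> carrier_mat k n. vec_space.rank k M = k \<and> (\<forall>j<n. col M j \<noteq> 0\<^sub>v k)}"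

definition torus :: "nat \<Rightarrow> complex mat set" where
  "torus n = {D \<in> carrier_mat n n. diagonal_mat D \<and> invertible_mat D}"

definition torus_rel :: "nat \<Rightarrow> nat \<Rightarrow> (complex mat \<times> complex mat) set" where
  "torus_rel k n = {(M, N). M \<in> full_mats k n \<and> N \<in> full_mats k n \<and> (\<exists>D\<in>torus n. N = M * D)}"

definition torus_class :: "nat \<Rightarrow> nat \<Rightarrow> complex mat \<Rightarrow> complex mat set" where
  "torus_class k n M = torus_rel k n `` {M}"

definition X_space :: "nat \<Rightarrow> nat \<Rightarrow> complex mat set set" where
  "X_space k n = full_mats k n // torus_rel k n"


section \<open>The Zariski topology\<close>

text \<open>
  Polynomials in the entries of a matrix: a monomial is a finitely supported exponent function
  on the positions \<open>(i, j)\<close>.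
\<close>

type_synonym entry_poly = "((nat \<times> nat) \<Rightarrow>\<^sub>0 nat) \<Rightarrow>\<^sub>0 complex"

definition eval_entries :: "entry_poly \<Rightarrow> complex mat \<Rightarrow> complex" where
  "eval_entries p M =
     (\<Sum>m\<in>Poly_Mapping.keys p. Poly_Mapping.lookup p m *
        (\<Prod>v\<in>Poly_Mapping.keys m. (M $$ v) ^ Poly_Mapping.lookup m v))"

text \<open>Homogeneous of some degree \<open>d j\<close> in the entries of column \<open>j\<close>, for each column \<open>j\<close>.\<close>

definition multihomogeneous :: "nat \<Rightarrow> nat \<Rightarrow> entry_poly \<Rightarrow> bool" where
  "multihomogeneous k n p \<longleftrightarrow>
     (\<exists>d :: nat \<Rightarrow> nat. \<forall>m\<in>Poly_Mapping.keys p. Poly_Mapping.keys m \<subseteq> {..<k} \<times> {..<n} \<and>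
        (\<forall>j<n. (\<Sum>i<k. Poly_Mapping.lookup m (i, j)) = d j))"

definition principal_open :: "nat \<Rightarrow> nat \<Rightarrow> entry_poly \<Rightarrow> complex mat set set" where
  "principal_open k n p =
     {torus_class k n M | M. M \<in> full_mats k n \<and> eval_entries p M \<noteq> 0}"

text \<open>
  The Zariski topology of the product of \<open>n\<close> copies of projective \<open>(k-1)\<close>-space, restricted to
  \<open>X_space k n\<close>. The principal open sets are closed under finite intersections (multiply the
  polynomials), so the closed sets are exactly the common zero loci in \<open>X_space k n\<close> of sets of
  multihomogeneous polynomials. The constant polynomial 1 shows that \<open>X_space k n\<close> itself is the
  underlying space.
\<close>

definition zariski :: "nat \<Rightarrow> nat \<Rightarrow> complex mat set topology" where
  "zariski k n = topology_generated_by {principal_open k n p | p. multihomogeneous k n p}"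


section \<open>Pawlowski--Rhoades cells and the medium roast order\<close>

abbreviation cspan :: "nat \<Rightarrow> complex vec set \<Rightarrow> complex vec set" where
  "cspan k S \<equiv> LinearCombinations.module.span class_ring (module_vec TYPE(complex) k) S"

definition rank_fun :: "complex mat \<Rightarrow> nat \<Rightarrow> nat set \<Rightarrow> nat" where
  "rank_fun M h J =
     (if h = 0 \<or> J = {} then 0 else vec_space.rank h (submatrix M {..<h} J))"

text \<open>The increasing list \<open>j\<^sub>1 < \<dots> < j\<^sub>k\<close> of initial positions.\<close>

definition initials :: "nat \<Rightarrow> nat \<Rightarrow> complex mat \<Rightarrow> nat list" where
  "initials k n M = filter (\<lambda>j. col M j \<notin> cspan k (col M ` {..<j})) [0..<n]"

text \<open>
  \<open>word_of_mat k n M w\<close> says that \<open>w\<close> is the word of \<open>M\<close>. In the last condition \<open>m\<close> is the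
  0-based index of the relevant initial position, hence \<open>Suc m\<close> initial columns are taken.
\<close>

definition word_of_mat :: "nat \<Rightarrow> nat \<Rightarrow> complex mat \<Rightarrow> nat list \<Rightarrow> bool" where
  "word_of_mat k n M w \<longleftrightarrow>
     w \<in> fubini_words n k \<and>
     (let js = initials k n M in
        bij_betw (\<lambda>b. w ! (js ! b)) {..<k} {..<k} \<and>
        (\<forall>a\<in>{1..k}. \<forall>h\<in>{1..k}.
           rank_fun M h (set (take a js)) = card {b. b < a \<and> w ! (js ! b) < h}) \<and>
        (\<forall>j<n. j \<notin> set js \<longrightarrow>
           w ! j = w ! (js ! (LEAST m. col M j \<in> cspan k (col M ` set (take (Suc m) js))))))"

definition cell :: "nat \<Rightarrow> nat \<Rightarrow> nat list \<Rightarrow> complex mat set set" where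
  "cell k n w = {torus_class k n M | M. M \<in> full_mats k n \<and> word_of_mat k n M w}"

definition word_quilt :: "nat \<Rightarrow> nat \<Rightarrow> nat list \<Rightarrow> nat \<times> nat set \<Rightarrow> nat" where
  "word_quilt k n w = (\<lambda>(h, J)\<in>grid k n.
     Max {rank_fun M h J | M. M \<in> full_mats k n \<and> torus_class k n M \<in> cell k n w})"

definition medium_roast_le :: "nat \<Rightarrow> nat \<Rightarrow> nat list \<Rightarrow> nat list \<Rightarrow> bool" where
  "medium_roast_le k n v w \<longleftrightarrow>
     zariski k n closure_of cell k n w \<subseteq> zariski k n closure_of cell k n v"

end

theory Submission
  imports
    Defs
    "HOL-Library.Function_Algebras"
    "HOL-Combinatorics.Transposition"
begin

text \<open>
  Write \<open>j\<^sub>1 < j\<^sub>2 < \<dots>\<close> for the first occurrences of the letters of \<open>v\<close>, \<open>\<sigma>\<close> for the permutation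
  read off at these positions, and let the level of a position be the index of its letter in this list.
  A matrix lies in \<open>C\<^sub>v\<close> iff some full flag \<open>F\<close> in the open Schubert cell of \<open>\<sigma>\<close> satisfies
  \<open>M\<^sub>j \<in> F\<^sub>m - F\<^sub>m\<^sub>-\<^sub>1\<close> for every position \<open>j\<close> of level \<open>m\<close>. The set \<open>J\<^sub>m\<close> of positions of level at
  most \<open>m\<close> then has \<open>f\<^sub>v(h, J\<^sub>m) \<le> #{b \<le> m. \<sigma>(b) \<le> h}\<close>.

  The closure of \<open>C\<^sub>v\<close> is exactly the locus \<open>f\<^sub>M \<le> f\<^sub>v\<close>. One inclusion holds because ranks are lower
  semicontinuous. Conversely, if \<open>f\<^sub>M \<le> f\<^sub>v\<close>, the bounds on the \<open>J\<^sub>m\<close> allow one to build, from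
  \<open>F\<^sub>k\<close> down to \<open>F\<^sub>0\<close>, a flag with \<open>M\<^sub>j \<in> F\<^sub>m\<close> in the closed Schubert variety of \<open>\<sigma>\<close>; its cell belongs
  to a permutation \<open>\<tau>\<close> that a chain of transpositions joins to \<open>\<sigma>\<close> in Bruhat order, each realised by an
  affine line of matrices. A last perturbation makes the coefficients at the top level nonzero.
  Injectivity holds because first occurrences, letters and levels can be read off from ranks that
  are constant on \<open>C\<^sub>v\<close>.
\<close>

section \<open>Column vectors as functions\<close>

text \<open>The obstacle in the converse inclusion is that the columns of level below m may span
  less than an m-dimensional space, or lie in special position, so a flag cannot be read off from
  the matrix: it has to be chosen, and every choice must respect the counts of the permutation.
  Encoding a flag dually, by linear forms vanishing on it, turns this into row operations. An
  invertible lower triangular factor L on the left changes no rank of first rows, and membership of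
  columns in flag spaces becomes the vanishing of entries of L A. The deformations run along affine
  lines. A Zariski neighbourhood contains a finite intersection of principal open sets, and on a
  line through a given matrix each of these contains a disc around it, so a small parameter outside
  any given finite set is always available. For the other inclusion, semicontinuity has to be
  witnessed inside the given topology, by a multihomogeneous polynomial whose nonvanishing bounds a
  rank from below. A quilt value is a maximum attained on the cell, possibly by a different matrix
  at each pair (h, J); all comparisons are made one pair at a time.\<close>

interpretation fv: vector_space "\<lambda>(c::complex) (f::nat \<Rightarrow> complex) i. c * f i"
  by unfold_locales (auto simp: fun_eq_iff algebra_simps)

interpretation fvp: vector_space_pair "\<lambda>(c::complex) (f::nat \<Rightarrow> complex) i. c * f i"
  "\<lambda>(c::complex) (f::nat \<Rightarrow> complex) i. c * f i"
  by unfold_locales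

interpretation fvc: vector_space_pair "\<lambda>(c::complex) (f::nat \<Rightarrow> complex) i. c * f i"
  "(*) :: complex \<Rightarrow> complex \<Rightarrow> complex"
  by unfold_locales (auto simp: algebra_simps)

abbreviation fv_linear :: "((nat \<Rightarrow> complex) \<Rightarrow> (nat \<Rightarrow> complex)) \<Rightarrow> bool" where
  "fv_linear \<equiv> Vector_Spaces.linear (\<lambda>c f i. c * f i) (\<lambda>c f i. c * f i)"

lemma sum_fun_apply: "(\<Sum>x\<in>A. f x) i = (\<Sum>x\<in>A. f x i)"
  for f :: "'b \<Rightarrow> 'c \<Rightarrow> 'd::comm_monoid_add"
  by (induction A rule: infinite_finite_induct) auto

lemma fv_basis:
  assumes "finite S"
  obtains B where "B \<subseteq> S" "fv.independent B" "fv.span B = fv.span S" "finite B" "card B = fv.dim S"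
proof -
  obtain B where B: "B \<subseteq> S" "fv.independent B" "S \<subseteq> fv.span B" "card B = fv.dim S"
    using fv.basis_exists by blast
  moreover have "fv.span B = fv.span S"
    using B by (metis fv.span_mono fv.span_span subset_antisym)
  ultimately show thesis using that assms finite_subset by blast
qed

lemma fv_dim_mono:
  assumes "finite T" "S \<subseteq> fv.span T"
  shows "fv.dim S \<le> fv.dim T"
proof -
  obtain B where "B \<subseteq> T" "fv.span B = fv.span T" "finite B" "card B = fv.dim T"
    using fv_basis[OF assms(1)] .
  then show ?thesis using fv.dim_le_card[of S B] assms by auto
qed

lemma fv_dim_insert_le:
  assumes "finite S"
  shows "fv.dim (insert x S) \<le> Suc (fv.dim S)"
proof -
  obtain B where B: "B \<subseteq> S" "fv.span B = fv.span S" "finite B" "card B = fv.dim S"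
    using fv_basis[OF assms] .
  have "insert x S \<subseteq> fv.span (insert x B)"
    using B fv.span_mono[of B "insert x B"] fv.span_superset[of S] fv.span_base[of x "insert x B"] by auto
  then have "fv.dim (insert x S) \<le> card (insert x B)" using B by (intro fv.dim_le_card) auto
  also have "\<dots> \<le> Suc (card B)" by (simp add: card_insert_le_m1 card_insert_if B)
  finally show ?thesis using B by simp
qed

lemma fv_dim_insert_eq_iff:
  assumes "finite S"
  shows "fv.dim (insert x S) = fv.dim S \<longleftrightarrow> x \<in> fv.span S"
proof
  assume "x \<in> fv.span S"
  then show "fv.dim (insert x S) = fv.dim S"
    by (metis fv.span_eq_dim fv.span_redundant)
next
  assume eq: "fv.dim (insert x S) = fv.dim S"
  show "x \<in> fv.span S"
  proof (rule ccontr)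
    assume x: "x \<notin> fv.span S"
    obtain B where B: "B \<subseteq> S" "fv.independent B" "fv.span B = fv.span S" "finite B" "card B = fv.dim S"
      using fv_basis[OF assms] .
    have "fv.independent (insert x B)" using x B fv.independent_insertI by auto
    moreover have "insert x B \<subseteq> fv.span (insert x S)"
      using B(1) fv.span_superset[of "insert x S"] by auto
    ultimately have "fv.dim (insert x B) \<le> fv.dim (insert x S)" "fv.dim (insert x B) = card (insert x B)"
      using assms by (auto intro: fv_dim_mono fv.dim_eq_card_independent)
    moreover have "x \<notin> B" using x B fv.span_superset by auto
    ultimately show False using eq B by simp
  qed
qed

lemma fv_dim_image_le:
  assumes "fv_linear f" "finite S"
  shows "fv.dim (f ` S) \<le> fv.dim S"
proof -
  obtain B where B: "B \<subseteq> S" "fv.span B = fv.span S" "finite B" "card B = fv.dim S"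
    using fv_basis[OF assms(2)] .
  have "f ` S \<subseteq> fv.span (f ` B)"
    using B fvp.linear_span_image[OF assms(1)] fv.span_superset by blast
  then have "fv.dim (f ` S) \<le> card (f ` B)" using B by (intro fv.dim_le_card) auto
  then show ?thesis using B card_image_le[of B f] by simp
qed

text \<open>Injectivity is asked on a span only, because maps such as \<open>lmap L h\<close> forget
  all coordinates from h on.\<close>

lemma fv_dim_image_eq:
  assumes "fv_linear f" "finite S" "inj_on f (fv.span S)"
  shows "fv.dim (f ` S) = fv.dim S"
proof -
  obtain B where B: "B \<subseteq> S" "fv.independent B" "fv.span B = fv.span S" "finite B" "card B = fv.dim S"
    using fv_basis[OF assms(2)] .
  have "fv.independent (f ` B)"
    using fvp.linear_independent_injective_image[OF assms(1) B(2)] assms(3) B(3) by simp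
  moreover have "fv.span (f ` B) = fv.span (f ` S)"
    using B fvp.linear_span_image[OF assms(1)] by simp
  moreover have "inj_on f B" using assms(3) B fv.span_superset[of B] by (metis inj_on_subset)
  ultimately show ?thesis using B fv.dim_eq_card[of "f ` B" "f ` S"] by (simp add: card_image)
qed

lemma fv_span_linear_image_iff:
  assumes "fv_linear f" "inj_on f (fv.span (insert x S))"
  shows "f x \<in> fv.span (f ` S) \<longleftrightarrow> x \<in> fv.span S"
proof -
  have "x \<in> fv.span (insert x S)" by (simp add: fv.span_base)
  moreover have "fv.span S \<subseteq> fv.span (insert x S)" by (simp add: fv.span_mono subset_insertI)
  ultimately show ?thesis
    using fvp.linear_span_image[OF assms(1)] assms(2) by (auto dest!: inj_onD)
qed

section \<open>Coordinate vectors and linear functionals\<close>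

definition unit_fun :: "nat \<Rightarrow> nat \<Rightarrow> complex" where
  "unit_fun i = (\<lambda>x. if x = i then 1 else 0)"

lemma inj_unit_fun: "inj unit_fun"
  by (auto simp: inj_def unit_fun_def fun_eq_iff split: if_splits)

lemma fun_eq_sum_unit_fun:
  assumes "finite R" "\<forall>i. i \<notin> R \<longrightarrow> x i = 0"
  shows "x = (\<Sum>i\<in>R. (\<lambda>l. x i * unit_fun i l))"
proof
  fix l
  have "(\<Sum>i\<in>R. (\<lambda>l. x i * unit_fun i l)) l = (\<Sum>i\<in>R. if l = i then x i else 0)"
    unfolding sum_fun_apply by (rule sum.cong) (auto simp: unit_fun_def)
  also have "\<dots> = x l" using assms by (auto simp: sum.delta')
  finally show "x l = (\<Sum>i\<in>R. (\<lambda>l. x i * unit_fun i l)) l" by simp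
qed

lemma in_span_unit_fun:
  assumes "finite R" "\<forall>i. i \<notin> R \<longrightarrow> x i = 0"
  shows "x \<in> fv.span (unit_fun ` R)"
proof -
  have "(\<Sum>i\<in>R. (\<lambda>l. x i * unit_fun i l)) \<in> fv.span (unit_fun ` R)"
    by (intro fv.span_sum fv.span_scale fv.span_base) auto
  then show ?thesis by (rule ssubst[OF fun_eq_sum_unit_fun[OF assms], where P = "\<lambda>y. y \<in> _"])
qed

lemma span_vanish:
  assumes "x \<in> fv.span S" "\<And>y. y \<in> S \<Longrightarrow> y i = 0"
  shows "x i = 0"
  using assms(1) by (rule fv.span_induct_alt) (use assms(2) in auto)

lemma span_unit_fun_iff:
  assumes "finite R"
  shows "x \<in> fv.span (unit_fun ` R) \<longleftrightarrow> (\<forall>i. i \<notin> R \<longrightarrow> x i = 0)"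
proof (intro iffI allI impI)
  fix i assume "x \<in> fv.span (unit_fun ` R)" "i \<notin> R"
  then show "x i = 0" by (intro span_vanish[of x "unit_fun ` R"]) (auto simp: unit_fun_def)
qed (use in_span_unit_fun[OF assms] in blast)

lemma independent_unit_fun:
  assumes "finite R"
  shows "fv.independent (unit_fun ` R)"
proof (rule fv.independent_if_scalars_zero)
  fix f x
  assume s: "(\<Sum>x\<in>unit_fun ` R. (\<lambda>i. f x * x i)) = 0" and "x \<in> unit_fun ` R"
  then obtain r where r: "r \<in> R" "x = unit_fun r" by auto
  have "0 = (\<Sum>x\<in>unit_fun ` R. (\<lambda>i. f x * x i)) r" using s by simp
  also have "\<dots> = (\<Sum>i\<in>R. f (unit_fun i) * unit_fun i r)"
    unfolding sum_fun_apply by (subst sum.reindex) (auto intro: inj_on_subset[OF inj_unit_fun])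
  also have "\<dots> = (\<Sum>i\<in>R. if r = i then f (unit_fun i) else 0)"
    by (rule sum.cong) (auto simp: unit_fun_def)
  also have "\<dots> = f x" using r assms by (simp add: sum.delta')
  finally show "f x = 0" by simp
qed (use assms in simp)

lemma dim_unit_fun:
  assumes "finite R"
  shows "fv.dim (unit_fun ` R) = card R"
  using fv.dim_eq_card_independent[OF independent_unit_fun[OF assms]]
  by (simp add: card_image inj_on_subset[OF inj_unit_fun])

lemma exists_functional:
  assumes "finite S" "x \<notin> fv.span S"
  obtains g where "Vector_Spaces.linear (\<lambda>c f i. c * f i) (*) g" "g x = 1" "\<And>y. y \<in> S \<Longrightarrow> g y = 0"
proof -
  obtain B where B: "B \<subseteq> S" "fv.independent B" "fv.span B = fv.span S"
    using fv_basis[OF assms(1)] by metis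
  have "fv.independent (insert x B)" using assms B fv.independent_insertI by auto
  then obtain g where g: "Vector_Spaces.linear (\<lambda>c f i. c * f i) (*) g"
      "\<forall>y\<in>insert x B. g y = (if y = x then 1 else 0)"
    using fvc.linear_independent_extend[of "insert x B" "\<lambda>y. if y = x then 1 else 0"] by blast
  have "x \<notin> B" using assms B fv.span_superset by auto
  then have "\<And>y. y \<in> B \<Longrightarrow> g y = 0" using g by auto
  then have "\<And>y. y \<in> S \<Longrightarrow> g y = 0"
    using B fvc.linear_eq_0_on_span[OF g(1), of B] fv.span_superset by blast
  then show thesis using that g by simp
qed

lemma functional_as_sum:
  assumes "Vector_Spaces.linear (\<lambda>c f i. c * f i) (*) g" "finite R" "\<forall>i. i \<notin> R \<longrightarrow> x i = 0"
  shows "g x = (\<Sum>i\<in>R. g (unit_fun i) * x i)"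
proof -
  have "g x = g (\<Sum>i\<in>R. (\<lambda>l. x i * unit_fun i l))" by (rule arg_cong[OF fun_eq_sum_unit_fun[OF assms(2,3)]])
  also have "\<dots> = (\<Sum>i\<in>R. x i * g (unit_fun i))"
    by (simp add: fvc.linear_sum[OF assms(1)] fvc.linear_scale[OF assms(1)])
  finally show ?thesis by (simp add: mult.commute)
qed

text \<open>By dimension some unit vector at r in R lies outside the span of W. A functional that is
  1 there and kills W has the required coefficients as its values on unit vectors.\<close>

lemma exists_annihilator:
  assumes "finite R" "finite W" "\<forall>w\<in>W. \<forall>i. i \<notin> R \<longrightarrow> w i = 0" "fv.dim W < card R"
  obtains c where "\<exists>i\<in>R. c i \<noteq> 0" "\<And>w. w \<in> W \<Longrightarrow> (\<Sum>i\<in>R. c i * w i) = 0"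
proof -
  have "\<not> unit_fun ` R \<subseteq> fv.span W"
    using fv_dim_mono[OF assms(2), of "unit_fun ` R"] assms(4) dim_unit_fun[OF assms(1)] by auto
  then obtain r where r: "r \<in> R" "unit_fun r \<notin> fv.span W" by auto
  obtain g where g: "Vector_Spaces.linear (\<lambda>c f i. c * f i) (*) g" "g (unit_fun r) = 1" "\<And>y. y \<in> W \<Longrightarrow> g y = 0"
    using exists_functional[OF assms(2) r(2)] by blast
  show thesis
  proof (rule that[of "\<lambda>i. g (unit_fun i)"])
    show "\<exists>i\<in>R. g (unit_fun i) \<noteq> 0" using r g by force
    fix w assume w: "w \<in> W"
    then show "(\<Sum>i\<in>R. g (unit_fun i) * w i) = 0"
      using functional_as_sum[OF g(1) assms(1), of w] g(3)[of w] assms(3) by metis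
  qed
qed

section \<open>Transfer from library vectors to zero-padded functions\<close>

definition vec_fun :: "complex vec \<Rightarrow> nat \<Rightarrow> complex" where
  "vec_fun v = (\<lambda>i. if i < dim_vec v then v $ i else 0)"

lemma inj_on_vec_fun: "inj_on vec_fun (carrier_vec h)"
proof (rule inj_onI)
  fix x y assume xy: "x \<in> carrier_vec h" "y \<in> carrier_vec h" "vec_fun x = vec_fun y"
  show "x = y"
  proof (rule eq_vecI)
    show "dim_vec x = dim_vec y" using xy by simp
    fix i assume i: "i < dim_vec y"
    have "vec_fun x i = vec_fun y i" using xy by simp
    then show "x $ i = y $ i" using xy i by (auto simp: vec_fun_def)
  qed
qed

lemma cspan_iff:
  assumes "finite S" "S \<subseteq> carrier_vec h" "x \<in> carrier_vec h"
  shows "x \<in> cspan h S \<longleftrightarrow> vec_fun x \<in> fv.span (vec_fun ` S)"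
proof -
  interpret vec_space "TYPE(complex)" h .
  have lin: "vec_fun (lincomb a S) = (\<Sum>v\<in>S. (\<lambda>i. a v * vec_fun v i))" for a
  proof
    fix i
    have "dim_vec v = h" if "v \<in> S" for v using assms(2) that by auto
    then have "(\<Sum>v\<in>S. (\<lambda>i. a v * vec_fun v i)) i = (\<Sum>v\<in>S. a v * (if i < h then v $ i else 0))"
      unfolding sum_fun_apply by (intro sum.cong) (auto simp: vec_fun_def)
    then show "vec_fun (lincomb a S) i = (\<Sum>v\<in>S. (\<lambda>i. a v * vec_fun v i)) i"
      using lincomb_dim[OF assms(1,2), of a] lincomb_index[OF _ assms(2), of i a]
      by (auto simp: vec_fun_def)
  qed
  have inj: "inj_on vec_fun S" using inj_on_vec_fun assms(2) by (rule inj_on_subset)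
  show ?thesis
  proof
    assume "x \<in> span S"
    then obtain a where "x = lincomb a S"
      using finite_span[OF assms(1)] assms(2) by auto
    then have "vec_fun x = (\<Sum>v\<in>S. (\<lambda>i. a v * vec_fun v i))" using lin by simp
    also have "\<dots> \<in> fv.span (vec_fun ` S)"
      by (intro fv.span_sum fv.span_scale fv.span_base) auto
    finally show "vec_fun x \<in> fv.span (vec_fun ` S)" .
  next
    assume "vec_fun x \<in> fv.span (vec_fun ` S)"
    then obtain u where "vec_fun x = (\<Sum>v\<in>vec_fun ` S. (\<lambda>i. u v * v i))"
      using fv.span_finite[of "vec_fun ` S"] assms(1) by auto
    also have "\<dots> = vec_fun (lincomb (u \<circ> vec_fun) S)"
      unfolding lin by (subst sum.reindex[OF inj]) simp
    finally have "x = lincomb (u \<circ> vec_fun) S"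
      using inj_on_vec_fun[of h] assms(3) lincomb_closed[of S] assms(2) by (auto dest: inj_onD)
    then show "x \<in> span S"
      using finite_span[OF assms(1)] assms(2) by auto
  qed
qed

text \<open>One vector at a time: an independent set becomes dependent exactly when the new vector
  is in its span, and \<open>cspan_iff\<close> already transfers spans.\<close>

lemma lin_dep_iff:
  assumes "finite S" "S \<subseteq> carrier_vec h"
  shows "LinearCombinations.module.lin_dep class_ring (module_vec TYPE(complex) h) S \<longleftrightarrow>
    fv.dependent (vec_fun ` S)"
proof -
  interpret vec_space "TYPE(complex)" h .
  show ?thesis using assms
  proof (induction S rule: finite_induct)
    case empty
    show ?case using finite_lin_indpt2[of "{}"] fv.independent_empty by auto
  next
    case (insert x S)
    have S: "S \<subseteq> carrier_vec h" and x: "x \<in> carrier_vec h" using insert by auto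
    have nx: "vec_fun x \<notin> vec_fun ` S"
      using insert.hyps inj_on_vec_fun[of h] S x by (auto dest: inj_onD)
    show ?case
    proof (cases "lin_dep S")
      case True
      then have "fv.dependent (vec_fun ` S)" using insert.IH S by simp
      then have "fv.dependent (vec_fun ` insert x S)" by (metis fv.dependent_mono image_mono subset_insertI)
      moreover have "lin_dep (insert x S)" using True supset_ld_is_ld[of S "insert x S"] by auto
      ultimately show ?thesis by simp
    next
      case False
      have "lin_dep (insert x S) \<longleftrightarrow> x \<in> span S"
        using lin_dep_iff_in_span[of S x] S False x insert.hyps by auto
      also have "\<dots> \<longleftrightarrow> vec_fun x \<in> fv.span (vec_fun ` S)" using cspan_iff insert.hyps S x by auto
      also have "\<dots> \<longleftrightarrow> fv.dependent (vec_fun ` insert x S)"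
        using False insert.IH S nx fv.independent_insert[of "vec_fun x" "vec_fun ` S"] by auto
      finally show ?thesis .
    qed
  qed
qed

lemma rank_eq_dim:
  assumes "A \<in> carrier_mat h nc"
  shows "vec_space.rank h A = fv.dim (vec_fun ` set (cols A))"
proof -
  interpret vec_space "TYPE(complex)" h .
  have cv: "set (cols A) \<subseteq> carrier_vec h" using assms cols_dim by blast
  obtain B' where B': "B' \<subseteq> vec_fun ` set (cols A)" "fv.independent B'"
      "fv.span B' = fv.span (vec_fun ` set (cols A))" "card B' = fv.dim (vec_fun ` set (cols A))"
    using fv_basis[OF finite_imageI[OF finite_set]] by metis
  obtain B where B: "B \<subseteq> set (cols A)" "B' = vec_fun ` B" using B'(1) by (auto simp: subset_image_iff)
  have Bc: "finite B" "B \<subseteq> carrier_vec h" using B cv by (auto intro: finite_subset)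
  \<comment> \<open>The library computes the rank as the size of a maximal independent set of
    columns; the preimage of a basis of the padded columns is one.\<close>
  have "maximal B (\<lambda>T. T \<subseteq> set (cols A) \<and> lin_indpt T)"
    unfolding maximal_def
  proof (intro conjI allI impI)
    show "B \<subseteq> set (cols A)" by fact
    show "lin_indpt B" using lin_dep_iff[OF Bc] B' B by simp
    fix C assume "B \<subseteq> C \<and> C \<subseteq> set (cols A) \<and> lin_indpt C"
    then have C: "B \<subseteq> C" "C \<subseteq> set (cols A)" "lin_indpt C" by auto
    then have Ci: "fv.independent (vec_fun ` C)"
      using lin_dep_iff[of C h] cv finite_subset[of C "set (cols A)"] by auto
    have "x \<in> B" if "x \<in> C" for x
    proof (rule ccontr)
      assume "x \<notin> B"
      then have "vec_fun x \<notin> vec_fun ` B"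
        using inj_on_image_mem_iff[OF inj_on_vec_fun[of h], of x B] that C Bc cv by auto
      moreover have "fv.independent (insert (vec_fun x) (vec_fun ` B))"
        using C that by (intro fv.independent_mono[OF Ci]) auto
      ultimately have "vec_fun x \<notin> fv.span (vec_fun ` B)"
        using fv.independent_insert[of "vec_fun x" "vec_fun ` B"] by simp
      moreover have "vec_fun x \<in> fv.span (vec_fun ` set (cols A))" using that C by (auto intro: fv.span_base)
      ultimately show False using B' B by simp
    qed
    then show "C = B" using C by auto
  qed
  then have "rank A = card B" using rank_card_indpt[OF assms] by simp
  also have "\<dots> = card B'" using B Bc inj_on_vec_fun[of h] by (metis card_image inj_on_subset)
  finally show ?thesis using B' by simp
qed

section \<open>Ranks of corner submatrices\<close>

text \<open>Padding by zeros puts columns of every height into one vector space, so that lowering h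
  is a linear map, \<open>trunc_map\<close>.\<close>

definition trunc_col :: "(nat \<Rightarrow> nat \<Rightarrow> complex) \<Rightarrow> nat \<Rightarrow> nat \<Rightarrow> nat \<Rightarrow> complex" where
  "trunc_col A h j = (\<lambda>i. if i < h then A i j else 0)"

definition rk :: "(nat \<Rightarrow> nat \<Rightarrow> complex) \<Rightarrow> nat \<Rightarrow> nat set \<Rightarrow> nat" where
  "rk A h J = fv.dim (trunc_col A h ` J)"

abbreviation entries :: "complex mat \<Rightarrow> nat \<Rightarrow> nat \<Rightarrow> complex" where
  "entries M \<equiv> \<lambda>i j. M $$ (i, j)"

lemma vec_fun_col:
  assumes "M \<in> carrier_mat k n" "j < n"
  shows "vec_fun (col M j) = trunc_col (entries M) k j"
  using assms by (auto simp: vec_fun_def trunc_col_def fun_eq_iff)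

lemma cspan_col_iff:
  assumes "M \<in> carrier_mat k n" "j < n" "J \<subseteq> {..<n}"
  shows "col M j \<in> cspan k (col M ` J) \<longleftrightarrow>
    trunc_col (entries M) k j \<in> fv.span (trunc_col (entries M) k ` J)"
proof -
  have "vec_fun ` col M ` J = trunc_col (entries M) k ` J"
    unfolding image_image using vec_fun_col[OF assms(1)] assms(3) by (intro image_cong) auto
  moreover have "finite J" using assms(3) finite_subset by auto
  moreover have "col M ` J \<subseteq> carrier_vec k" "col M j \<in> carrier_vec k" using assms(1) by auto
  ultimately show ?thesis
    using cspan_iff[of "col M ` J" k "col M j"] vec_fun_col[OF assms(1,2)] by simp
qed

text \<open>\<open>submatrix\<close> renumbers its rows and columns through \<open>pick\<close>; on
  the initial segment of rows this is the identity, and on the columns it enumerates J.\<close>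

lemma rank_fun_eq_rk:
  assumes M: "M \<in> carrier_mat k n" and h: "h \<le> k" and J: "J \<subseteq> {..<n}"
  shows "rank_fun M h J = rk (entries M) h J"
proof (cases "h = 0 \<or> J = {}")
  case True
  then have "trunc_col (entries M) h ` J \<subseteq> fv.span {}" by (auto simp: trunc_col_def fun_eq_iff)
  then have "rk (entries M) h J = 0" using fv.dim_le_card[of _ "{}"] by (auto simp: rk_def)
  then show ?thesis using True by (simp add: rank_fun_def)
next
  case False
  let ?S = "submatrix M {..<h} J"
  have fJ: "finite J" using J finite_subset by auto
  have c1: "card {i. i < dim_row M \<and> i \<in> {..<h}} = h"
  proof -
    have "{i. i < dim_row M \<and> i \<in> {..<h}} = {..<h}" using M h by auto
    then show ?thesis by simp
  qed
  have c2: "{j. j < dim_col M \<and> j \<in> J} = J" using M J by auto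
  have S: "?S \<in> carrier_mat h (card J)"
    by (rule carrier_matI) (simp_all only: dim_submatrix c1 c2)
  have pick: "pick {..<h} i = i" if "i < h" for i
  proof -
    have *: "card {a \<in> {..<h}. a < i} = i"
    proof -
      have "{a \<in> {..<h}. a < i} = {..<i}" using that by auto
      then show ?thesis by simp
    qed
    show ?thesis using pick_card_in_set[of i "{..<h}"] that unfolding * by simp
  qed
  have col: "vec_fun (col ?S b) = trunc_col (entries M) h (pick J b)" if "b < card J" for b
  proof
    fix i show "vec_fun (col ?S b) i = trunc_col (entries M) h (pick J b) i"
    proof (cases "i < h")
      case True
      have "?S $$ (i, b) = M $$ (pick {..<h} i, pick J b)"
        by (rule submatrix_index) (use that c1 c2 True in auto)
      then show ?thesis using S that True pick by (auto simp: vec_fun_def trunc_col_def)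
    qed (use S that in \<open>auto simp: vec_fun_def trunc_col_def\<close>)
  qed
  have img: "pick J ` {..<card J} = J"
  proof
    show "pick J ` {..<card J} \<subseteq> J" using pick_in_set by auto
    show "J \<subseteq> pick J ` {..<card J}"
    proof
      fix j assume j: "j \<in> J"
      have "{a \<in> J. a < j} \<subset> J" using j by auto
      then have "card {a \<in> J. a < j} < card J" using fJ by (simp add: psubset_card_mono)
      moreover have "pick J (card {a \<in> J. a < j}) = j" using pick_card_in_set j by auto
      ultimately show "j \<in> pick J ` {..<card J}"
        by (intro image_eqI[of _ _ "card {a \<in> J. a < j}"]) auto
    qed
  qed
  have "set (cols ?S) = col ?S ` {..<card J}"
    using S by (auto simp: cols_def)
  then have "vec_fun ` set (cols ?S) = trunc_col (entries M) h ` J"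
    using col img by (auto simp: image_image image_iff) (metis lessThan_iff image_iff)+
  then show ?thesis using False rank_eq_dim[OF S] by (simp add: rank_fun_def rk_def)
qed

lemma rank_eq_rk:
  assumes "M \<in> carrier_mat k n"
  shows "vec_space.rank k M = rk (entries M) k {..<n}"
proof -
  have "vec_fun ` set (cols M) = trunc_col (entries M) k ` {..<n}"
    using assms vec_fun_col[OF assms] by (auto simp: cols_def image_image)
  then show ?thesis using rank_eq_dim[OF assms] by (simp add: rk_def)
qed

definition trunc_map :: "nat \<Rightarrow> (nat \<Rightarrow> complex) \<Rightarrow> nat \<Rightarrow> complex" where
  "trunc_map h x = (\<lambda>i. if i < h then x i else 0)"

lemma linear_trunc_map: "fv_linear (trunc_map h)"
  by unfold_locales (auto simp: trunc_map_def fun_eq_iff algebra_simps)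

lemma trunc_map_trunc_col: "h \<le> k \<Longrightarrow> trunc_map h (trunc_col A k j) = trunc_col A h j"
  by (auto simp: trunc_map_def trunc_col_def fun_eq_iff)

lemma trunc_map_image: "h \<le> k \<Longrightarrow> trunc_map h ` trunc_col A k ` J = trunc_col A h ` J"
  by (simp add: image_image trunc_map_trunc_col)

lemma rk_mono_cols: "finite J' \<Longrightarrow> J \<subseteq> J' \<Longrightarrow> rk A h J \<le> rk A h J'"
  unfolding rk_def by (intro fv_dim_mono) (auto intro: fv.span_base)

lemma rk_mono_rows: "finite J \<Longrightarrow> h \<le> h' \<Longrightarrow> rk A h J \<le> rk A h' J"
  unfolding rk_def trunc_map_image[of h h', symmetric]
  by (intro fv_dim_image_le linear_trunc_map) auto

lemma rk_insert_le: "finite J \<Longrightarrow> rk A h (insert j J) \<le> Suc (rk A h J)"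
  unfolding rk_def by (simp add: fv_dim_insert_le)

lemma rk_insert_eq_iff:
  "finite J \<Longrightarrow> rk A h (insert j J) = rk A h J \<longleftrightarrow> trunc_col A h j \<in> fv.span (trunc_col A h ` J)"
  unfolding rk_def by (simp add: fv_dim_insert_eq_iff)

text \<open>The additional row changes each column by a multiple of one fixed unit vector.\<close>

lemma rk_Suc_le:
  assumes "finite J"
  shows "rk A (Suc h) J \<le> Suc (rk A h J)"
proof -
  let ?T = "insert (unit_fun h) (trunc_col A h ` J)"
  have "trunc_col A (Suc h) j \<in> fv.span ?T" if "j \<in> J" for j
  proof -
    have "trunc_col A (Suc h) j = trunc_col A h j + (\<lambda>i. A h j * unit_fun h i)"
      by (auto simp: trunc_col_def unit_fun_def fun_eq_iff less_Suc_eq)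
    also have "\<dots> \<in> fv.span ?T"
      using that by (intro fv.span_add fv.span_scale fv.span_base) auto
    finally show ?thesis .
  qed
  then have "rk A (Suc h) J \<le> fv.dim ?T"
    unfolding rk_def using assms by (intro fv_dim_mono) auto
  also have "\<dots> \<le> Suc (rk A h J)" unfolding rk_def using assms by (simp add: fv_dim_insert_le)
  finally show ?thesis .
qed

lemma rk_le_card: "finite J \<Longrightarrow> rk A h J \<le> card J"
  unfolding rk_def
  by (rule order.trans[OF fv.dim_le_card[OF fv.span_superset] card_image_le]) auto

lemma rk_le_rows: "rk A h J \<le> h"
proof -
  have "trunc_col A h j \<in> fv.span (unit_fun ` {..<h})" for j
    by (intro in_span_unit_fun) (auto simp: trunc_col_def)
  then have "rk A h J \<le> fv.dim (unit_fun ` {..<h})"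
    unfolding rk_def by (intro fv_dim_mono) auto
  then show ?thesis by (simp add: dim_unit_fun)
qed

text \<open>Truncation is linear, so a span relation between full columns survives in the first h
  rows.\<close>

lemma rk_le_span:
  assumes "finite J'" "h \<le> k" "\<And>j. j \<in> J \<Longrightarrow> trunc_col A k j \<in> fv.span (trunc_col A k ` J')"
  shows "rk A h J \<le> rk A h J'"
  unfolding rk_def
proof (rule fv_dim_mono)
  have "trunc_map h ` trunc_col A k ` J \<subseteq> trunc_map h ` fv.span (trunc_col A k ` J')"
    using assms(3) by auto
  then show "trunc_col A h ` J \<subseteq> fv.span (trunc_col A h ` J')"
    using fvp.linear_span_image[OF linear_trunc_map, of h "trunc_col A k ` J'"] trunc_map_image[OF assms(2)]
    by simp
qed (use assms in simp)

lemma rk_scale: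
  assumes "finite J" "\<And>j. j \<in> J \<Longrightarrow> d j \<noteq> 0" "\<And>i j. i < h \<Longrightarrow> j \<in> J \<Longrightarrow> B i j = d j * A i j"
  shows "rk B h J = rk A h J"
proof -
  have eq: "trunc_col B h j = (\<lambda>i. d j * trunc_col A h j i)"
    "trunc_col A h j = (\<lambda>i. inverse (d j) * trunc_col B h j i)" if "j \<in> J" for j
    using assms that by (auto simp: trunc_col_def fun_eq_iff)
  show ?thesis unfolding rk_def
  proof (intro antisym fv_dim_mono)
    show "trunc_col B h ` J \<subseteq> fv.span (trunc_col A h ` J)"
    proof (rule image_subsetI)
      fix j assume j: "j \<in> J"
      show "trunc_col B h j \<in> fv.span (trunc_col A h ` J)"
        unfolding eq(1)[OF j] by (rule fv.span_scale, rule fv.span_base) (use j in blast)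
    qed
    show "trunc_col A h ` J \<subseteq> fv.span (trunc_col B h ` J)"
    proof (rule image_subsetI)
      fix j assume j: "j \<in> J"
      have "(\<lambda>i. inverse (d j) * trunc_col B h j i) \<in> fv.span (trunc_col B h ` J)"
        by (rule fv.span_scale, rule fv.span_base) (use j in blast)
      then show "trunc_col A h j \<in> fv.span (trunc_col B h ` J)" using eq(2)[OF j] by simp
    qed
  qed (use assms in auto)
qed

section \<open>Invertible lower triangular matrices acting on rows\<close>

definition lapp :: "(nat \<Rightarrow> nat \<Rightarrow> complex) \<Rightarrow> nat \<Rightarrow> (nat \<Rightarrow> nat \<Rightarrow> complex) \<Rightarrow> nat \<Rightarrow> nat \<Rightarrow> complex" where
  "lapp L k A = (\<lambda>i j. \<Sum>l<k. L i l * A l j)"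

text \<open>Row i of the product uses only rows up to i, invertibly. This is the Borel group whose
  left action preserves all ranks \<open>rk A h J\<close> with h at most k.\<close>

definition lower_tri :: "nat \<Rightarrow> (nat \<Rightarrow> nat \<Rightarrow> complex) \<Rightarrow> bool" where
  "lower_tri k L \<longleftrightarrow> (\<forall>i<k. L i i \<noteq> 0 \<and> (\<forall>l<k. i < l \<longrightarrow> L i l = 0))"

lemma lapp_lower:
  assumes "lower_tri k L" "i < h" "h \<le> k"
  shows "lapp L k A i j = (\<Sum>l<h. L i l * A l j)"
  unfolding lapp_def
  by (rule sum.mono_neutral_right) (use assms in \<open>auto simp: lower_tri_def\<close>)

lemma lower_tri_kernel:
  assumes L: "lower_tri k L" and h: "h \<le> k" and z: "\<And>i. i < h \<Longrightarrow> (\<Sum>l<h. L i l * x l) = 0" and i: "i < h"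
  shows "x i = 0"
  using i
proof (induction i rule: less_induct)
  case (less i)
  have "(\<Sum>l<h. L i l * x l) = (\<Sum>l\<in>{i}. L i l * x l)"
  proof (rule sum.mono_neutral_right)
    show "\<forall>l\<in>{..<h} - {i}. L i l * x l = 0"
    proof
      fix l assume "l \<in> {..<h} - {i}"
      then consider "l < i" | "i < l" "l < k" using h by fastforce
      then show "L i l * x l = 0" using less L h by cases (auto simp: lower_tri_def)
    qed
  qed (use less in auto)
  then show ?case using z[of i] less L h by (auto simp: lower_tri_def)
qed

text \<open>The leading h by h block of L. By triangularity it alone describes the effect of L on
  truncated columns.\<close>

definition lmap :: "(nat \<Rightarrow> nat \<Rightarrow> complex) \<Rightarrow> nat \<Rightarrow> (nat \<Rightarrow> complex) \<Rightarrow> nat \<Rightarrow> complex" where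
  "lmap L h x = (\<lambda>i. if i < h then \<Sum>l<h. L i l * x l else 0)"

lemma linear_lmap: "fv_linear (lmap L h)"
proof unfold_locales
  show "lmap L h (x + y) = lmap L h x + lmap L h y" for x y
    by (simp add: lmap_def fun_eq_iff distrib_left sum.distrib)
  show "lmap L h (\<lambda>i. c * x i) = (\<lambda>i. c * lmap L h x i)" for c x
  proof
    have "(\<Sum>l<h. L i l * (c * x l)) = c * (\<Sum>l<h. L i l * x l)" for i
      unfolding sum_distrib_left by (rule sum.cong) (simp_all only: mult.left_commute)
    then show "lmap L h (\<lambda>i. c * x i) i = c * lmap L h x i" for i by (simp only: lmap_def) simp
  qed
qed

lemma lmap_trunc_col:
  assumes "lower_tri k L" "h \<le> k"
  shows "lmap L h (trunc_col A h j) = trunc_col (lapp L k A) h j"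
proof
  fix i
  show "lmap L h (trunc_col A h j) i = trunc_col (lapp L k A) h j i"
    using lapp_lower[OF assms(1) _ assms(2), of i A j] by (simp add: lmap_def trunc_col_def)
qed

lemma inj_on_lmap:
  assumes "lower_tri k L" "h \<le> k"
  shows "inj_on (lmap L h) (fv.span (trunc_col A h ` J))"
proof (rule inj_onI)
  fix x y assume xy: "x \<in> fv.span (trunc_col A h ` J)" "y \<in> fv.span (trunc_col A h ` J)"
    "lmap L h x = lmap L h y"
  have "x i = y i" if "i < h" for i
  proof -
    have "(\<lambda>i. x i - y i) i = 0"
    proof (rule lower_tri_kernel[OF assms _ that])
      fix i assume "i < h"
      then show "(\<Sum>l<h. L i l * (x l - y l)) = 0"
        using fun_cong[OF xy(3), of i] by (simp add: lmap_def algebra_simps sum_subtractf)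
    qed
    then show ?thesis by simp
  qed
  moreover have "x i = y i" if "\<not> i < h" for i
  proof -
    have z: "z i = 0" if "z \<in> fv.span (trunc_col A h ` J)" for z
      by (rule span_vanish[OF that]) (use \<open>\<not> i < h\<close> in \<open>auto simp: trunc_col_def\<close>)
    show ?thesis using z[OF xy(1)] z[OF xy(2)] by simp
  qed
  ultimately show "x = y" by (auto simp: fun_eq_iff)
qed

lemma rk_lapp:
  assumes "lower_tri k L" "h \<le> k" "finite J"
  shows "rk (lapp L k A) h J = rk A h J"
  using fv_dim_image_eq[OF linear_lmap _ inj_on_lmap[OF assms(1,2), of A J]] assms
  by (simp add: rk_def image_image lmap_trunc_col)

lemma span_lapp:
  assumes "lower_tri k L"
  shows "trunc_col (lapp L k A) k j \<in> fv.span (trunc_col (lapp L k A) k ` J) \<longleftrightarrow>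
    trunc_col A k j \<in> fv.span (trunc_col A k ` J)"
  using fv_span_linear_image_iff[OF linear_lmap, of L k "trunc_col A k j" "trunc_col A k ` J"]
    inj_on_lmap[OF assms order.refl, of A "insert j J"] assms
  by (simp add: image_image lmap_trunc_col)

text \<open>Forward substitution in each column. It converts a change prescribed for L A into a
  direction N in which A itself has to move.\<close>

lemma lower_tri_solve:
  assumes L: "lower_tri k L"
  obtains N where "\<And>i j. i < k \<Longrightarrow> lapp L k N i j = E i j"
proof -
  have solve: "\<exists>x. \<forall>i<h. (\<Sum>l<h. L i l * x l) = y i" if "h \<le> k" for h y
    using that
  proof (induction h)
    case (Suc h)
    then obtain x where x: "\<And>i. i < h \<Longrightarrow> (\<Sum>l<h. L i l * x l) = y i" by auto
    define x' where "x' = x(h := (y h - (\<Sum>l<h. L h l * x l)) / L h h)"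
    have eq: "(\<Sum>l<Suc h. L i l * x' l) = (\<Sum>l<h. L i l * x l) + L i h * x' h" for i
      by (simp add: x'_def)
    have "L h h \<noteq> 0" using L Suc by (auto simp: lower_tri_def)
    then have "L h h * x' h = y h - (\<Sum>l<h. L h l * x l)" by (simp add: x'_def)
    then have "(\<Sum>l<Suc h. L i l * x' l) = y i" if "i < Suc h" for i
    proof (cases "i = h")
      case False
      then have "L i h = 0" using L Suc that by (auto simp: lower_tri_def)
      then show ?thesis using eq[of i] x[of i] that False by simp
    qed (use eq[of h] in simp)
    then show ?case by blast
  qed simp
  have "\<forall>j. \<exists>x. \<forall>i<k. (\<Sum>l<k. L i l * x l) = E i j" by (intro allI solve order.refl)
  then obtain X where "\<And>i j. i < k \<Longrightarrow> (\<Sum>l<k. L i l * X j l) = E i j" by metis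
  then show thesis using that[of "\<lambda>i j. X j i"] by (simp add: lapp_def)
qed

section \<open>Flags in Schubert varieties\<close>

lemma bij_betw_lessThan_eq_iff:
  "bij_betw \<tau> {..<k} B \<Longrightarrow> c < k \<Longrightarrow> d < k \<Longrightarrow> \<tau> c = \<tau> d \<longleftrightarrow> c = d"
  for k :: nat
  using inj_on_eq_iff[OF bij_betw_imp_inj_on, of \<tau> "{..<k}" B c d] by simp

text \<open>Corner rank of the permutation matrix with ones at (\<open>\<tau> b\<close>, b): first m
  columns, first h rows. For permutations, pointwise comparison of these counts is the Bruhat order,
  with larger counts lower.\<close>

definition nw :: "(nat \<Rightarrow> nat) \<Rightarrow> nat \<Rightarrow> nat \<Rightarrow> nat" where
  "nw \<tau> m h = card {b. b < m \<and> \<tau> b < h}"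

lemma nw_Suc: "nw \<tau> (Suc m) h = nw \<tau> m h + (if \<tau> m < h then 1 else 0)"
proof -
  have "{b. b < Suc m \<and> \<tau> b < h} = (if \<tau> m < h then {m} else {}) \<union> {b. b < m \<and> \<tau> b < h}"
    by (auto simp: less_Suc_eq)
  then show ?thesis by (simp add: nw_def)
qed

lemma nw_cong: "(\<And>b. b < m \<Longrightarrow> \<tau> b = \<tau>' b) \<Longrightarrow> nw \<tau> m h = nw \<tau>' m h"
  unfolding nw_def by (rule arg_cong[where f = card]) auto

lemma nw_transpose:
  assumes "a < m" "b < m"
  shows "nw (\<tau> \<circ> transpose a b) m h = nw \<tau> m h"
proof -
  have "transpose a b c < m \<longleftrightarrow> c < m" for c
    using assms by (auto simp: transpose_def)
  moreover have "c \<in> transpose a b ` S \<longleftrightarrow> transpose a b c \<in> S" for c S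
    by (metis image_iff transpose_involutory)
  ultimately have "{c. c < m \<and> (\<tau> \<circ> transpose a b) c < h} = transpose a b ` {c. c < m \<and> \<tau> c < h}"
    by (simp add: set_eq_iff)
  moreover have "inj_on (transpose a b) S" for S by (rule inj_on_subset[OF bij_is_inj[OF bij_transpose]]) simp
  ultimately show ?thesis by (simp only: nw_def card_image)
qed

lemma nw_full:
  assumes "bij_betw \<tau> {..<k} {..<k}"
  shows "nw \<tau> k k = k"
proof -
  have "{b. b < k \<and> \<tau> b < k} = {..<k}" using assms by (auto simp: bij_betw_def)
  then show ?thesis by (simp add: nw_def)
qed

lemma bij_betw_transpose_comp:
  assumes "bij_betw \<tau> {..<k} {..<k}" "a < k" "b < k"
  shows "bij_betw (\<tau> \<circ> transpose a b) {..<k} {..<k}"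
proof (rule bij_betw_trans[OF _ assms(1)])
  show "bij_betw (transpose a b) {..<k} {..<k}"
    using assms(2,3) inj_on_subset[OF bij_is_inj[OF bij_transpose], of "{..<k}" a b]
    by (simp add: bij_betw_def)
qed

definition restr_map :: "nat set \<Rightarrow> (nat \<Rightarrow> complex) \<Rightarrow> nat \<Rightarrow> complex" where
  "restr_map R x = (\<lambda>i. if i \<in> R then x i else 0)"

lemma linear_restr_map: "fv_linear (restr_map R)"
  by unfold_locales (auto simp: restr_map_def fun_eq_iff algebra_simps)

text \<open>After restriction to the coordinates in R the columns still span less than card R
  dimensions; an annihilator of that space is a relation between the rows in R.\<close>

lemma exists_row_relation:
  assumes "finite J" "R \<subseteq> {..<h}" "rk A h J < card R"
  obtains c where "\<exists>i\<in>R. c i \<noteq> 0" "\<And>j. j \<in> J \<Longrightarrow> (\<Sum>i\<in>R. c i * A i j) = 0"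
proof -
  let ?W = "restr_map R ` trunc_col A h ` J"
  have R: "finite R" using assms(2) finite_subset by auto
  have "fv.dim ?W \<le> rk A h J"
    unfolding rk_def using assms(1) by (intro fv_dim_image_le linear_restr_map) auto
  then have "fv.dim ?W < card R" using assms(3) by simp
  moreover have "finite ?W" "\<forall>w\<in>?W. \<forall>i. i \<notin> R \<longrightarrow> w i = 0"
    using assms(1) by (auto simp: restr_map_def)
  ultimately obtain c where c: "\<exists>i\<in>R. c i \<noteq> 0" "\<And>w. w \<in> ?W \<Longrightarrow> (\<Sum>i\<in>R. c i * w i) = 0"
    using exists_annihilator[OF R, of ?W thesis] by blast
  have "(\<Sum>i\<in>R. c i * A i j) = 0" if "j \<in> J" for j
  proof -
    have "(\<Sum>i\<in>R. c i * A i j) = (\<Sum>i\<in>R. c i * restr_map R (trunc_col A h j) i)"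
      by (rule sum.cong) (use assms(2) in \<open>auto simp: restr_map_def trunc_col_def\<close>)
    then show ?thesis using c(2) that by auto
  qed
  then show thesis using that c(1) by blast
qed

text \<open>
  With \<open>P = L A\<close> for a lower triangular \<open>L\<close>, the flag is encoded by \<open>L\<close> and \<open>\<tau>\<close>: its \<open>b\<close>-dimensional
  space is the common kernel of the rows \<open>\<tau> b, \<dots>, \<tau> (k - 1)\<close> of \<open>L\<close>, and columns of level less than
  \<open>b\<close> must lie in it. Only the spaces of dimension at least \<open>m\<close> are taken into account.
\<close>

definition echelon :: "nat \<Rightarrow> nat \<Rightarrow> (nat \<Rightarrow> nat) \<Rightarrow> (nat \<Rightarrow> nat) \<Rightarrow> nat \<Rightarrow> (nat \<Rightarrow> nat \<Rightarrow> complex) \<Rightarrow> bool" where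
  "echelon k n lev \<tau> m P \<longleftrightarrow> (\<forall>b j. m \<le> b \<and> b < k \<and> j < n \<and> lev j < b \<longrightarrow> P (\<tau> b) j = 0)"

text \<open>
  At the least row number \<open>h0 > \<sigma> m\<close> where the bound for \<open>m + 1\<close> is attained, the columns of level below
  \<open>m\<close> have too small a rank for the rows that are still free, so these rows satisfy a linear
  relation. The last row \<open>t\<close> occurring in it can be cleared, and minimality of \<open>h0\<close> preserves the bounds.
\<close>

lemma flag_step:
  assumes \<sigma>: "bij_betw \<sigma> {..<k} {..<k}" and m: "m < k"
    and rank: "\<And>h. h \<le> k \<Longrightarrow> rk A h {j. j < n \<and> lev j < m} \<le> nw \<sigma> m h"
    and L: "lower_tri k L" and \<tau>: "bij_betw \<tau> {..<k} {..<k}"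
    and dom: "\<And>m' h. Suc m \<le> m' \<Longrightarrow> m' \<le> k \<Longrightarrow> h \<le> k \<Longrightarrow> nw \<tau> m' h \<le> nw \<sigma> m' h"
    and ech: "echelon k n lev \<tau> (Suc m) (lapp L k A)"
  shows "\<exists>L \<tau>. lower_tri k L \<and> bij_betw \<tau> {..<k} {..<k} \<and>
    (\<forall>m' h. m \<le> m' \<and> m' \<le> k \<and> h \<le> k \<longrightarrow> nw \<tau> m' h \<le> nw \<sigma> m' h) \<and>
    echelon k n lev \<tau> m (lapp L k A)"
proof -
  let ?tight = "\<lambda>h. \<sigma> m < h \<and> h \<le> k \<and> nw \<tau> (Suc m) h = nw \<sigma> (Suc m) h"
  let ?J = "{j. j < n \<and> lev j < m}"
  have lt: "\<tau> b < k" "\<sigma> b < k" if "b < k" for b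
    using \<sigma> \<tau> that by (auto simp: bij_betw_def)
  have "nw \<upsilon> (Suc m) k = Suc m" if "\<And>b. b < k \<Longrightarrow> \<upsilon> b < k" for \<upsilon>
  proof -
    have "{b. b < Suc m \<and> \<upsilon> b < k} = {..<Suc m}" using that m by auto
    then show ?thesis by (simp add: nw_def)
  qed
  \<comment> \<open>At h = k both counts equal \<open>Suc m\<close>, so a tight row number exists
    and \<open>h0\<close> is well defined.\<close>
  then have "?tight k" using lt m by simp
  define h0 where "h0 = (LEAST h. ?tight h)"
  have h0: "?tight h0" unfolding h0_def by (rule LeastI[of ?tight k]) fact
  have not_tight: "nw \<tau> (Suc m) h < nw \<sigma> (Suc m) h" if "\<sigma> m < h" "h < h0" for h
  proof -
    have "\<not> ?tight h" using not_less_Least[of h ?tight] that unfolding h0_def by blast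
    then show ?thesis using dom[of "Suc m" h] that h0 m by auto
  qed
  \<comment> \<open>The rows at positions up to m carry no vanishing condition so far. Tightness and
    \<open>\<sigma> m < h0\<close> give \<open>card R = nw \<sigma> m h0 + 1\<close>, one more than
    the rank allowed for the columns of level below m.\<close>
  define R where "R = \<tau> ` {b. b < Suc m \<and> \<tau> b < h0}"
  have inj: "inj_on \<tau> {b. b < Suc m \<and> \<tau> b < h0}"
    by (rule inj_on_subset[OF bij_betw_imp_inj_on[OF \<tau>]]) (use m in auto)
  have R: "finite R" "R \<subseteq> {..<h0}" by (auto simp: R_def)
  have "rk (lapp L k A) h0 ?J \<le> nw \<sigma> m h0"
    using rk_lapp[OF L, of h0 ?J A] rank[of h0] h0 by simp
  also have "\<dots> < card R"
    using h0 nw_Suc[of \<sigma> m h0] card_image[OF inj] by (simp add: R_def nw_def)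
  finally have lt_card: "rk (lapp L k A) h0 ?J < card R" .
  have "finite ?J" by simp
  then obtain c where c: "\<exists>i\<in>R. c i \<noteq> 0"
      "\<And>j. j \<in> ?J \<Longrightarrow> (\<Sum>i\<in>R. c i * lapp L k A i j) = 0"
    using exists_row_relation[OF _ R(2) lt_card, of thesis] by blast
  \<comment> \<open>Since t is the last row with a nonzero coefficient, putting the whole
    combination in place of row t keeps L lower triangular, with diagonal entry
    \<open>c t * L t t\<close>.\<close>
  define t where "t = Max {i \<in> R. c i \<noteq> 0}"
  have tin: "t \<in> {i \<in> R. c i \<noteq> 0}" unfolding t_def using R c(1) by (intro Max_in) auto
  have tmax: "c i = 0" if "i \<in> R" "t < i" for i
  proof (rule ccontr)
    assume "c i \<noteq> 0"
    then have "i \<le> t" unfolding t_def using R that(1) by (intro Max_ge) auto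
    then show False using that(2) by simp
  qed
  from tin obtain c0 where c0: "c0 < Suc m" "\<tau> c0 = t" "t < h0" by (auto simp: R_def)
  have tk: "t < k" using c0 h0 by simp
  \<comment> \<open>The cleared row t moves to position m. Both swapped positions are at most m, so
    the conditions and counts beyond m are untouched.\<close>
  define \<tau>' where "\<tau>' = \<tau> \<circ> transpose m c0"
  define L' where "L' = L(t := (\<lambda>l. \<Sum>i\<in>R. c i * L i l))"
  have L0: "L i l = 0" if "i < l" "l < k" for i l
    using L that unfolding lower_tri_def by (meson order.strict_trans)
  have "lower_tri k L'"
    unfolding lower_tri_def
  proof (intro allI impI conjI)
    fix i assume i: "i < k"
    show "L' i i \<noteq> 0"
    proof (cases "i = t")
      case True
      have "(\<Sum>i\<in>R. c i * L i t) = (\<Sum>i\<in>{t}. c i * L i t)"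
      proof (rule sum.mono_neutral_right)
        show "\<forall>i\<in>R - {t}. c i * L i t = 0"
        proof
          fix i assume "i \<in> R - {t}"
          then show "c i * L i t = 0" using tmax[of i] L0[of i t] tk by (cases "t < i") auto
        qed
      qed (use tin R in auto)
      then show ?thesis using True tin L tk by (auto simp: L'_def lower_tri_def)
    qed (use L i in \<open>auto simp: L'_def lower_tri_def\<close>)
    fix l assume l: "l < k" "i < l"
    show "L' i l = 0"
    proof (cases "i = t")
      case True
      have "(\<Sum>i\<in>R. c i * L i l) = 0"
      proof (rule sum.neutral, rule)
        fix i assume "i \<in> R"
        then show "c i * L i l = 0" using tmax[of i] L0[of i l] l True by (cases "t < i") auto
      qed
      then show ?thesis using True by (simp add: L'_def)
    qed (use L0 l in \<open>auto simp: L'_def\<close>)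
  qed
  moreover have "bij_betw \<tau>' {..<k} {..<k}"
    unfolding \<tau>'_def using c0 m by (intro bij_betw_transpose_comp \<tau>) auto
  moreover have "nw \<tau>' m' h \<le> nw \<sigma> m' h" if "m \<le> m'" "m' \<le> k" "h \<le> k" for m' h
  proof (cases "m' = m")
    case False
    then have "nw \<tau>' m' h = nw \<tau> m' h"
      unfolding \<tau>'_def using that c0 by (intro nw_transpose) auto
    then show ?thesis using dom[of m' h] False that by auto
  next
    case True
    have "nw \<tau>' (Suc m) h = nw \<tau> (Suc m) h"
      unfolding \<tau>'_def using c0 by (intro nw_transpose) auto
    moreover have "\<tau>' m = t" using c0 by (simp add: \<tau>'_def)
    ultimately have "nw \<tau>' m h + (if t < h then 1 else 0) = nw \<tau> (Suc m) h"
      using nw_Suc[of \<tau>' m h] by simp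
    moreover have "nw \<tau> (Suc m) h \<le> nw \<sigma> (Suc m) h" using dom[of "Suc m" h] that m by auto
    \<comment> \<open>The only critical range is \<open>\<sigma> m < h \<le> t\<close>, where the
      bound loses one and the count does not. It lies below \<open>h0\<close>, so there was
      slack.\<close>
    moreover have "nw \<tau> (Suc m) h < nw \<sigma> (Suc m) h" if "\<sigma> m < h" "\<not> t < h"
      using not_tight[of h] that c0 by auto
    ultimately show ?thesis using nw_Suc[of \<sigma> m h] True by (auto split: if_splits)
  qed
  moreover have "echelon k n lev \<tau>' m (lapp L' k A)"
    unfolding echelon_def
  proof (intro allI impI)
    fix b j assume bj: "m \<le> b \<and> b < k \<and> j < n \<and> lev j < b"
    show "lapp L' k A (\<tau>' b) j = 0"
    proof (cases "b = m")
      case True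
      have "lapp L' k A t j = (\<Sum>l<k. \<Sum>i\<in>R. c i * L i l * A l j)"
        by (simp add: lapp_def L'_def sum_distrib_right)
      also have "\<dots> = (\<Sum>i\<in>R. \<Sum>l<k. c i * L i l * A l j)" by (rule sum.swap)
      also have "\<dots> = (\<Sum>i\<in>R. c i * lapp L k A i j)"
        unfolding lapp_def sum_distrib_left by (simp only: mult.assoc)
      also have "\<dots> = 0" using c(2)[of j] bj True by auto
      finally show ?thesis using True c0 by (simp add: \<tau>'_def)
    next
      case False
      then have "\<tau>' b = \<tau> b" using bj c0 by (simp add: \<tau>'_def transpose_def)
      moreover have "\<tau> b \<noteq> t"
      proof
        assume "\<tau> b = t"
        then have "b = c0"
          using bij_betw_lessThan_eq_iff[OF \<tau>, of b c0] c0 bj m by simp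
        then show False using bj False c0 by simp
      qed
      ultimately have "lapp L' k A (\<tau>' b) j = lapp L k A (\<tau> b) j" by (simp add: lapp_def L'_def)
      then show ?thesis using ech bj False by (auto simp: echelon_def)
    qed
  qed
  ultimately show ?thesis by blast
qed

text \<open>Downward induction on m. At m = k no vanishing is required, and the identity matrix with
  \<open>\<tau> = \<sigma>\<close> starts it.\<close>

lemma exists_echelon:
  assumes \<sigma>: "bij_betw \<sigma> {..<k} {..<k}"
    and rank: "\<And>m h. m \<le> k \<Longrightarrow> h \<le> k \<Longrightarrow> rk A h {j. j < n \<and> lev j < m} \<le> nw \<sigma> m h"
  obtains L \<tau> where "lower_tri k L" "bij_betw \<tau> {..<k} {..<k}"
    "\<And>m h. m \<le> k \<Longrightarrow> h \<le> k \<Longrightarrow> nw \<tau> m h \<le> nw \<sigma> m h" "echelon k n lev \<tau> 0 (lapp L k A)"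
proof -
  have "\<exists>L \<tau>. lower_tri k L \<and> bij_betw \<tau> {..<k} {..<k} \<and>
    (\<forall>m' h. m \<le> m' \<and> m' \<le> k \<and> h \<le> k \<longrightarrow> nw \<tau> m' h \<le> nw \<sigma> m' h) \<and>
    echelon k n lev \<tau> m (lapp L k A)" if "m \<le> k" for m
    using that
  proof (induction m rule: inc_induct)
    case base
    have "lower_tri k (\<lambda>i j. if i = j then 1 else 0)" by (auto simp: lower_tri_def)
    then show ?case using \<sigma> unfolding echelon_def by (intro exI[of _ "\<lambda>i j. if i = j then 1 else 0"] exI[of _ \<sigma>]) auto
  next
    case (step m)
    from step.IH obtain L \<tau> where "lower_tri k L" "bij_betw \<tau> {..<k} {..<k}"
      "\<And>m' h. Suc m \<le> m' \<Longrightarrow> m' \<le> k \<Longrightarrow> h \<le> k \<Longrightarrow> nw \<tau> m' h \<le> nw \<sigma> m' h"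
      "echelon k n lev \<tau> (Suc m) (lapp L k A)" by blast
    then show ?case using step.hyps rank[of m] by (intro flag_step[OF \<sigma>]) auto
  qed
  from this[of 0] show thesis using that by auto
qed

text \<open>
  Take for \<open>a\<close> the first position where \<open>\<tau>\<close> and \<open>\<sigma>\<close> differ and for \<open>b\<close> the first later position with
  \<open>\<sigma> a \<le> \<tau> b < \<tau> a\<close>.
\<close>

lemma bruhat_swap:
  assumes \<sigma>: "bij_betw \<sigma> {..<k} {..<k}" and \<tau>: "bij_betw \<tau> {..<k} {..<k}"
    and dom: "\<And>m h. m \<le> k \<Longrightarrow> h \<le> k \<Longrightarrow> nw \<tau> m h \<le> nw \<sigma> m h"
    and ne: "\<exists>c<k. \<tau> c \<noteq> \<sigma> c"
  obtains a b where "a < b" "b < k" "\<tau> b < \<tau> a"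
    "\<And>m h. m \<le> k \<Longrightarrow> h \<le> k \<Longrightarrow> nw (\<tau> \<circ> transpose a b) m h \<le> nw \<sigma> m h"
proof -
  define a where "a = (LEAST c. c < k \<and> \<tau> c \<noteq> \<sigma> c)"
  have a: "a < k" "\<tau> a \<noteq> \<sigma> a"
    using LeastI_ex[of "\<lambda>c. c < k \<and> \<tau> c \<noteq> \<sigma> c"] ne unfolding a_def by auto
  have pre: "\<tau> c = \<sigma> c" if "c < a" for c
    using not_less_Least[of c "\<lambda>c. c < k \<and> \<tau> c \<noteq> \<sigma> c"] that a(1) unfolding a_def[symmetric] by auto
  have lt: "\<tau> b < k" "\<sigma> b < k" if "b < k" for b
    using \<sigma> \<tau> that by (auto simp: bij_betw_def)
  \<comment> \<open>The permutations agree before a, so the comparison of counts at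
    \<open>Suc a\<close> columns and \<open>Suc (\<tau> a)\<close> rows decides.\<close>
  have \<sigma>\<tau>: "\<sigma> a < \<tau> a"
  proof -
    have "nw \<tau> (Suc a) (Suc (\<tau> a)) \<le> nw \<sigma> (Suc a) (Suc (\<tau> a))"
      using a lt by (intro dom) (auto simp: Suc_le_eq)
    moreover have "nw \<tau> a h = nw \<sigma> a h" for h by (rule nw_cong) (rule pre)
    ultimately have "\<sigma> a < Suc (\<tau> a)"
      using nw_Suc[of \<tau> a "Suc (\<tau> a)"] nw_Suc[of \<sigma> a "Suc (\<tau> a)"] by (auto split: if_splits)
    then show ?thesis using a by auto
  qed
  let ?Q = "\<lambda>b. a < b \<and> b < k \<and> \<sigma> a \<le> \<tau> b \<and> \<tau> b < \<tau> a"
  \<comment> \<open>The position where \<open>\<tau>\<close> takes the value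
    \<open>\<sigma> a\<close> qualifies: it cannot precede a, since \<open>\<tau>\<close> agrees
    with the injective \<open>\<sigma>\<close> there.\<close>
  have "\<exists>b. ?Q b"
  proof -
    have "\<sigma> a \<in> \<tau> ` {..<k}" using \<tau> lt a by (simp add: bij_betw_def)
    then obtain b where b: "b < k" "\<tau> b = \<sigma> a" by auto
    have "\<not> b < a"
    proof
      assume "b < a"
      then have "\<sigma> b = \<sigma> a" using pre b by simp
      then show False using bij_betw_lessThan_eq_iff[OF \<sigma>, of b a] \<open>b < a\<close> a b by simp
    qed
    moreover have "b \<noteq> a" using b a by auto
    ultimately show ?thesis using b \<sigma>\<tau> by (intro exI[of _ b]) auto
  qed
  define b where "b = (LEAST b. ?Q b)"
  have b: "?Q b" unfolding b_def by (rule LeastI_ex) fact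
  have bmin: "\<not> (\<sigma> a \<le> \<tau> c \<and> \<tau> c < \<tau> a)" if "a < c" "c < b" for c
    using not_less_Least[of c ?Q] that b unfolding b_def[symmetric] by auto
  let ?\<tau>' = "\<tau> \<circ> transpose a b"
  have "nw ?\<tau>' m h \<le> nw \<sigma> m h" if mh: "m \<le> k" "h \<le> k" for m h
  proof -
    consider "m \<le> a" | "b < m" | "a < m" "m \<le> b" by linarith
    then show ?thesis
    proof cases
      case 1
      then have "nw ?\<tau>' m h = nw \<tau> m h" using b by (intro nw_cong) (auto simp: transpose_def)
      then show ?thesis using dom mh by simp
    next
      case 2
      then have "nw ?\<tau>' m h = nw \<tau> m h" using b by (intro nw_transpose) auto
      then show ?thesis using dom mh by simp
    next
      case 3
      have same: "?\<tau>' c = \<tau> c" if "c < m" "c \<noteq> a" for c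
        using that 3 by (auto simp: transpose_def)
      have swapped: "?\<tau>' a = \<tau> b" by simp
      show ?thesis
      proof (cases "\<tau> b < h \<and> h \<le> \<tau> a")
        case False
        have "{c. c < m \<and> ?\<tau>' c < h} \<subseteq> {c. c < m \<and> \<tau> c < h}"
        proof
          fix c assume c: "c \<in> {c. c < m \<and> ?\<tau>' c < h}"
          show "c \<in> {c. c < m \<and> \<tau> c < h}"
          proof (cases "c = a")
            case True
            then have "\<tau> b < h" using c swapped by simp
            then show ?thesis using False True 3 by auto
          qed (use c same in auto)
        qed
        then have "nw ?\<tau>' m h \<le> nw \<tau> m h" unfolding nw_def by (intro card_mono) auto
        then show ?thesis using dom mh by (meson order.trans)
      next
        case True
        \<comment> \<open>By minimality of b, a position c < m other than a with
          \<open>\<sigma> a \<le> \<tau> c < h\<close> precedes a, where \<open>\<tau>\<close> and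
          \<open>\<sigma>\<close> agree; these form \<open>?X\<close>. Values below
          \<open>\<sigma> a\<close> are controlled by the old bound at row
          \<open>\<sigma> a\<close>, and a itself is counted for \<open>\<sigma>\<close> too,
          because \<open>\<sigma> a \<le> \<tau> b < h\<close>.\<close>
        let ?X = "{c. c < a \<and> \<sigma> a \<le> \<sigma> c \<and> \<sigma> c < h}"
        have "{c. c < m \<and> ?\<tau>' c < h} \<subseteq> insert a ({c. c < m \<and> \<tau> c < \<sigma> a} \<union> ?X)"
        proof
          fix c assume c: "c \<in> {c. c < m \<and> ?\<tau>' c < h}"
          show "c \<in> insert a ({c. c < m \<and> \<tau> c < \<sigma> a} \<union> ?X)"
          proof (cases "c = a")
            case False
            then have "\<tau> c < h" "c < m" using c same by auto
            moreover have "c < a" if "\<sigma> a \<le> \<tau> c"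
              using bmin[of c] that False \<open>\<tau> c < h\<close> True \<open>c < m\<close> 3 by (cases "a < c") auto
            ultimately show ?thesis using pre[of c] by (auto simp: not_less)
          qed simp
        qed
        then have "nw ?\<tau>' m h \<le> card (insert a ({c. c < m \<and> \<tau> c < \<sigma> a} \<union> ?X))"
          unfolding nw_def by (intro card_mono) auto
        also have "\<dots> \<le> Suc (card ({c. c < m \<and> \<tau> c < \<sigma> a} \<union> ?X))"
          by (simp add: card_insert_if)
        also have "\<dots> \<le> Suc (nw \<tau> m (\<sigma> a) + card ?X)"
          unfolding nw_def by (simp add: card_Un_le)
        also have "\<dots> \<le> Suc (nw \<sigma> m (\<sigma> a) + card ?X)"
          using dom[of m "\<sigma> a"] mh lt[of a] a by simp
        also have "\<dots> = card (insert a ({c. c < m \<and> \<sigma> c < \<sigma> a} \<union> ?X))"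
        proof -
          have "card ({c. c < m \<and> \<sigma> c < \<sigma> a} \<union> ?X) = nw \<sigma> m (\<sigma> a) + card ?X"
            unfolding nw_def by (rule card_Un_disjoint) auto
          then show ?thesis by simp
        qed
        also have "\<dots> \<le> nw \<sigma> m h"
          unfolding nw_def by (rule card_mono) (use 3 True b \<sigma>\<tau> in auto)
        finally show ?thesis .
      qed
    qed
  qed
  then show thesis using that[of a b] b by blast
qed

text \<open>The rearrangement inequality for two terms: the larger value moves to the later
  position. It supplies the termination measure of \<open>bruhat_chain\<close>.\<close>

lemma sum_transpose_less:
  assumes "a < b" "b < k" "\<tau> b < \<tau> (a::nat)"
  shows "(\<Sum>c<k. c * \<tau> c) < (\<Sum>c<k. c * (\<tau> \<circ> transpose a b) c :: nat)"
proof -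
  let ?R = "{..<k} - {a, b}"
  have split: "(\<Sum>c<k. f c) = f a + f b + (\<Sum>c\<in>?R. f c)" for f :: "nat \<Rightarrow> nat"
  proof -
    have "(\<Sum>c<k. f c) = (\<Sum>c\<in>{a, b}. f c) + (\<Sum>c\<in>?R. f c)"
      using assms by (subst add.commute, intro sum.subset_diff) auto
    then show ?thesis using assms by simp
  qed
  have "(\<Sum>c\<in>?R. c * (\<tau> \<circ> transpose a b) c) = (\<Sum>c\<in>?R. c * \<tau> c)"
    by (rule sum.cong) (auto simp: transpose_def)
  moreover have "a * \<tau> a + b * \<tau> b < a * \<tau> b + b * \<tau> a"
  proof -
    obtain d where d: "b = a + d" "0 < d" using assms(1) less_imp_add_positive by blast
    have "d * \<tau> b < d * \<tau> a" using d assms by simp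
    then show ?thesis by (simp add: d distrib_right)
  qed
  ultimately show ?thesis unfolding split[of "\<lambda>c. c * \<tau> c"] split[of "\<lambda>c. c * (\<tau> \<circ> transpose a b) c"]
    by simp
qed

text \<open>Induction on the gap between the weighted sum and the crude bound
  \<open>k * (k * k)\<close>. The result agrees with \<open>\<sigma>\<close> below k only, since
  values elsewhere are arbitrary.\<close>

lemma bruhat_chain:
  assumes \<sigma>: "bij_betw \<sigma> {..<k} {..<k}" and \<tau>: "bij_betw \<tau> {..<k} {..<k}"
    and dom: "\<And>m h. m \<le> k \<Longrightarrow> h \<le> k \<Longrightarrow> nw \<tau> m h \<le> nw \<sigma> m h"
    and P: "P \<tau>"
    and step: "\<And>\<tau> a b. bij_betw \<tau> {..<k} {..<k} \<Longrightarrow> P \<tau> \<Longrightarrow> a < b \<Longrightarrow> b < k \<Longrightarrow> \<tau> b < \<tau> a \<Longrightarrow>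
      P (\<tau> \<circ> transpose a b)"
  obtains \<tau>' where "P \<tau>'" "\<And>c. c < k \<Longrightarrow> \<tau>' c = \<sigma> c"
proof -
  have "\<exists>\<tau>'. P \<tau>' \<and> (\<forall>c<k. \<tau>' c = \<sigma> c)"
    using \<tau> dom P
  proof (induction "k * (k * k) - (\<Sum>c<k. c * \<tau> c)" arbitrary: \<tau> rule: less_induct)
    case less
    show ?case
    proof (cases "\<exists>c<k. \<tau> c \<noteq> \<sigma> c")
      case True
      obtain a b where ab: "a < b" "b < k" "\<tau> b < \<tau> a"
        "\<And>m h. m \<le> k \<Longrightarrow> h \<le> k \<Longrightarrow> nw (\<tau> \<circ> transpose a b) m h \<le> nw \<sigma> m h"
        using bruhat_swap[OF \<sigma> less.prems(1,2) True] by blast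
      let ?\<tau>' = "\<tau> \<circ> transpose a b"
      have bij: "bij_betw ?\<tau>' {..<k} {..<k}"
        using ab by (intro bij_betw_transpose_comp less.prems) auto
      have bound: "(\<Sum>c<k. c * ?\<tau>' c) \<le> k * (k * k)"
      proof -
        have "c * ?\<tau>' c \<le> k * k" if "c < k" for c
        proof -
          have "?\<tau>' c < k" using bij that unfolding bij_betw_def by blast
          then show ?thesis using that by (intro mult_le_mono) auto
        qed
        then show ?thesis using sum_bounded_above[of "{..<k}" "\<lambda>c. c * ?\<tau>' c" "k * k"] by simp
      qed
      have "k * (k * k) - (\<Sum>c<k. c * ?\<tau>' c) < k * (k * k) - (\<Sum>c<k. c * \<tau> c)"
        using sum_transpose_less[OF ab(1-3)] bound by linarith
      then show ?thesis
        using less.hyps[OF _ bij ab(4) step[OF less.prems(1,3) ab(1-3)]] by blast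
    qed (use less in blast)
  qed
  then show thesis using that by blast
qed

section \<open>Degenerations along lines\<close>

lemma lapp_add_scale: "lapp L k (\<lambda>i j. A i j + s * N i j) i j = lapp L k A i j + s * lapp L k N i j"
proof -
  have "(\<Sum>l<k. L i l * (A l j + s * N l j)) = (\<Sum>l<k. L i l * A l j + s * (L i l * N l j))"
    by (rule sum.cong) (simp_all only: distrib_left mult.left_commute)
  then show ?thesis by (simp only: lapp_def sum.distrib sum_distrib_left)
qed

text \<open>
  Adding \<open>s\<close> times row \<open>\<tau> a\<close> of \<open>L A\<close> to row \<open>\<tau> b\<close> moves along a line; for \<open>s \<noteq> 0\<close> the new row \<open>\<tau> b\<close>
  lies above row \<open>\<tau> a\<close> and can be used to clear it, which exchanges the roles of the two rows.
\<close>

lemma echelon_swap: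
  assumes \<tau>: "bij_betw \<tau> {..<k} {..<k}" and ab: "a < b" "b < k" "\<tau> b < \<tau> a"
    and L: "lower_tri k L" and ech: "echelon k n lev \<tau> 0 (lapp L k A)"
  obtains N where "\<And>s. s \<noteq> 0 \<Longrightarrow> \<exists>L'. lower_tri k L' \<and>
    echelon k n lev (\<tau> \<circ> transpose a b) 0 (lapp L' k (\<lambda>i j. A i j + s * N i j))"
proof -
  let ?P = "lapp L k A"
  have lt: "\<tau> c < k" if "c < k" for c
    using \<tau> that by (auto simp: bij_betw_def)
  have neq: "\<tau> c \<noteq> \<tau> d" if "c < k" "d < k" "c \<noteq> d" for c d
    using bij_betw_lessThan_eq_iff[OF \<tau>, of c d] that by simp
  have P0: "?P (\<tau> c) j = 0" if "c < k" "j < n" "lev j < c" for c j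
    using ech that by (auto simp: echelon_def)
  \<comment> \<open>N is the direction for which L N has row \<open>\<tau> a\<close> of L A in place
    \<open>\<tau> b\<close> and zeros elsewhere.\<close>
  obtain N where N: "\<And>i j. i < k \<Longrightarrow> lapp L k N i j = (if i = \<tau> b then ?P (\<tau> a) j else 0)"
    using lower_tri_solve[OF L, of "\<lambda>i j. if i = \<tau> b then ?P (\<tau> a) j else 0" thesis] by blast
  show thesis
  proof (rule that)
    fix s :: complex assume s: "s \<noteq> 0"
    let ?A = "\<lambda>i j. A i j + s * N i j"
    have PA: "lapp L k ?A i j = ?P i j + s * (if i = \<tau> b then ?P (\<tau> a) j else 0)" if "i < k" for i j
      by (simp only: lapp_add_scale N[OF that])
    define L' where "L' = L(\<tau> a := (\<lambda>l. L (\<tau> a) l - inverse s * L (\<tau> b) l))"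
    have "lower_tri k L'"
      using L ab lt[of b] unfolding lower_tri_def L'_def by auto
    moreover have row_a: "lapp L' k ?A (\<tau> a) j = - inverse s * ?P (\<tau> b) j" for j
    proof -
      have "lapp L' k ?A (\<tau> a) j = (\<Sum>l<k. L (\<tau> a) l * ?A l j - inverse s * (L (\<tau> b) l * ?A l j))"
        unfolding lapp_def L'_def by (rule sum.cong) (simp_all add: left_diff_distrib)
      also have "\<dots> = lapp L k ?A (\<tau> a) j - inverse s * lapp L k ?A (\<tau> b) j"
        unfolding lapp_def by (simp only: sum_subtractf sum_distrib_left)
      also have "\<dots> = - inverse s * ?P (\<tau> b) j"
        using PA[of "\<tau> a" j] PA[of "\<tau> b" j] lt ab s by (simp add: distrib_left)
      finally show ?thesis .
    qed
    have row: "lapp L' k ?A i j = ?P i j + s * (if i = \<tau> b then ?P (\<tau> a) j else 0)"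
      if "i < k" "i \<noteq> \<tau> a" for i j
      using PA[OF that(1), of j] that(2) by (simp add: lapp_def L'_def)
    \<comment> \<open>Position a now holds row \<open>\<tau> b\<close>, a sum of multiples of both
      old rows, which vanish on levels below a. Position b holds row \<open>\<tau> a\<close>, by now
      a multiple of the old row \<open>\<tau> b\<close>, which vanishes on levels below b.\<close>
    have "echelon k n lev (\<tau> \<circ> transpose a b) 0 (lapp L' k ?A)"
      unfolding echelon_def
    proof (intro allI impI)
      fix c j assume c: "0 \<le> c \<and> c < k \<and> j < n \<and> lev j < c"
      consider "c = a" | "c = b" | "c \<noteq> a" "c \<noteq> b" by blast
      then show "lapp L' k ?A ((\<tau> \<circ> transpose a b) c) j = 0"
      proof cases
        case 1
        then show ?thesis using row[of "\<tau> b" j] lt ab c P0[of a j] P0[of b j] by simp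
      next
        case 2
        then show ?thesis using row_a[of j] c P0[of b j] by simp
      next
        case 3
        then show ?thesis using row[of "\<tau> c" j] lt neq[of c a] neq[of c b] ab c P0[of c j] by simp
      qed
    qed
    ultimately show "\<exists>L'. lower_tri k L' \<and> echelon k n lev (\<tau> \<circ> transpose a b) 0 (lapp L' k ?A)" by blast
  qed
qed

text \<open>Exactly the part of openness that the degenerations use, stated for arbitrary functions
  so that no topology on matrices enters.\<close>

definition line_open :: "((nat \<Rightarrow> nat \<Rightarrow> complex) \<Rightarrow> bool) \<Rightarrow> bool" where
  "line_open U \<longleftrightarrow> (\<forall>A N. U A \<longrightarrow> (\<exists>\<epsilon>>0. \<forall>s. cmod s < \<epsilon> \<longrightarrow> U (\<lambda>i j. A i j + s * N i j)))"

text \<open>The disc of admissible parameters contains infinitely many positive reals, so 0 and a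
  finite set F can be avoided.\<close>

lemma line_open_avoid:
  assumes "line_open U" "U A" "finite F"
  obtains s where "s \<noteq> 0" "s \<notin> F" "U (\<lambda>i j. A i j + s * N i j)"
proof -
  obtain \<epsilon> where \<epsilon>: "\<epsilon> > 0" "\<And>s. cmod s < \<epsilon> \<Longrightarrow> U (\<lambda>i j. A i j + s * N i j)"
    using assms(1,2) unfolding line_open_def by blast
  have "infinite (complex_of_real ` {0<..<\<epsilon>})"
    using \<epsilon>(1) infinite_Ioo[of 0 \<epsilon>] by (subst finite_image_iff) (auto simp: inj_on_def)
  then obtain s where s: "s \<in> complex_of_real ` {0<..<\<epsilon>}" "s \<notin> F"
    using assms(3) by (meson finite_subset subsetI)
  then have "s \<noteq> 0" "cmod s < \<epsilon>" by auto
  then show thesis using that s(2) \<epsilon>(2) by blast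
qed

text \<open>The vanishing part puts column j into the flag space of dimension
  \<open>lev j + 1\<close>; the nonzero entry keeps it out of the space of dimension
  \<open>lev j\<close>.\<close>

definition cell_shape :: "nat \<Rightarrow> nat \<Rightarrow> (nat \<Rightarrow> nat) \<Rightarrow> (nat \<Rightarrow> nat) \<Rightarrow> (nat \<Rightarrow> nat \<Rightarrow> complex) \<Rightarrow> bool" where
  "cell_shape k n lev \<sigma> P \<longleftrightarrow> echelon k n lev \<sigma> 0 P \<and> (\<forall>j<n. P (\<sigma> (lev j)) j \<noteq> 0)"

theorem exists_cell_shape:
  assumes \<sigma>: "bij_betw \<sigma> {..<k} {..<k}" and lev: "\<And>j. j < n \<Longrightarrow> lev j < k"
    and rank: "\<And>m h. m \<le> k \<Longrightarrow> h \<le> k \<Longrightarrow> rk A h {j. j < n \<and> lev j < m} \<le> nw \<sigma> m h"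
    and U: "line_open U" "U A"
  obtains B L where "U B" "lower_tri k L" "cell_shape k n lev \<sigma> (lapp L k B)"
proof -
  obtain L \<tau> where L: "lower_tri k L" "bij_betw \<tau> {..<k} {..<k}"
    "\<And>m h. m \<le> k \<Longrightarrow> h \<le> k \<Longrightarrow> nw \<tau> m h \<le> nw \<sigma> m h" "echelon k n lev \<tau> 0 (lapp L k A)"
    using exists_echelon[OF \<sigma> rank, where thesis = thesis] by blast
  \<comment> \<open>The invariant carried along the Bruhat chain: some matrix in the neighbourhood U
    has a flag of type \<open>\<tau>\<close>.\<close>
  let ?Q = "\<lambda>\<tau>. \<exists>B L. U B \<and> lower_tri k L \<and> echelon k n lev \<tau> 0 (lapp L k B)"
  have step: "?Q (\<tau> \<circ> transpose a b)"
    if \<tau>: "bij_betw \<tau> {..<k} {..<k}" and Q: "?Q \<tau>" and ab: "a < b" "b < k" "\<tau> b < \<tau> a" for \<tau> a b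
  proof -
    obtain B L where BL: "U B" "lower_tri k L" "echelon k n lev \<tau> 0 (lapp L k B)" using Q by blast
    obtain N where N: "\<And>s. s \<noteq> 0 \<Longrightarrow> \<exists>L'. lower_tri k L' \<and>
      echelon k n lev (\<tau> \<circ> transpose a b) 0 (lapp L' k (\<lambda>i j. B i j + s * N i j))"
      using echelon_swap[OF \<tau> ab BL(2,3), of thesis] by blast
    obtain s where "s \<noteq> 0" "U (\<lambda>i j. B i j + s * N i j)"
      using line_open_avoid[OF U(1) BL(1) finite.emptyI, where N = N and thesis = thesis] by blast
    then show ?thesis using N by blast
  qed
  have "?Q \<tau>" using L U by blast
  then obtain \<tau>' where \<tau>': "?Q \<tau>'" "\<And>c. c < k \<Longrightarrow> \<tau>' c = \<sigma> c"
    using bruhat_chain[OF \<sigma> L(2,3), of ?Q thesis] step by blast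
  then obtain B L where B: "U B" "lower_tri k L" "echelon k n lev \<sigma> 0 (lapp L k B)"
    unfolding echelon_def by auto
  \<comment> \<open>All pivot entries are shifted by the same s. The entries required to vanish stay
    zero because \<open>\<sigma>\<close> is injective, and each column excludes a single value of
    s.\<close>
  let ?E = "\<lambda>i j. if i = \<sigma> (lev j) then 1 else 0 :: complex"
  obtain N where N: "\<And>i j. i < k \<Longrightarrow> lapp L k N i j = ?E i j"
    using lower_tri_solve[OF B(2), of ?E thesis] by blast
  obtain s where s: "s \<notin> (\<lambda>j. - lapp L k B (\<sigma> (lev j)) j) ` {..<n}" "U (\<lambda>i j. B i j + s * N i j)"
    using line_open_avoid[OF U(1) B(1) finite_imageI[OF finite_lessThan], where N = N and thesis = thesis] by blast
  have \<sigma>k: "\<sigma> c < k" if "c < k" for c using \<sigma> that by (auto simp: bij_betw_def)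
  have neq: "\<sigma> c \<noteq> \<sigma> d" if "c < k" "d < k" "c \<noteq> d" for c d
    using bij_betw_lessThan_eq_iff[OF \<sigma>, of c d] that by simp
  let ?P = "lapp L k (\<lambda>i j. B i j + s * N i j)"
  have P: "?P i j = lapp L k B i j + s * ?E i j" if "i < k" for i j
    by (simp only: lapp_add_scale N[OF that])
  have "cell_shape k n lev \<sigma> ?P"
    unfolding cell_shape_def echelon_def
  proof (intro conjI allI impI)
    fix b j assume bj: "0 \<le> b \<and> b < k \<and> j < n \<and> lev j < b"
    then show "?P (\<sigma> b) j = 0"
      using P[of "\<sigma> b" j] \<sigma>k[of b] neq[of b "lev j"] lev[of j] B(3) by (simp add: echelon_def)
  next
    fix j assume j: "j < n"
    then have "s \<noteq> - lapp L k B (\<sigma> (lev j)) j" using s(1) by auto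
    then show "?P (\<sigma> (lev j)) j \<noteq> 0"
      using P[of "\<sigma> (lev j)" j] \<sigma>k lev[OF j] by (simp add: add_eq_0_iff)
  qed
  then show thesis using that s(2) B(2) by blast
qed

text \<open>The vectors are triangular with respect to the order \<open>\<sigma> 0\<close>,
  \<open>\<sigma> 1\<close>, and so on, with nonzero pivots, so elimination yields the unit
  vectors.\<close>

lemma span_triangular:
  fixes a :: nat
  assumes "\<And>b i. b < a \<Longrightarrow> i \<notin> \<sigma> ` {..b} \<Longrightarrow> p b i = 0" "\<And>b. b < a \<Longrightarrow> p b (\<sigma> b) \<noteq> (0::complex)"
  shows "fv.span (p ` {..<a}) = fv.span (unit_fun ` \<sigma> ` {..<a})"
  using assms
proof (induction a)
  case (Suc a)
  have IH: "fv.span (p ` {..<a}) = fv.span (unit_fun ` \<sigma> ` {..<a})"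
    by (rule Suc.IH) (use Suc.prems in auto)
  let ?T = "p ` {..<Suc a}"
  have pa: "p a \<in> fv.span (unit_fun ` \<sigma> ` {..<Suc a})"
    by (rule in_span_unit_fun) (use Suc.prems(1)[of a] in \<open>auto simp: lessThan_Suc_atMost\<close>)
  \<comment> \<open>The part of \<open>p a\<close> on earlier pivots, which lies in the span by
    induction; what is left is a multiple of one unit vector. Excluding \<open>\<sigma> a\<close>
    covers a repeated value of \<open>\<sigma>\<close>.\<close>
  define r where "r = (\<lambda>i. if i \<in> \<sigma> ` {..<a} \<and> i \<noteq> \<sigma> a then p a i else 0)"
  have "r \<in> fv.span (unit_fun ` \<sigma> ` {..<a})"
    by (rule in_span_unit_fun) (auto simp: r_def)
  moreover have m1: "fv.span (p ` {..<a}) \<subseteq> fv.span ?T" by (rule fv.span_mono) auto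
  ultimately have "r \<in> fv.span ?T" using IH by blast
  then have "(\<lambda>i. inverse (p a (\<sigma> a)) * (p a - r) i) \<in> fv.span ?T"
    by (intro fv.span_scale fv.span_diff) (auto intro: fv.span_base)
  moreover have "(\<lambda>i. inverse (p a (\<sigma> a)) * (p a - r) i) = unit_fun (\<sigma> a)"
  proof
    fix i
    show "inverse (p a (\<sigma> a)) * (p a - r) i = unit_fun (\<sigma> a) i"
      using Suc.prems(1)[of a i] Suc.prems(2)[of a]
      by (auto simp: r_def unit_fun_def atMost_Suc lessThan_Suc_atMost[symmetric] lessThan_Suc)
  qed
  ultimately have ua: "unit_fun (\<sigma> a) \<in> fv.span ?T" by simp
  show ?case
  proof (rule fv.span_eq[THEN iffD2], rule conjI)
    show "?T \<subseteq> fv.span (unit_fun ` \<sigma> ` {..<Suc a})"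
    proof -
      have "p ` {..<a} \<subseteq> fv.span (unit_fun ` \<sigma> ` {..<Suc a})"
        using fv.span_superset[of "p ` {..<a}"] IH
          fv.span_mono[OF image_mono[OF image_mono[OF lessThan_subset_iff[THEN iffD2, OF le_SucI[OF order.refl[of a]]]]],
            of unit_fun \<sigma>] by blast
      then show ?thesis using pa by (simp add: lessThan_Suc)
    qed
    have "unit_fun ` \<sigma> ` {..<a} \<subseteq> fv.span ?T"
      using fv.span_superset[of "unit_fun ` \<sigma> ` {..<a}"] IH m1 by blast
    then show "unit_fun ` \<sigma> ` {..<Suc a} \<subseteq> fv.span ?T" using ua by (simp add: lessThan_Suc)
  qed
qed simp

text \<open>\<open>js\<close> picks one column of each level as a pivot column. It is later
  instantiated by the first occurrences of the letters, and P by L A.\<close>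

locale shape =
  fixes k n :: nat and lev \<sigma> js :: "nat \<Rightarrow> nat" and P :: "nat \<Rightarrow> nat \<Rightarrow> complex"
  assumes \<sigma>: "bij_betw \<sigma> {..<k} {..<k}"
    and lev: "\<And>j. j < n \<Longrightarrow> lev j < k"
    and js: "\<And>b. b < k \<Longrightarrow> js b < n" "\<And>b. b < k \<Longrightarrow> lev (js b) = b"
    and P: "cell_shape k n lev \<sigma> P"
begin

lemma col_support:
  assumes "j < n" "i \<notin> \<sigma> ` {..lev j}"
  shows "trunc_col P k j i = 0"
proof (cases "i < k")
  case True
  then obtain b where b: "b < k" "i = \<sigma> b" using \<sigma> unfolding bij_betw_def by (metis imageE lessThan_iff)
  then have "lev j < b" using assms(2) by (auto simp: not_le)
  then show ?thesis using P assms(1) b by (auto simp: cell_shape_def echelon_def trunc_col_def)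
qed (simp add: trunc_col_def)

lemma col_pivot:
  assumes "j < n"
  shows "trunc_col P k j (\<sigma> (lev j)) \<noteq> 0"
  using P assms lev[of j] \<sigma> by (auto simp: cell_shape_def trunc_col_def bij_betw_def)

lemma span_pivots:
  assumes "a \<le> k"
  shows "fv.span (trunc_col P k ` js ` {..<a}) = fv.span (unit_fun ` \<sigma> ` {..<a})"
  unfolding image_image[of "trunc_col P k" js]
proof (rule span_triangular)
  fix b assume "b < a"
  then have b: "js b < n" "lev (js b) = b" using js assms by auto
  show "trunc_col P k (js b) (\<sigma> b) \<noteq> 0" using col_pivot[OF b(1)] b(2) by simp
  show "trunc_col P k (js b) i = 0" if "i \<notin> \<sigma> ` {..b}" for i
    using col_support[OF b(1)] b(2) that by simp
qed

lemma col_in_span_iff: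
  assumes "j < n" "a \<le> k"
  shows "trunc_col P k j \<in> fv.span (trunc_col P k ` js ` {..<a}) \<longleftrightarrow> lev j < a"
proof -
  have "trunc_col P k j \<in> fv.span (unit_fun ` \<sigma> ` {..<a}) \<longleftrightarrow> lev j < a"
  proof
    assume "trunc_col P k j \<in> fv.span (unit_fun ` \<sigma> ` {..<a})"
    then have "\<sigma> (lev j) \<in> \<sigma> ` {..<a}"
      using span_unit_fun_iff[of "\<sigma> ` {..<a}"] col_pivot[OF assms(1)] by auto
    then obtain c where "c < a" "\<sigma> (lev j) = \<sigma> c" by auto
    then show "lev j < a" using bij_betw_lessThan_eq_iff[OF \<sigma>, of "lev j" c] lev[OF assms(1)] assms(2) by simp
  next
    assume "lev j < a"
    then have "\<sigma> ` {..lev j} \<subseteq> \<sigma> ` {..<a}" by auto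
    then show "trunc_col P k j \<in> fv.span (unit_fun ` \<sigma> ` {..<a})"
      using col_support[OF assms(1)] by (intro in_span_unit_fun) (simp, blast)
  qed
  then show ?thesis by (simp only: span_pivots[OF assms(2)])
qed

text \<open>The first a pivot columns span a coordinate subspace; truncation to h rows keeps exactly
  the coordinates below h.\<close>

lemma rk_pivots:
  assumes "a \<le> k" "h \<le> k"
  shows "rk P h (js ` {..<a}) = nw \<sigma> a h"
proof -
  let ?R = "\<sigma> ` {b. b < a \<and> \<sigma> b < h}"
  have "fv.span (trunc_col P h ` js ` {..<a}) = trunc_map h ` fv.span (trunc_col P k ` js ` {..<a})"
    using fvp.linear_span_image[OF linear_trunc_map, of h "trunc_col P k ` js ` {..<a}"]
    by (simp only: trunc_map_image[OF assms(2)])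
  also have "\<dots> = trunc_map h ` fv.span (unit_fun ` \<sigma> ` {..<a})" by (simp only: span_pivots[OF assms(1)])
  also have "\<dots> = fv.span (unit_fun ` ?R)"
  proof (rule Set.set_eqI)
    fix x
    have "x \<in> trunc_map h ` fv.span (unit_fun ` \<sigma> ` {..<a}) \<longleftrightarrow> (\<forall>i. i \<notin> ?R \<longrightarrow> x i = 0)"
    proof
      assume "x \<in> trunc_map h ` fv.span (unit_fun ` \<sigma> ` {..<a})"
      then obtain y where y: "\<forall>i. i \<notin> \<sigma> ` {..<a} \<longrightarrow> y i = 0" "x = trunc_map h y"
        using span_unit_fun_iff[of "\<sigma> ` {..<a}"] by auto
      show "\<forall>i. i \<notin> ?R \<longrightarrow> x i = 0"
      proof (intro allI impI)
        fix i assume "i \<notin> ?R"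
        then show "x i = 0" using y by (cases "i < h") (auto simp: trunc_map_def)
      qed
    next
      assume x: "\<forall>i. i \<notin> ?R \<longrightarrow> x i = 0"
      have "x i = 0" if "\<not> i < h" for i
        by (rule x[rule_format]) (use that in auto)
      then have "x = trunc_map h x" by (auto simp: trunc_map_def fun_eq_iff)
      moreover have "x \<in> fv.span (unit_fun ` \<sigma> ` {..<a})"
        using x by (intro in_span_unit_fun) auto
      ultimately show "x \<in> trunc_map h ` fv.span (unit_fun ` \<sigma> ` {..<a})" by (rule image_eqI)
    qed
    also have "\<dots> \<longleftrightarrow> x \<in> fv.span (unit_fun ` ?R)" using span_unit_fun_iff[of ?R x] by simp
    finally show "x \<in> trunc_map h ` fv.span (unit_fun ` \<sigma> ` {..<a}) \<longleftrightarrow> x \<in> fv.span (unit_fun ` ?R)" .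
  qed
  finally have "rk P h (js ` {..<a}) = fv.dim (unit_fun ` ?R)" unfolding rk_def by (rule fv.span_eq_dim)
  also have "\<dots> = card ?R" by (simp add: dim_unit_fun)
  also have "\<dots> = nw \<sigma> a h"
    unfolding nw_def using assms(1) by (intro card_image inj_on_subset[OF bij_betw_imp_inj_on[OF \<sigma>]]) auto
  finally show ?thesis .
qed

end

section \<open>Words and cells\<close>

definition firsts :: "nat list \<Rightarrow> nat list" where
  "firsts v = filter (\<lambda>j. v ! j \<notin> set (take j v)) [0..<length v]"

definition level :: "nat list \<Rightarrow> nat \<Rightarrow> nat" where
  "level v j = (LEAST b. v ! (firsts v ! b) = v ! j)"

definition letter :: "nat list \<Rightarrow> nat \<Rightarrow> nat" where
  "letter v b = v ! (firsts v ! b)"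

lemma sorted_firsts: "sorted_wrt (<) (firsts v)"
  unfolding firsts_def by (rule sorted_wrt_filter) simp

lemma distinct_firsts: "distinct (firsts v)"
  by (simp add: firsts_def)

lemma set_firsts: "set (firsts v) = {j. j < length v \<and> v ! j \<notin> set (take j v)}"
  by (auto simp: firsts_def)

lemma firsts_less: "j \<in> set (firsts v) \<Longrightarrow> j < length v"
  by (simp add: set_firsts)

lemma in_set_take: "i < j \<Longrightarrow> j \<le> length v \<Longrightarrow> v ! i \<in> set (take j v)"
  by (auto simp: in_set_conv_nth intro!: exI[of _ i])

lemma inj_on_firsts: "inj_on ((!) v) (set (firsts v))"
proof (rule inj_onI)
  fix x y assume "x \<in> set (firsts v)" "y \<in> set (firsts v)" "v ! x = v ! y"
  then show "x = y"
    using in_set_take[of x y v] in_set_take[of y x v] by (cases x y rule: linorder_cases) (auto simp: set_firsts)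
qed

lemma first_occurrence:
  assumes "j < length v"
  obtains i where "i \<in> set (firsts v)" "i \<le> j" "v ! i = v ! j"
proof -
  define i where "i = (LEAST i. v ! i = v ! j)"
  have i: "v ! i = v ! j" unfolding i_def by (rule LeastI[of "\<lambda>i. v ! i = v ! j" j]) simp
  have le: "i \<le> j" unfolding i_def by (rule Least_le) simp
  have "v ! i \<notin> set (take i v)"
  proof
    assume "v ! i \<in> set (take i v)"
    then obtain l where "l < i" "v ! l = v ! i" by (auto simp: in_set_conv_nth)
    then show False using not_less_Least[of l "\<lambda>i. v ! i = v ! j"] i unfolding i_def by simp
  qed
  then show thesis using that i le assms by (simp add: set_firsts)
qed

context
  fixes v :: "nat list" and n k :: nat
  assumes v: "v \<in> fubini_words n k"
begin

lemma length_word: "length v = n"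
  using v by (simp add: fubini_words_def)

lemma bij_betw_firsts: "bij_betw ((!) v) (set (firsts v)) {..<k}"
proof -
  have "(!) v ` set (firsts v) = {..<k}"
  proof
    show "(!) v ` set (firsts v) \<subseteq> {..<k}"
      using v by (auto simp: fubini_words_def dest: firsts_less nth_mem)
    show "{..<k} \<subseteq> (!) v ` set (firsts v)"
    proof
      fix c assume "c \<in> {..<k}"
      then have "c \<in> set v" using v by (simp add: fubini_words_def)
      then obtain j where j: "j < length v" "v ! j = c" by (auto simp: in_set_conv_nth)
      obtain i where "i \<in> set (firsts v)" "v ! i = v ! j" using j(1) by (rule first_occurrence)
      then show "c \<in> (!) v ` set (firsts v)" by (intro image_eqI[of _ _ i]) (simp_all add: j)
    qed
  qed
  then show ?thesis using inj_on_firsts by (simp add: bij_betw_def)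
qed

lemma length_firsts: "length (firsts v) = k"
  using bij_betw_same_card[OF bij_betw_firsts] distinct_card[OF distinct_firsts, of v] by simp

lemma bij_betw_letter: "bij_betw (letter v) {..<k} {..<k}"
proof -
  have "bij_betw ((!) (firsts v)) {..<k} (set (firsts v))"
    using bij_betw_nth[OF distinct_firsts, of "{..<k}" v "set (firsts v)"] length_firsts by auto
  from bij_betw_trans[OF this bij_betw_firsts] show ?thesis by (simp add: comp_def letter_def[abs_def])
qed

lemma letter_eq_iff: "b < k \<Longrightarrow> c < k \<Longrightarrow> letter v b = letter v c \<longleftrightarrow> b = c"
  using bij_betw_lessThan_eq_iff[OF bij_betw_letter, of b c] by simp

lemma letter_less: "b < k \<Longrightarrow> letter v b < k"
  using bij_betw_letter unfolding bij_betw_def by blast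

lemma level_props:
  assumes "j < n"
  shows "level v j < k" "letter v (level v j) = v ! j" "firsts v ! level v j \<le> j"
proof -
  obtain i where i: "i \<in> set (firsts v)" "i \<le> j" "v ! i = v ! j"
    using first_occurrence[of j v thesis] assms length_word by blast
  then obtain b where b: "b < k" "firsts v ! b = i" using length_firsts by (auto simp: in_set_conv_nth)
  have ex: "v ! (firsts v ! b) = v ! j" using b i by simp
  have le: "level v j \<le> b" unfolding level_def by (rule Least_le) (rule ex)
  have eq: "letter v (level v j) = v ! j"
    unfolding letter_def level_def by (rule LeastI[of "\<lambda>b. v ! (firsts v ! b) = v ! j"]) (rule ex)
  have "level v j = b" using letter_eq_iff[of "level v j" b] le b(1) eq ex by (simp add: letter_def)
  then show "level v j < k" "firsts v ! level v j \<le> j" "letter v (level v j) = v ! j" using b i eq by auto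
qed

lemma level_eqI:
  assumes "j < n" "b < k" "v ! (firsts v ! b) = v ! j"
  shows "level v j = b"
  using level_props(1,2)[OF assms(1)] letter_eq_iff[of "level v j" b] assms by (simp add: letter_def)

lemma firsts_nth: "b < k \<Longrightarrow> firsts v ! b < n" "b < k \<Longrightarrow> level v (firsts v ! b) = b"
proof -
  assume b: "b < k"
  then show lt: "firsts v ! b < n" using firsts_less[of "firsts v ! b" v] length_firsts length_word by simp
  show "level v (firsts v ! b) = b" by (rule level_eqI) (use lt b in simp_all)
qed

lemma set_take_firsts: "a \<le> k \<Longrightarrow> set (take a (firsts v)) = (!) (firsts v) ` {..<a}"
  using nth_image[of a "firsts v"] length_firsts by (simp add: lessThan_atLeast0)

lemma set_take_firsts_subset: "set (take a (firsts v)) \<subseteq> {..<n}"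
  using set_take_subset[of a "firsts v"] firsts_less[of _ v] length_word by auto

end

text \<open>Translates between the two ways of cutting a list of positions: by number of elements a,
  and by position j.\<close>

lemma sorted_wrt_take_less:
  fixes xs :: "nat list"
  assumes "sorted_wrt (<) xs"
  obtains a where "a \<le> length xs" "set (take a xs) = {i \<in> set xs. i < j}"
    "\<And>b. b < length xs \<Longrightarrow> b < a \<longleftrightarrow> xs ! b < j"
proof -
  let ?a = "length (takeWhile (\<lambda>i. i < j) xs)"
  have t: "take ?a xs = takeWhile (\<lambda>i. i < j) xs" by (rule takeWhile_eq_take[symmetric])
  have s: "set (takeWhile (\<lambda>i. i < j) xs) = {i \<in> set xs. i < j}"
    using assms by (induction xs) auto
  have "b < ?a \<longleftrightarrow> xs ! b < j" if b: "b < length xs" for b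
  proof
    assume "b < ?a"
    then show "xs ! b < j" using nth_mem[of b "takeWhile (\<lambda>i. i < j) xs"] takeWhile_nth[of b "\<lambda>i. i < j" xs] s by auto
  next
    assume xb: "xs ! b < j"
    show "b < ?a"
    proof (rule ccontr)
      assume n: "\<not> b < ?a"
      then have a: "?a < length xs" using b by simp
      then have "\<not> xs ! ?a < j" by (rule nth_length_takeWhile)
      moreover have "xs ! ?a \<le> xs ! b"
        using sorted_wrt_nth_less[OF assms, of ?a b] n b by (cases "?a = b") auto
      ultimately show False using xb by simp
    qed
  qed
  then show thesis using that[of ?a] t s length_takeWhile_le[of "\<lambda>i. i < j" xs] by simp
qed

section \<open>Initial columns and rank conditions for a cell\<close>

definition initial :: "(nat \<Rightarrow> nat \<Rightarrow> complex) \<Rightarrow> nat \<Rightarrow> nat \<Rightarrow> bool" where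
  "initial A k j \<longleftrightarrow> trunc_col A k j \<notin> fv.span (trunc_col A k ` {..<j})"

text \<open>A column that is not initial depends on the columns before it, so leaving it out never
  shrinks the span.\<close>

lemma span_initial:
  "fv.span (trunc_col A k ` {..<j}) = fv.span (trunc_col A k ` {i. i < j \<and> initial A k i})"
proof (induction j)
  case (Suc j)
  let ?T = "trunc_col A k" and ?S = "{i. i < j \<and> initial A k i}"
  have T: "?T ` {..<Suc j} = insert (?T j) (?T ` {..<j})" by (auto simp: lessThan_Suc)
  show ?case
  proof (cases "initial A k j")
    case True
    then have "{i. i < Suc j \<and> initial A k i} = insert j ?S" by (auto simp: less_Suc_eq)
    then show ?thesis unfolding T using Suc by (simp add: fv.span_insert)
  next
    case False
    then have "{i. i < Suc j \<and> initial A k i} = ?S" by (auto simp: less_Suc_eq)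
    moreover have "?T j \<in> fv.span (?T ` {..<j})" using False by (simp add: initial_def)
    ultimately show ?thesis unfolding T using Suc fv.span_redundant by simp
  qed
qed simp

lemma rk_eq_card_initial: "rk A k {..<j} = card {i. i < j \<and> initial A k i}"
proof (induction j)
  case 0
  then show ?case using rk_le_card[of "{}" A k] by simp
next
  case (Suc j)
  let ?S = "{i. i < j \<and> initial A k i}"
  have r: "rk A k {..<Suc j} = rk A k (insert j {..<j})" by (simp add: lessThan_Suc)
  show ?case
  proof (cases "initial A k j")
    case True
    then have "{i. i < Suc j \<and> initial A k i} = insert j ?S" by (auto simp: less_Suc_eq)
    moreover have "rk A k (insert j {..<j}) \<noteq> rk A k {..<j}"
      using True rk_insert_eq_iff[of "{..<j}" A k j] by (simp add: initial_def)
    moreover have "rk A k {..<j} \<le> rk A k (insert j {..<j})" by (rule rk_mono_cols) auto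
    moreover have "rk A k (insert j {..<j}) \<le> Suc (rk A k {..<j})" by (rule rk_insert_le) simp
    ultimately show ?thesis using r Suc by simp
  next
    case False
    then have "{i. i < Suc j \<and> initial A k i} = ?S" by (auto simp: less_Suc_eq)
    moreover have "rk A k (insert j {..<j}) = rk A k {..<j}"
      using False rk_insert_eq_iff[of "{..<j}" A k j] by (simp add: initial_def)
    ultimately show ?thesis using r Suc by simp
  qed
qed

lemma initials_eq:
  assumes "M \<in> carrier_mat k n"
  shows "initials k n M = filter (initial (entries M) k) [0..<n]"
  unfolding initials_def
proof (rule filter_cong)
  fix j assume "j \<in> set [0..<n]"
  then show "col M j \<notin> cspan k (col M ` {..<j}) \<longleftrightarrow> initial (entries M) k j"
    using cspan_col_iff[OF assms, of j "{..<j}"] by (auto simp: initial_def)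
qed simp

text \<open>Membership in the cell with all positions taken from the word rather than from the
  matrix. The least index in the original description becomes an equivalence for every a, and the
  boundary cases a = 0 and h = 0 are included.\<close>

definition cell_conds :: "nat \<Rightarrow> nat \<Rightarrow> nat list \<Rightarrow> (nat \<Rightarrow> nat \<Rightarrow> complex) \<Rightarrow> bool" where
  "cell_conds k n v A \<longleftrightarrow>
     (\<forall>j<n. \<forall>a\<le>k. trunc_col A k j \<in> fv.span (trunc_col A k ` set (take a (firsts v))) \<longleftrightarrow> level v j < a) \<and>
     (\<forall>a\<le>k. \<forall>h\<le>k. rk A h (set (take a (firsts v))) = nw (letter v) a h)"

lemma cell_conds_if_shape:
  assumes v: "v \<in> fubini_words n k" and L: "lower_tri k L"
    and P: "cell_shape k n (level v) (letter v) (lapp L k A)"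
  shows "cell_conds k n v A"
proof -
  interpret shape k n "level v" "letter v" "(!) (firsts v)" "lapp L k A"
    by unfold_locales (use bij_betw_letter[OF v] level_props(1)[OF v] firsts_nth[OF v] P in auto)
  show ?thesis
    unfolding cell_conds_def
  proof (intro conjI allI impI)
    fix j a assume "j < n" "a \<le> k"
    then show "trunc_col A k j \<in> fv.span (trunc_col A k ` set (take a (firsts v))) \<longleftrightarrow> level v j < a"
      using col_in_span_iff[of j a] span_lapp[OF L, of A j "set (take a (firsts v))"]
      by (simp only: set_take_firsts[OF v])
  next
    fix a h assume "a \<le> k" "h \<le> k"
    then show "rk A h (set (take a (firsts v))) = nw (letter v) a h"
      using rk_pivots[of a h] rk_lapp[OF L, of h "set (take a (firsts v))" A]
      by (simp add: set_take_firsts[OF v])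
  qed
qed

text \<open>Here a counts the first occurrences before j. The letter of an earlier column first
  occurs before j too, so its level is below a.\<close>

lemma cell_conds_span:
  assumes v: "v \<in> fubini_words n k" and A: "cell_conds k n v A" and j: "j \<le> n"
    and a: "a \<le> k" "set (take a (firsts v)) = {i \<in> set (firsts v). i < j}"
    "\<And>b. b < k \<Longrightarrow> b < a \<longleftrightarrow> firsts v ! b < j"
  shows "fv.span (trunc_col A k ` {..<j}) = fv.span (trunc_col A k ` set (take a (firsts v)))"
proof (rule fv.span_eq[THEN iffD2], intro conjI)
  show "trunc_col A k ` {..<j} \<subseteq> fv.span (trunc_col A k ` set (take a (firsts v)))"
  proof (rule image_subsetI)
    fix i assume i: "i \<in> {..<j}"
    then have "level v i < a" using a(3)[of "level v i"] level_props[OF v, of i] j by auto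
    then show "trunc_col A k i \<in> fv.span (trunc_col A k ` set (take a (firsts v)))"
      using A i j a(1) unfolding cell_conds_def by auto
  qed
  show "trunc_col A k ` set (take a (firsts v)) \<subseteq> fv.span (trunc_col A k ` {..<j})"
    using a(2) by (intro subset_trans[OF _ fv.span_superset]) auto
qed

text \<open>Column j escapes the span of its predecessors iff the first occurrence of its letter is
  not before j, that is, iff it is j itself.\<close>

lemma cell_conds_initial_iff:
  assumes v: "v \<in> fubini_words n k" and A: "cell_conds k n v A" and j: "j < n"
  shows "initial A k j \<longleftrightarrow> j \<in> set (firsts v)"
proof -
  obtain a where a: "a \<le> k" "set (take a (firsts v)) = {i \<in> set (firsts v). i < j}"
    "\<And>b. b < k \<Longrightarrow> b < a \<longleftrightarrow> firsts v ! b < j"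
    using sorted_wrt_take_less[OF sorted_firsts, of v j thesis] length_firsts[OF v] by auto
  have "initial A k j \<longleftrightarrow> \<not> level v j < a"
    using cell_conds_span[OF v A _ a] A j a(1) unfolding cell_conds_def initial_def by auto
  also have "\<dots> \<longleftrightarrow> firsts v ! level v j = j"
    using a(3)[of "level v j"] level_props[OF v j] by auto
  also have "\<dots> \<longleftrightarrow> j \<in> set (firsts v)"
  proof
    assume "j \<in> set (firsts v)"
    then obtain b where "b < k" "firsts v ! b = j" using length_firsts[OF v] by (auto simp: in_set_conv_nth)
    then show "firsts v ! level v j = j" using firsts_nth(2)[OF v] by auto
  qed (use level_props(1)[OF v j] length_firsts[OF v] in \<open>metis nth_mem\<close>)
  finally show ?thesis .
qed

lemma word_of_mat_if_conds:
  assumes v: "v \<in> fubini_words n k" and M: "M \<in> carrier_mat k n"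
    and A: "cell_conds k n v (entries M)"
  shows "M \<in> full_mats k n" "word_of_mat k n M v"
proof -
  let ?A = "entries M"
  have W1: "trunc_col ?A k j \<in> fv.span (trunc_col ?A k ` set (take a (firsts v))) \<longleftrightarrow> level v j < a"
    if "j < n" "a \<le> k" for j a using A that by (auto simp: cell_conds_def)
  have W2: "rk ?A h (set (take a (firsts v))) = nw (letter v) a h" if "a \<le> k" "h \<le> k" for a h
    using A that by (auto simp: cell_conds_def)
  show "M \<in> full_mats k n"
  proof -
    have "k = rk ?A k (set (take k (firsts v)))" using W2[of k k] nw_full[OF bij_betw_letter[OF v]] by simp
    also have "\<dots> \<le> rk ?A k {..<n}" by (rule rk_mono_cols) (use set_take_firsts_subset[OF v] in auto)
    finally have "vec_space.rank k M = k" using rank_eq_rk[OF M] rk_le_rows[of ?A k "{..<n}"] by simp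
    moreover have "col M j \<noteq> 0\<^sub>v k" if j: "j < n" for j
    proof
      assume "col M j = 0\<^sub>v k"
      then have "trunc_col ?A k j = 0"
        using vec_fun_col[OF M j] by (auto simp: vec_fun_def fun_eq_iff split: if_splits)
      \<comment> \<open>For a = 0 the span is that of the empty set, and no level is below
        0.\<close>
      then show False using W1[OF j, of 0] by simp
    qed
    ultimately show ?thesis using M by (simp add: full_mats_def)
  qed
  have ini: "initials k n M = firsts v"
    unfolding initials_eq[OF M] firsts_def length_word[OF v]
    by (rule filter_cong) (use cell_conds_initial_iff[OF v A] set_firsts[of v] length_word[OF v] in auto)
  have least: "(LEAST m. col M j \<in> cspan k (col M ` set (take (Suc m) (firsts v)))) = level v j" if j: "j < n" for j
  proof -
    have "col M j \<in> cspan k (col M ` set (take (Suc m) (firsts v))) \<longleftrightarrow> level v j < Suc m" for m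
    proof (cases "m < k")
      case True
      then show ?thesis
        using W1[OF j, of "Suc m"] cspan_col_iff[OF M j set_take_firsts_subset[OF v], of "Suc m"] by simp
    next
      case False
      \<comment> \<open>Beyond the end of the list \<open>take\<close> saturates, so the case a = k
        of the span condition applies.\<close>
      then have "take (Suc m) (firsts v) = take k (firsts v)" using length_firsts[OF v] by simp
      then show ?thesis
        using W1[OF j, of k] cspan_col_iff[OF M j set_take_firsts_subset[OF v], of k] False level_props(1)[OF v j] by auto
    qed
    then show ?thesis by (intro Least_equality) auto
  qed
  show "word_of_mat k n M v"
    unfolding word_of_mat_def Let_def ini
  proof (intro conjI ballI allI impI)
    show "v \<in> fubini_words n k" by (fact v)
    show "bij_betw (\<lambda>b. v ! (firsts v ! b)) {..<k} {..<k}"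
      using bij_betw_letter[OF v] by (simp add: letter_def[abs_def])
    fix a h assume "a \<in> {1..k}" "h \<in> {1..k}"
    then show "rank_fun M h (set (take a (firsts v))) = card {b. b < a \<and> v ! (firsts v ! b) < h}"
      using W2[of a h] rank_fun_eq_rk[OF M _ set_take_firsts_subset[OF v], of h a] by (simp add: nw_def letter_def)
  next
    fix j assume "j < n"
    then show "v ! j = v ! (firsts v ! (LEAST m. col M j \<in> cspan k (col M ` set (take (Suc m) (firsts v)))))"
      using least level_props(2)[OF v] by (simp add: letter_def)
  qed
qed

text \<open>The crux is that the initial columns sit at the first occurrences in the word: letters
  at initial positions are distinct, and every other position repeats the letter of an initial
  position strictly to its left.\<close>

lemma conds_if_word_of_mat:
  assumes v: "v \<in> fubini_words n k" and M: "M \<in> full_mats k n" and w: "word_of_mat k n M v"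
  shows "cell_conds k n v (entries M)"
proof -
  let ?A = "entries M"
  define js where "js = initials k n M"
  let ?T = "trunc_col ?A k"
  have Mc: "M \<in> carrier_mat k n" using M by (simp add: full_mats_def)
  have js: "js = filter (initial ?A k) [0..<n]" unfolding js_def by (rule initials_eq[OF Mc])
  have set_js: "set js = {j. j < n \<and> initial ?A k j}" unfolding js by auto
  have sorted_js: "sorted_wrt (<) js" unfolding js by (rule sorted_wrt_filter) simp
  have "distinct js" unfolding js by simp
  then have "length js = card {j. j < n \<and> initial ?A k j}" by (metis distinct_card set_js)
  also have "\<dots> = k" using rk_eq_card_initial[of ?A k n] rank_eq_rk[OF Mc] M by (simp add: full_mats_def)
  finally have len: "length js = k" .
  have bij: "bij_betw (\<lambda>b. v ! (js ! b)) {..<k} {..<k}"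
    and W2: "\<And>a h. a \<in> {1..k} \<Longrightarrow> h \<in> {1..k} \<Longrightarrow> rank_fun M h (set (take a js)) = card {b. b < a \<and> v ! (js ! b) < h}"
    and W3: "\<And>j. j < n \<Longrightarrow> j \<notin> set js \<Longrightarrow>
      v ! j = v ! (js ! (LEAST m. col M j \<in> cspan k (col M ` set (take (Suc m) js))))"
    using w by (auto simp: word_of_mat_def Let_def js_def)
  have sub: "set (take a js) \<subseteq> {..<n}" for a
    using set_take_subset[of a js] set_js by auto
  have inspan: "col M j \<in> cspan k (col M ` set (take a js)) \<longleftrightarrow> ?T j \<in> fv.span (?T ` set (take a js))"
    if "j < n" for j a by (rule cspan_col_iff[OF Mc that sub])
  have nz: "?T j \<noteq> 0" if j: "j < n" for j
  proof
    assume "?T j = 0"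
    then have "vec_fun (col M j) = vec_fun (0\<^sub>v k)"
      using vec_fun_col[OF Mc j] by (auto simp: vec_fun_def fun_eq_iff)
    then have "col M j = 0\<^sub>v k" using inj_onD[OF inj_on_vec_fun[of k], of "col M j" "0\<^sub>v k"] Mc by auto
    then show False using M j by (simp add: full_mats_def)
  qed
  have inj_js: "i = j" if ij: "i \<in> set js" "j \<in> set js" "v ! i = v ! j" for i j
  proof -
    obtain b where "b < k" "i = js ! b" using ij(1) len by (auto simp: in_set_conv_nth)
    moreover obtain c where "c < k" "j = js ! c" using ij(2) len by (auto simp: in_set_conv_nth)
    ultimately show ?thesis using bij_betw_lessThan_eq_iff[OF bij, of b c] ij by simp
  qed
  define m where "m j = (LEAST m. ?T j \<in> fv.span (?T ` set (take (Suc m) js)))" for j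
  have m: "m j < k \<and> js ! m j < j \<and> ?T j \<in> fv.span (?T ` set (take (Suc (m j)) js)) \<and> v ! j = v ! (js ! m j)"
    if j: "j < n" "j \<notin> set js" for j
  proof -
    obtain a where a: "a \<le> k" "set (take a js) = {i \<in> set js. i < j}"
      "\<And>b. b < k \<Longrightarrow> b < a \<longleftrightarrow> js ! b < j"
      using sorted_wrt_take_less[OF sorted_js, of j thesis] len by auto
    have "{i \<in> set js. i < j} = {i. i < j \<and> initial ?A k i}" unfolding set_js using j(1) by auto
    moreover have "?T j \<in> fv.span (?T ` {..<j})" using j unfolding set_js by (simp add: initial_def)
    ultimately have span: "?T j \<in> fv.span (?T ` set (take a js))" using span_initial[of ?A k j] a by simp
    \<comment> \<open>Columns are nonzero, so at least one initial column is used; the predecessor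
      of a then bounds the 0-based least index.\<close>
    then have "a \<noteq> 0" using nz[OF j(1)] by auto
    then obtain a' where a': "a = Suc a'" by (cases a) auto
    have "m j \<le> a'" unfolding m_def by (rule Least_le) (use span a' in simp)
    then have "m j < a" using a' by simp
    moreover have "?T j \<in> fv.span (?T ` set (take (Suc (m j)) js))"
      unfolding m_def by (rule LeastI[of _ a']) (use span a' in simp)
    moreover have "v ! j = v ! (js ! m j)"
      using W3[OF j] inspan[OF j(1)] by (simp add: m_def)
    ultimately show ?thesis using a(1) a(3)[of "m j"] by auto
  qed
  have iff: "j \<in> set js \<longleftrightarrow> v ! j \<notin> set (take j v)" if j: "j < n" for j
  proof
    assume jj: "j \<in> set js"
    show "v ! j \<notin> set (take j v)"
    proof
      assume "v ! j \<in> set (take j v)"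
      then obtain i where i: "i < j" "v ! i = v ! j" using length_word[OF v] j by (auto simp: in_set_conv_nth)
      show False
      proof (cases "i \<in> set js")
        case True
        then show False using inj_js[of i j] jj i by simp
      next
        case False
        then have mi: "m i < k" "js ! m i < i" "v ! (js ! m i) = v ! j" using m[of i] i j by auto
        then have "js ! m i = j" using inj_js[of "js ! m i" j] nth_mem[of "m i" js] len jj by simp
        then show False using mi i by simp
      qed
    qed
  next
    assume nin: "v ! j \<notin> set (take j v)"
    show "j \<in> set js"
    proof (rule ccontr)
      assume "j \<notin> set js"
      then have "js ! m j < j" "v ! j = v ! (js ! m j)" using m[of j] j by auto
      then show False using nin in_set_take[of "js ! m j" j v] length_word[OF v] j by simp
    qed
  qed
  have firsts: "firsts v = js"
  proof (rule sorted_distinct_set_unique)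
    have "j < n" if "j \<in> set js" for j using that unfolding set_js by simp
    then show "set (firsts v) = set js" using iff unfolding set_firsts length_word[OF v] by blast
  qed (use sorted_js sorted_firsts[of v] in \<open>simp_all add: strict_sorted_iff\<close>)
  show ?thesis
    unfolding cell_conds_def firsts
  proof (intro conjI allI impI)
    fix j a assume j: "j < n" and a: "a \<le> k"
    show "?T j \<in> fv.span (?T ` set (take a js)) \<longleftrightarrow> level v j < a"
    proof (cases "j \<in> set js")
      case True
      then obtain c where c: "c < k" "j = js ! c" using len by (auto simp: in_set_conv_nth)
      then have lev: "level v j = c" using firsts_nth(2)[OF v, of c] firsts by simp
      show ?thesis
      proof (cases "c < a")
        case True
        then have "j \<in> set (take a js)" using c len a by (auto simp: in_set_conv_nth intro!: exI[of _ c])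
        then show ?thesis using True lev by (auto intro: fv.span_base)
      next
        case False
        have "set (take a js) \<subseteq> {..<j}"
        proof
          fix i assume "i \<in> set (take a js)"
          then obtain b where "b < a" "b < length js" "i = js ! b" by (auto simp: in_set_conv_nth)
          then show "i \<in> {..<j}" using sorted_wrt_nth_less[OF sorted_js, of b c] c False len by auto
        qed
        then have "fv.span (?T ` set (take a js)) \<subseteq> fv.span (?T ` {..<j})" by (intro fv.span_mono image_mono)
        moreover have "?T j \<notin> fv.span (?T ` {..<j})" using \<open>j \<in> set js\<close> unfolding set_js by (simp add: initial_def)
        ultimately show ?thesis using False lev by auto
      qed
    next
      case False
      note mj = m[OF j False]
      have lev: "level v j = m j" by (rule level_eqI[OF v j]) (use mj firsts in auto)
      show ?thesis
      proof
        assume span: "?T j \<in> fv.span (?T ` set (take a js))"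
        then have "a \<noteq> 0" using nz[OF j] by auto
        then obtain a' where a': "a = Suc a'" by (cases a) auto
        have "m j \<le> a'" unfolding m_def by (rule Least_le) (use span a' in simp)
        then show "level v j < a" using lev a' by simp
      next
        assume "level v j < a"
        then have "set (take (Suc (m j)) js) \<subseteq> set (take a js)" using lev by (intro set_take_subset_set_take) simp
        then have "fv.span (?T ` set (take (Suc (m j)) js)) \<subseteq> fv.span (?T ` set (take a js))"
          by (intro fv.span_mono image_mono)
        then show "?T j \<in> fv.span (?T ` set (take a js))" using mj by auto
      qed
    qed
  next
    fix a h assume ah: "a \<le> k" "h \<le> k"
    show "rk ?A h (set (take a js)) = nw (letter v) a h"
    proof (cases "a = 0 \<or> h = 0")
      case True
      then show ?thesis using rk_le_rows[of ?A h "set (take a js)"] rk_le_card[of "{}" ?A h] by (auto simp: nw_def)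
    next
      case False
      then show ?thesis
        using W2[of a h] rank_fun_eq_rk[OF Mc ah(2) sub, of a] ah by (simp add: nw_def letter_def firsts)
    qed
  qed
qed

section \<open>Ranks that are bounded or constant on a cell\<close>

lemma cell_conds_rk_level:
  assumes A: "cell_conds k n v A" and "a \<le> k" "h \<le> k"
  shows "rk A h {j. j < n \<and> level v j < a} \<le> nw (letter v) a h"
proof -
  have "rk A h {j. j < n \<and> level v j < a} \<le> rk A h (set (take a (firsts v)))"
    by (rule rk_le_span[OF _ assms(3)]) (use A assms(2) in \<open>auto simp: cell_conds_def\<close>)
  then show ?thesis using A assms(2,3) by (simp add: cell_conds_def)
qed

lemma cell_conds_rk_firsts:
  assumes v: "v \<in> fubini_words n k" and A: "cell_conds k n v A" and "a \<le> k"
  shows "rk A k (set (take a (firsts v))) = a"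
proof -
  have "{b. b < a \<and> letter v b < k} = {..<a}" using letter_less[OF v] assms(3) by auto
  then show ?thesis using A assms(3) by (simp add: cell_conds_def nw_def)
qed

lemma cell_conds_rk_prefix:
  assumes v: "v \<in> fubini_words n k" and A: "cell_conds k n v A" and j: "j \<le> n"
  shows "rk A k {..<j} = card {i \<in> set (firsts v). i < j}"
proof -
  have "{i. i < j \<and> initial A k i} = {i \<in> set (firsts v). i < j}"
    using cell_conds_initial_iff[OF v A] j by auto
  then show ?thesis using rk_eq_card_initial[of A k j] by simp
qed

text \<open>The rank is constant on the cell and tells whether the level of j is below a;
  injectivity recovers levels from it.\<close>

lemma cell_conds_rk_insert:
  assumes v: "v \<in> fubini_words n k" and A: "cell_conds k n v A" and "a \<le> k" "j < n"
  shows "rk A k (insert j (set (take a (firsts v)))) = (if level v j < a then a else Suc a)"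
proof -
  let ?S = "set (take a (firsts v))"
  have "rk A k (insert j ?S) = rk A k ?S \<longleftrightarrow> level v j < a"
    using rk_insert_eq_iff[of ?S A k j] A assms(3,4) by (simp add: cell_conds_def)
  moreover have "rk A k ?S \<le> rk A k (insert j ?S)" by (rule rk_mono_cols) auto
  moreover have "rk A k (insert j ?S) \<le> Suc (rk A k ?S)" by (rule rk_insert_le) simp
  ultimately show ?thesis using cell_conds_rk_firsts[OF v A assms(3)] by auto
qed

section \<open>The Zariski closure of a cell\<close>

lemma torusD:
  assumes "D \<in> torus n"
  shows "D \<in> carrier_mat n n" "\<And>j. j < n \<Longrightarrow> D $$ (j, j) \<noteq> 0"
    "\<And>M i j. M \<in> carrier_mat k n \<Longrightarrow> i < k \<Longrightarrow> j < n \<Longrightarrow> (M * D) $$ (i, j) = D $$ (j, j) * M $$ (i, j)"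
proof -
  have D: "D \<in> carrier_mat n n" and diag: "\<And>i j. i < n \<Longrightarrow> j < n \<Longrightarrow> i \<noteq> j \<Longrightarrow> D $$ (i, j) = 0"
    and inv: "invertible_mat D" using assms by (auto simp: torus_def diagonal_mat_def)
  show "D \<in> carrier_mat n n" by fact
  show mult: "(M * D) $$ (i, j) = D $$ (j, j) * M $$ (i, j)"
    if "M \<in> carrier_mat k n" "i < k" "j < n" for k M i j
  proof -
    have "(M * D) $$ (i, j) = (\<Sum>l\<in>{0..<n}. M $$ (i, l) * D $$ (l, j))"
      using that D by (simp add: scalar_prod_def)
    also have "\<dots> = (\<Sum>l\<in>{j}. M $$ (i, l) * D $$ (l, j))"
      by (rule sum.mono_neutral_right) (use that diag in auto)
    finally show ?thesis by simp
  qed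
  show "D $$ (j, j) \<noteq> 0" if j: "j < n" for j
  proof -
    obtain B where B: "D * B = 1\<^sub>m n" "B * D = 1\<^sub>m (dim_row B)"
      using inv D by (auto simp: invertible_mat_def inverts_mat_def)
    have "dim_col (B * D) = dim_col (1\<^sub>m (dim_row B) :: complex mat)" using B by simp
    \<comment> \<open>\<open>invertible_mat\<close> leaves the size of the inverse open; it is read
      off from the two products.\<close>
    then have "dim_row B = n" using D by simp
    moreover have "dim_col (D * B) = dim_col (1\<^sub>m n :: complex mat)" using B by simp
    ultimately have Bc: "B \<in> carrier_mat n n" by (auto intro: carrier_matI)
    have "(B * D) $$ (j, j) = 1" using B Bc j by simp
    then show ?thesis using mult[OF Bc j j] by auto
  qed
qed

lemma one_mat_torus: "1\<^sub>m n \<in> torus n"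
  by (auto simp: torus_def diagonal_mat_def invertible_mat_def inverts_mat_def intro!: exI[of _ "1\<^sub>m n"])

lemma torus_class_eqD:
  assumes "M \<in> full_mats k n" "torus_class k n M = torus_class k n M'"
  obtains D where "D \<in> torus n" "M = M' * D"
proof -
  have "M = M * 1\<^sub>m n" using assms(1) by (auto simp: full_mats_def)
  then have "M \<in> torus_class k n M"
    using assms(1) one_mat_torus by (auto simp: torus_class_def torus_rel_def)
  then have "(M', M) \<in> torus_rel k n" unfolding assms(2) by (simp add: torus_class_def)
  then show thesis using that by (auto simp: torus_rel_def)
qed

lemma rk_torus:
  assumes "D \<in> torus n" "M \<in> carrier_mat k n" "h \<le> k" "J \<subseteq> {..<n}"
  shows "rk (entries (M * D)) h J = rk (entries M) h J"
  by (rule rk_scale[where d = "\<lambda>j. D $$ (j, j)"])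
    (use assms torusD[OF assms(1)] finite_subset[of J "{..<n}"] in auto)

definition eval_monom :: "((nat \<times> nat) \<Rightarrow>\<^sub>0 nat) \<Rightarrow> complex mat \<Rightarrow> complex" where
  "eval_monom m M = (\<Prod>v\<in>Poly_Mapping.keys m. (M $$ v) ^ Poly_Mapping.lookup m v)"

lemma eval_entries_eq: "eval_entries p M = (\<Sum>m\<in>Poly_Mapping.keys p. Poly_Mapping.lookup p m * eval_monom m M)"
  by (simp add: eval_entries_def eval_monom_def)

text \<open>Each column contributes its scalar to the power of its degree. Extending the product
  from the support to the whole grid adds only factors with exponent 0.\<close>

lemma eval_monom_torus:
  assumes m: "Poly_Mapping.keys m \<subseteq> {..<k} \<times> {..<n}" and D: "D \<in> torus n" and M: "M \<in> carrier_mat k n"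
  shows "eval_monom m (M * D) =
    (\<Prod>j<n. (D $$ (j, j)) ^ (\<Sum>i<k. Poly_Mapping.lookup m (i, j))) * eval_monom m M"
proof -
  let ?e = "Poly_Mapping.lookup m" and ?K = "Poly_Mapping.keys m"
  have "eval_monom m (M * D) = (\<Prod>v\<in>?K. (D $$ (snd v, snd v)) ^ ?e v * (M $$ v) ^ ?e v)"
    unfolding eval_monom_def
  proof (rule prod.cong)
    fix v assume "v \<in> ?K"
    then obtain i j where "v = (i, j)" "i < k" "j < n" using m by auto
    then show "((M * D) $$ v) ^ ?e v = (D $$ (snd v, snd v)) ^ ?e v * (M $$ v) ^ ?e v"
      using torusD(3)[OF D M] by (simp only: snd_conv power_mult_distrib)
  qed simp
  also have "\<dots> = (\<Prod>v\<in>?K. (D $$ (snd v, snd v)) ^ ?e v) * eval_monom m M"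
    by (simp only: prod.distrib eval_monom_def)
  also have "(\<Prod>v\<in>?K. (D $$ (snd v, snd v)) ^ ?e v) = (\<Prod>v\<in>{..<k} \<times> {..<n}. (D $$ (snd v, snd v)) ^ ?e v)"
    by (rule prod.mono_neutral_left) (use m in \<open>auto simp: in_keys_iff\<close>)
  also have "\<dots> = (\<Prod>i<k. \<Prod>j<n. (D $$ (j, j)) ^ ?e (i, j))"
    by (simp add: prod.cartesian_product case_prod_unfold)
  also have "\<dots> = (\<Prod>j<n. \<Prod>i<k. (D $$ (j, j)) ^ ?e (i, j))" by (rule prod.swap)
  also have "\<dots> = (\<Prod>j<n. (D $$ (j, j)) ^ (\<Sum>i<k. ?e (i, j)))" by (simp only: power_sum)
  finally show ?thesis .
qed

text \<open>All monomials have the same column degrees, hence a common nonzero factor comes out;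
  vanishing is a property of the class.\<close>

lemma eval_entries_torus:
  assumes p: "multihomogeneous k n p" and D: "D \<in> torus n" and M: "M \<in> carrier_mat k n"
  shows "eval_entries p (M * D) = 0 \<longleftrightarrow> eval_entries p M = 0"
proof -
  obtain d where d: "\<And>m. m \<in> Poly_Mapping.keys p \<Longrightarrow> Poly_Mapping.keys m \<subseteq> {..<k} \<times> {..<n}"
    "\<And>m j. m \<in> Poly_Mapping.keys p \<Longrightarrow> j < n \<Longrightarrow> (\<Sum>i<k. Poly_Mapping.lookup m (i, j)) = d j"
    using p unfolding multihomogeneous_def by blast
  let ?c = "\<Prod>j<n. (D $$ (j, j)) ^ d j"
  have "eval_entries p (M * D) = (\<Sum>m\<in>Poly_Mapping.keys p. ?c * (Poly_Mapping.lookup p m * eval_monom m M))"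
    unfolding eval_entries_eq
  proof (rule sum.cong)
    fix m assume m: "m \<in> Poly_Mapping.keys p"
    have "(\<Prod>j<n. (D $$ (j, j)) ^ (\<Sum>i<k. Poly_Mapping.lookup m (i, j))) = ?c"
      by (rule prod.cong) (use d(2)[OF m] in auto)
    then show "Poly_Mapping.lookup p m * eval_monom m (M * D) = ?c * (Poly_Mapping.lookup p m * eval_monom m M)"
      unfolding eval_monom_torus[OF d(1)[OF m] D M] by (simp only: mult.left_commute)
  qed simp
  also have "\<dots> = ?c * eval_entries p M" by (simp only: eval_entries_eq sum_distrib_left)
  finally show ?thesis using torusD(2)[OF D] by auto
qed

lemma torus_class_in_principal_open_iff:
  assumes "multihomogeneous k n p" "M \<in> full_mats k n"
  shows "torus_class k n M \<in> principal_open k n p \<longleftrightarrow> eval_entries p M \<noteq> 0"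
proof
  assume "torus_class k n M \<in> principal_open k n p"
  then obtain M' where M': "M' \<in> full_mats k n" "torus_class k n M = torus_class k n M'" "eval_entries p M' \<noteq> 0"
    by (auto simp: principal_open_def)
  obtain D where "D \<in> torus n" "M = M' * D" using torus_class_eqD[OF assms(2) M'(2), of thesis] by blast
  then show "eval_entries p M \<noteq> 0"
    using eval_entries_torus[OF assms(1), of D M'] M' by (auto simp: full_mats_def)
qed (use assms in \<open>auto simp: principal_open_def\<close>)

section \<open>Representatives of cells and values of their quilts\<close>

definition cell_mats :: "nat \<Rightarrow> nat \<Rightarrow> nat list \<Rightarrow> complex mat set" where
  "cell_mats k n v = {M \<in> full_mats k n. word_of_mat k n M v}"

lemma cell_eq: "cell k n v = torus_class k n ` cell_mats k n v"
  by (auto simp: cell_def cell_mats_def)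

lemma cell_mats_carrier: "M \<in> cell_mats k n v \<Longrightarrow> M \<in> carrier_mat k n"
  by (simp add: cell_mats_def full_mats_def)

lemma cell_mats_iff:
  assumes "v \<in> fubini_words n k"
  shows "M \<in> cell_mats k n v \<longleftrightarrow> M \<in> carrier_mat k n \<and> cell_conds k n v (entries M)"
proof
  assume "M \<in> cell_mats k n v"
  then show "M \<in> carrier_mat k n \<and> cell_conds k n v (entries M)"
    using conds_if_word_of_mat[OF assms, of M] by (simp add: cell_mats_def full_mats_def)
next
  assume "M \<in> carrier_mat k n \<and> cell_conds k n v (entries M)"
  then show "M \<in> cell_mats k n v"
    using word_of_mat_if_conds[OF assms, of M] by (simp add: cell_mats_def)
qed

text \<open>The quilt ranges over all matrices whose class meets the cell description in some
  representative. Rescaling columns preserves ranks, so matrices with word v themselves give the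
  same set of values.\<close>

lemma word_quilt_eq_Max:
  assumes "h \<le> k" "J \<subseteq> {..<n}"
  shows "word_quilt k n v (h, J) = Max ((\<lambda>M. rk (entries M) h J) ` cell_mats k n v)"
proof -
  have "{rank_fun M h J |M. M \<in> full_mats k n \<and> torus_class k n M \<in> cell k n v} =
    (\<lambda>M. rk (entries M) h J) ` cell_mats k n v"
  proof (rule subset_antisym; rule subsetI)
    fix r assume "r \<in> {rank_fun M h J |M. M \<in> full_mats k n \<and> torus_class k n M \<in> cell k n v}"
    then obtain M M' where M: "r = rank_fun M h J" "M \<in> full_mats k n"
      "M' \<in> cell_mats k n v" "torus_class k n M = torus_class k n M'"
      by (auto simp: cell_eq)
    obtain D where D: "D \<in> torus n" "M = M' * D" using torus_class_eqD[OF M(2,4), of thesis] by blast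
    have "M \<in> carrier_mat k n" using M(2) by (simp add: full_mats_def)
    then have "r = rk (entries M') h J"
      using M(1) rank_fun_eq_rk[of M k n h J] rk_torus[OF D(1) cell_mats_carrier[OF M(3)] assms] assms D(2) by simp
    then show "r \<in> (\<lambda>M. rk (entries M) h J) ` cell_mats k n v" using M(3) by blast
  next
    fix r assume "r \<in> (\<lambda>M. rk (entries M) h J) ` cell_mats k n v"
    then obtain M where M: "M \<in> cell_mats k n v" "r = rk (entries M) h J" by blast
    then have "r = rank_fun M h J" using rank_fun_eq_rk[OF cell_mats_carrier[OF M(1)] assms] by simp
    then show "r \<in> {rank_fun M h J |M. M \<in> full_mats k n \<and> torus_class k n M \<in> cell k n v}"
      using M(1) by (auto simp: cell_eq cell_mats_def)
  qed
  then show ?thesis using assms by (simp add: word_quilt_def grid_def)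
qed

lemma finite_rk_image: "finite ((\<lambda>M. rk (entries M) h J) ` S)"
  by (rule finite_subset[of _ "{..h}"]) (use rk_le_rows in auto)

lemma rk_le_word_quilt:
  assumes "h \<le> k" "J \<subseteq> {..<n}" "M \<in> cell_mats k n v"
  shows "rk (entries M) h J \<le> word_quilt k n v (h, J)"
  unfolding word_quilt_eq_Max[OF assms(1,2)] by (rule Max_ge[OF finite_rk_image]) (use assms in blast)

definition nonvanishing :: "nat \<Rightarrow> nat \<Rightarrow> entry_poly set \<Rightarrow> (nat \<Rightarrow> nat \<Rightarrow> complex) \<Rightarrow> bool" where
  "nonvanishing k n P A \<longleftrightarrow> (\<forall>p\<in>P. eval_entries p (mat k n (\<lambda>(i, j). A i j)) \<noteq> 0)"

lemma line_open_nonvanishing: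
  assumes "finite P" "\<And>p. p \<in> P \<Longrightarrow> multihomogeneous k n p"
  shows "line_open (nonvanishing k n P)"
  unfolding line_open_def
proof (intro allI impI)
  fix A N assume A: "nonvanishing k n P A"
  let ?M = "\<lambda>s. mat k n (\<lambda>(i, j). A i j + s * N i j)"
  have "\<forall>\<^sub>F s in nhds 0. eval_entries p (?M s) \<noteq> 0" if p: "p \<in> P" for p
  proof -
    have "isCont (\<lambda>s. eval_entries p (?M s)) 0"
      unfolding eval_entries_def
    proof (intro continuous_intros)
      fix m v assume "m \<in> Poly_Mapping.keys p" "v \<in> Poly_Mapping.keys m"
      \<comment> \<open>Multihomogeneity confines the variables to the grid, where the entries of
        \<open>mat\<close> are affine in s.\<close>
      then have "v \<in> {..<k} \<times> {..<n}" using assms(2)[OF p] unfolding multihomogeneous_def by blast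
      then obtain i j where "v = (i, j)" "i < k" "j < n" by auto
      then show "isCont (\<lambda>s. ?M s $$ v) 0" by simp
    qed
    then have "((\<lambda>s. eval_entries p (?M s)) \<longlongrightarrow> eval_entries p (?M 0)) (nhds 0)"
      by (simp only: isCont_def tendsto_nhds_iff)
    moreover have "eval_entries p (?M 0) \<noteq> 0" using A p by (simp add: nonvanishing_def)
    ultimately show ?thesis by (rule tendsto_imp_eventually_ne)
  qed
  then have "\<forall>\<^sub>F s in nhds 0. \<forall>p\<in>P. eval_entries p (?M s) \<noteq> 0" using assms(1) by (simp add: eventually_ball_finite)
  then show "\<exists>\<epsilon>>0. \<forall>s. cmod s < \<epsilon> \<longrightarrow> nonvanishing k n P (\<lambda>i j. A i j + s * N i j)"
    by (simp add: eventually_nhds_metric dist_norm nonvanishing_def)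
qed

text \<open>Matrix form of \<open>exists_cell_shape\<close>. The congruence assumption says that U
  sees only the k by n entries, so the function found there may be replaced by a genuine
  matrix.\<close>

lemma exists_cell_mat:
  assumes v: "v \<in> fubini_words n k" and U: "line_open U" "U A"
    and cong: "\<And>A B. (\<And>i j. i < k \<Longrightarrow> j < n \<Longrightarrow> A i j = B i j) \<Longrightarrow> U A \<Longrightarrow> U B"
    and rank: "\<And>a h. a \<le> k \<Longrightarrow> h \<le> k \<Longrightarrow> rk A h {j. j < n \<and> level v j < a} \<le> nw (letter v) a h"
  obtains N where "N \<in> cell_mats k n v" "U (entries N)"
proof -
  obtain B L where B: "U B" "lower_tri k L" "cell_shape k n (level v) (letter v) (lapp L k B)"
    using exists_cell_shape[OF bij_betw_letter[OF v] level_props(1)[OF v] rank U, where thesis = thesis] by blast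
  let ?N = "mat k n (\<lambda>(i, j). B i j)"
  have N: "?N $$ (i, j) = B i j" if "i < k" "j < n" for i j using that by simp
  have "lapp L k (entries ?N) i j = lapp L k B i j" if "j < n" for i j
    unfolding lapp_def by (rule sum.cong) (use N that in auto)
  then have "cell_shape k n (level v) (letter v) (lapp L k (entries ?N))"
    using B(3) by (simp add: cell_shape_def echelon_def)
  then have "?N \<in> cell_mats k n v"
    using cell_conds_if_shape[OF v B(2)] cell_mats_iff[OF v] by auto
  moreover have "U (entries ?N)" by (rule cong[OF _ B(1)]) (use N in simp)
  ultimately show thesis by (rule that)
qed

text \<open>The zero array satisfies every rank bound, so the deformation result with a trivial open
  condition already produces a member of the cell.\<close>

lemma cell_mats_nonempty:
  assumes v: "v \<in> fubini_words n k"
  obtains N where "N \<in> cell_mats k n v"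
proof -
  have "rk (\<lambda>i j. 0) h J = 0" for h J
  proof -
    have "trunc_col (\<lambda>i j. 0) h ` J \<subseteq> fv.span {}" by (auto simp: trunc_col_def fun_eq_iff)
    then show ?thesis using fv.dim_le_card[of _ "{}"] by (simp add: rk_def)
  qed
  moreover have "line_open (\<lambda>A. True)" by (auto simp: line_open_def intro: exI[of _ 1])
  ultimately show thesis
    using exists_cell_mat[OF v, of "\<lambda>A. True" "\<lambda>i j. 0" thesis] that by auto
qed

lemma word_quilt_attained:
  assumes v: "v \<in> fubini_words n k" and "h \<le> k" "J \<subseteq> {..<n}"
  obtains M where "M \<in> cell_mats k n v" "word_quilt k n v (h, J) = rk (entries M) h J"
proof -
  have "(\<lambda>M. rk (entries M) h J) ` cell_mats k n v \<noteq> {}" using cell_mats_nonempty[OF v, of False] by auto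
  then have "word_quilt k n v (h, J) \<in> (\<lambda>M. rk (entries M) h J) ` cell_mats k n v"
    unfolding word_quilt_eq_Max[OF assms(2,3)] by (rule Max_in[OF finite_rk_image])
  then show thesis using that by blast
qed

text \<open>Around each of its points an open set contains a finite intersection of principal open
  sets. Keeping the finite set P makes intersections into unions of such sets, in place of products
  of polynomials.\<close>

lemma generate_principal_open:
  assumes "generate_topology_on {principal_open k n p | p. multihomogeneous k n p} T" "x \<in> T"
  shows "\<exists>P. finite P \<and> (\<forall>p\<in>P. multihomogeneous k n p \<and> x \<in> principal_open k n p) \<and>
    (\<forall>y. (\<forall>p\<in>P. y \<in> principal_open k n p) \<longrightarrow> y \<in> T)"
  using assms
proof (induction T rule: generate_topology_on.induct)
  case (Int a b)
  from Int.IH(1) Int.prems obtain P where P: "finite P" "\<forall>p\<in>P. multihomogeneous k n p \<and> x \<in> principal_open k n p"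
    "\<forall>y. (\<forall>p\<in>P. y \<in> principal_open k n p) \<longrightarrow> y \<in> a" by auto
  from Int.IH(2) Int.prems obtain Q where Q: "finite Q" "\<forall>p\<in>Q. multihomogeneous k n p \<and> x \<in> principal_open k n p"
    "\<forall>y. (\<forall>p\<in>Q. y \<in> principal_open k n p) \<longrightarrow> y \<in> b" by auto
  show ?case by (rule exI[of _ "P \<union> Q"]) (use P Q in auto)
next
  case (UN K)
  then obtain S where S: "S \<in> K" "x \<in> S" by auto
  from UN.IH[OF S] obtain P where P: "finite P" "\<forall>p\<in>P. multihomogeneous k n p \<and> x \<in> principal_open k n p"
    "\<forall>y. (\<forall>p\<in>P. y \<in> principal_open k n p) \<longrightarrow> y \<in> S" by auto
  show ?case by (rule exI[of _ P]) (use P S(1) in auto)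
next
  case (Basis s)
  then obtain p where "s = principal_open k n p" "multihomogeneous k n p" by auto
  then show ?case using Basis.prems by (intro exI[of _ "{p}"]) auto
qed simp

section \<open>Determinants as multihomogeneous polynomials\<close>

definition representable :: "nat \<Rightarrow> nat \<Rightarrow> (nat \<Rightarrow> nat) \<Rightarrow> (complex mat \<Rightarrow> complex) \<Rightarrow> bool" where
  "representable k n d F \<longleftrightarrow> (\<exists>p. (\<forall>m\<in>Poly_Mapping.keys p. Poly_Mapping.keys m \<subseteq> {..<k} \<times> {..<n} \<and>
     (\<forall>j<n. (\<Sum>i<k. Poly_Mapping.lookup m (i, j)) = d j)) \<and> (\<forall>M. eval_entries p M = F M))"

lemma representableD:
  assumes "representable k n d F"
  obtains p where "multihomogeneous k n p" "\<forall>M. eval_entries p M = F M"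
proof -
  obtain p where p: "\<forall>m\<in>Poly_Mapping.keys p. Poly_Mapping.keys m \<subseteq> {..<k} \<times> {..<n} \<and>
     (\<forall>j<n. (\<Sum>i<k. Poly_Mapping.lookup m (i, j)) = d j)" "\<forall>M. eval_entries p M = F M"
    using assms unfolding representable_def by (elim exE conjE)
  have "multihomogeneous k n p" unfolding multihomogeneous_def by (rule exI[of _ d]) (rule p(1))
  then show thesis using that p(2) by blast
qed

lemma representable_0: "representable k n d (\<lambda>M. 0)"
  unfolding representable_def by (rule exI[of _ 0]) (simp add: eval_entries_eq)

lemma eval_entries_add: "eval_entries (p + q) M = eval_entries p M + eval_entries q M"
  unfolding eval_entries_eq by (rule setsum_keys_plus_distrib) (simp_all add: distrib_right)

text \<open>The prescribed degree vector d, shared by both summands, is what keeps the sum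
  multihomogeneous.\<close>

lemma representable_add:
  assumes "representable k n d F" "representable k n d G"
  shows "representable k n d (\<lambda>M. F M + G M)"
proof -
  let ?ok = "\<lambda>m. Poly_Mapping.keys m \<subseteq> {..<k} \<times> {..<n} \<and> (\<forall>j<n. (\<Sum>i<k. Poly_Mapping.lookup m (i, j)) = d j)"
  obtain p q where p: "\<forall>m\<in>Poly_Mapping.keys p. ?ok m" "\<And>M. eval_entries p M = F M"
    and q: "\<forall>m\<in>Poly_Mapping.keys q. ?ok m" "\<And>M. eval_entries q M = G M"
    using assms unfolding representable_def by blast
  have "\<forall>m\<in>Poly_Mapping.keys (p + q). ?ok m" using p(1) q(1) keys_add[of p q] by blast
  then show ?thesis unfolding representable_def
    by (intro exI[of _ "p + q"]) (simp add: eval_entries_add p(2) q(2))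
qed

lemma representable_sum:
  assumes "\<And>x. x \<in> S \<Longrightarrow> representable k n d (F x)"
  shows "representable k n d (\<lambda>M. \<Sum>x\<in>S. F x M)"
  using assms
proof (induction S rule: infinite_finite_induct)
  case (insert x S)
  then have "representable k n d (\<lambda>M. F x M + (\<Sum>x\<in>S. F x M))" by (intro representable_add) auto
  then show ?case using insert.hyps by simp
qed (simp_all add: representable_0)

text \<open>Squarefree monomials, encoded by their set K of positions; these are the terms of the
  determinants below.\<close>

lemma representable_monom:
  assumes K: "K \<subseteq> {..<k} \<times> {..<n}" and d: "\<And>j. j < n \<Longrightarrow> d j = card {i. i < k \<and> (i, j) \<in> K}"
  shows "representable k n d (\<lambda>M. c * (\<Prod>v\<in>K. M $$ v))"
proof -
  have fin: "finite K" using K finite_subset by blast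
  define m :: "(nat \<times> nat) \<Rightarrow>\<^sub>0 nat" where "m = (\<Sum>v\<in>K. Poly_Mapping.single v 1)"
  have lookup: "Poly_Mapping.lookup m x = (if x \<in> K then 1 else 0)" for x
  proof -
    have "Poly_Mapping.lookup m x = (\<Sum>v\<in>K. if v = x then 1 else 0)"
      unfolding m_def lookup_sum by (rule sum.cong) (auto simp: lookup_single when_def)
    then show ?thesis using fin by simp
  qed
  have keys: "Poly_Mapping.keys m = K" by (simp add: set_eq_iff in_keys_iff lookup)
  have "(\<Sum>i<k. Poly_Mapping.lookup m (i, j)) = d j" if "j < n" for j
  proof -
    have "(\<Sum>i<k. Poly_Mapping.lookup m (i, j)) = (\<Sum>i\<in>{i. i < k \<and> (i, j) \<in> K}. 1)"
      unfolding lookup by (rule sum.mono_neutral_cong_right) auto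
    then show ?thesis using d[OF that] by simp
  qed
  moreover have "eval_entries (Poly_Mapping.single m c) M = c * (\<Prod>v\<in>K. M $$ v)" for M
    by (cases "c = 0") (simp_all add: eval_entries_eq eval_monom_def keys lookup)
  ultimately show ?thesis unfolding representable_def
    by (intro exI[of _ "Poly_Mapping.single m c"]) (use K in \<open>simp add: keys\<close>)
qed

text \<open>After the Leibniz expansion and multiplying out, a term is given by a permutation
  \<open>\<pi>\<close> and a choice \<open>\<phi>\<close> of rows. Injectivity of b puts its factors
  into distinct columns, so its degree is 1 in each column selected by b and 0 elsewhere.\<close>

lemma representable_det:
  assumes b: "inj_on b {..<s}" "b ` {..<s} \<subseteq> {..<n}" and h: "h \<le> k"
  shows "representable k n (\<lambda>j. if j \<in> b ` {..<s} then 1 else 0)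
    (\<lambda>M. det (mat s s (\<lambda>(t, u). \<Sum>i<h. X t i * M $$ (i, b u))))"
proof -
  let ?d = "\<lambda>j. if j \<in> b ` {..<s} then 1 else 0"
  let ?Phi = "{0..<s} \<rightarrow>\<^sub>E {..<h}"
  let ?term = "\<lambda>\<pi> \<phi> M. (signof \<pi> * (\<Prod>t = 0..<s. X t (\<phi> t))) * (\<Prod>v\<in>(\<lambda>t. (\<phi> t, b (\<pi> t))) ` {0..<s}. M $$ v)"
  have "det (mat s s (\<lambda>(t, u). \<Sum>i<h. X t i * M $$ (i, b u))) =
    (\<Sum>\<pi>\<in>{\<pi>. \<pi> permutes {0..<s}}. \<Sum>\<phi>\<in>?Phi. ?term \<pi> \<phi> M)" for M
  proof -
    have "det (mat s s (\<lambda>(t, u). \<Sum>i<h. X t i * M $$ (i, b u))) =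
      (\<Sum>\<pi>\<in>{\<pi>. \<pi> permutes {0..<s}}. signof \<pi> * (\<Prod>t = 0..<s. \<Sum>i<h. X t i * M $$ (i, b (\<pi> t))))"
      unfolding det_def'[OF mat_carrier]
    proof (rule sum.cong)
      fix \<pi> assume "\<pi> \<in> {\<pi>. \<pi> permutes {0..<s}}"
      then have "\<pi> t < s" if "t < s" for t using that permutes_in_image[of \<pi> "{0..<s}" t] by auto
      then have "(\<Prod>t = 0..<s. mat s s (\<lambda>(t, u). \<Sum>i<h. X t i * M $$ (i, b u)) $$ (t, \<pi> t)) =
        (\<Prod>t = 0..<s. \<Sum>i<h. X t i * M $$ (i, b (\<pi> t)))"
        by (intro prod.cong) auto
      then show "signof \<pi> * (\<Prod>t = 0..<s. mat s s (\<lambda>(t, u). \<Sum>i<h. X t i * M $$ (i, b u)) $$ (t, \<pi> t)) =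
        signof \<pi> * (\<Prod>t = 0..<s. \<Sum>i<h. X t i * M $$ (i, b (\<pi> t)))" by (simp only:)
    qed simp
    also have "\<dots> = (\<Sum>\<pi>\<in>{\<pi>. \<pi> permutes {0..<s}}. \<Sum>\<phi>\<in>?Phi. ?term \<pi> \<phi> M)"
    proof (rule sum.cong)
      fix \<pi> assume \<pi>: "\<pi> \<in> {\<pi>. \<pi> permutes {0..<s}}"
      have "(\<Prod>t = 0..<s. \<Sum>i<h. X t i * M $$ (i, b (\<pi> t))) =
        (\<Sum>\<phi>\<in>?Phi. \<Prod>t = 0..<s. X t (\<phi> t) * M $$ (\<phi> t, b (\<pi> t)))"
        by (rule prod_sum_PiE) simp_all
      also have "\<dots> = (\<Sum>\<phi>\<in>?Phi. (\<Prod>t = 0..<s. X t (\<phi> t)) * (\<Prod>v\<in>(\<lambda>t. (\<phi> t, b (\<pi> t))) ` {0..<s}. M $$ v))"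
      proof (rule sum.cong)
        fix \<phi> :: "nat \<Rightarrow> nat"
        have "inj_on (\<lambda>t. (\<phi> t, b (\<pi> t))) {0..<s}"
        proof (rule inj_onI)
          fix t u assume tu: "t \<in> {0..<s}" "u \<in> {0..<s}" "(\<phi> t, b (\<pi> t)) = (\<phi> u, b (\<pi> u))"
          have "\<pi> t \<in> {..<s}" "\<pi> u \<in> {..<s}" using \<pi> tu permutes_in_image[of \<pi> "{0..<s}"] by auto
          then have "\<pi> t = \<pi> u" using tu(3) inj_onD[OF b(1)] by blast
          then show "t = u" using \<pi> permutes_inj[of \<pi> "{0..<s}"] by (auto dest: injD)
        qed
        then show "(\<Prod>t = 0..<s. X t (\<phi> t) * M $$ (\<phi> t, b (\<pi> t))) =
          (\<Prod>t = 0..<s. X t (\<phi> t)) * (\<Prod>v\<in>(\<lambda>t. (\<phi> t, b (\<pi> t))) ` {0..<s}. M $$ v)"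
          by (simp add: prod.reindex prod.distrib)
      qed simp
      finally show "signof \<pi> * (\<Prod>t = 0..<s. \<Sum>i<h. X t i * M $$ (i, b (\<pi> t))) = (\<Sum>\<phi>\<in>?Phi. ?term \<pi> \<phi> M)"
        by (simp only: sum_distrib_left mult.assoc)
    qed simp
    finally show ?thesis .
  qed
  moreover have "representable k n ?d (\<lambda>M. \<Sum>\<pi>\<in>{\<pi>. \<pi> permutes {0..<s}}. \<Sum>\<phi>\<in>?Phi. ?term \<pi> \<phi> M)"
  proof (intro representable_sum representable_monom)
    fix \<pi> \<phi> assume \<pi>: "\<pi> \<in> {\<pi>. \<pi> permutes {0..<s}}" and \<phi>: "\<phi> \<in> ?Phi"
    have \<pi>s: "\<pi> ` {0..<s} = {..<s}" using \<pi> permutes_image[of \<pi> "{0..<s}"] by auto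
    have \<phi>h: "\<phi> t < k" if "t < s" for t using PiE_mem[OF \<phi>, of t] that h by auto
    show "(\<lambda>t. (\<phi> t, b (\<pi> t))) ` {0..<s} \<subseteq> {..<k} \<times> {..<n}"
    proof (rule image_subsetI)
      fix t assume t: "t \<in> {0..<s}"
      then have "\<pi> t \<in> {..<s}" using \<pi>s by blast
      then have "b (\<pi> t) \<in> {..<n}" using b(2) by blast
      then show "(\<phi> t, b (\<pi> t)) \<in> {..<k} \<times> {..<n}" using \<phi>h t by simp
    qed
    fix j assume "j < n"
    let ?I = "{i. i < k \<and> (i, j) \<in> (\<lambda>t. (\<phi> t, b (\<pi> t))) ` {0..<s}}"
    show "?d j = card ?I"
    proof (cases "j \<in> b ` {..<s}")
      case True
      then obtain u where "u < s" "j = b u" by auto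
      moreover then obtain t where "t \<in> {0..<s}" "u = \<pi> t" using \<pi>s by (metis imageE lessThan_iff)
      ultimately have t: "t < s" "j = b (\<pi> t)" by auto
      have "?I = {\<phi> t}"
      proof (intro subset_antisym subsetI)
        fix i assume "i \<in> ?I"
        then obtain t' where t': "t' < s" "i = \<phi> t'" "b (\<pi> t') = b (\<pi> t)" using t by auto
        have "\<pi> t' \<in> {..<s}" "\<pi> t \<in> {..<s}"
          using \<pi> permutes_in_image[of \<pi> "{0..<s}"] t(1) t'(1) by auto
        then have "\<pi> t' = \<pi> t" using t'(3) inj_onD[OF b(1)] by blast
        then have "t' = t" using \<pi> permutes_inj[of \<pi> "{0..<s}"] by (auto dest: injD)
        then show "i \<in> {\<phi> t}" using t' by simp
      next
        fix i assume "i \<in> {\<phi> t}"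
        then show "i \<in> ?I" using t \<phi>h by auto
      qed
      then show ?thesis using True by simp
    next
      case False
      have "?I = {}"
      proof -
        have "b (\<pi> t) \<in> b ` {..<s}" if "t < s" for t using \<pi>s that by auto
        then show ?thesis using False by auto
      qed
      then show ?thesis using False by (simp only: card.empty) simp
    qed
  qed
  ultimately show ?thesis by (simp only:)
qed

lemma rk_lapp_le:
  assumes "finite J"
  shows "rk (lapp X h A) s J \<le> rk A h J"
proof -
  let ?f = "\<lambda>x t. if t < s then \<Sum>i<h. X t i * x i else (0::complex)"
  have "fv_linear ?f"
  proof unfold_locales
    show "?f (x + y) = ?f x + ?f y" for x y
      by (simp add: fun_eq_iff distrib_left sum.distrib)
    show "?f (\<lambda>i. c * x i) = (\<lambda>t. c * ?f x t)" for c x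
    proof
      have "(\<Sum>i<h. X t i * (c * x i)) = c * (\<Sum>i<h. X t i * x i)" for t
        unfolding sum_distrib_left by (rule sum.cong) (simp_all only: mult.left_commute)
      then show "?f (\<lambda>i. c * x i) t = c * ?f x t" for t by simp
    qed
  qed
  then have "fv.dim (?f ` trunc_col A h ` J) \<le> rk A h J"
    unfolding rk_def using assms by (intro fv_dim_image_le) auto
  moreover have "?f (trunc_col A h j) = trunc_col (lapp X h A) s j" for j
    by (auto simp: trunc_col_def lapp_def fun_eq_iff)
  ultimately show ?thesis by (simp add: rk_def image_image)
qed

text \<open>
  The polynomial is \<open>det (X N')\<close>, where \<open>N'\<close> consists of the columns of \<open>N\<close> at positions whose columns
  form a basis for \<open>M\<close>, and the constant matrix \<open>X\<close> is a left inverse of the corresponding \<open>M'\<close>.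
\<close>

lemma exists_rank_detector:
  assumes M: "M \<in> carrier_mat k n" and h: "h \<le> k" and J: "J \<subseteq> {..<n}"
  obtains p where "multihomogeneous k n p" "eval_entries p M \<noteq> 0"
    "\<And>N. eval_entries p N \<noteq> 0 \<Longrightarrow> rk (entries M) h J \<le> rk (entries N) h J"
proof -
  let ?T = "trunc_col (entries M) h" and ?s = "rk (entries M) h J"
  have fJ: "finite J" using J finite_subset by blast
  obtain B where B: "B \<subseteq> ?T ` J" "fv.independent B" "card B = ?s"
    using fv_basis[OF finite_imageI[OF fJ, of ?T], where thesis = thesis] unfolding rk_def by blast
  \<comment> \<open>One position per basis vector, since different positions of J may carry equal
    columns.\<close>
  obtain J' where J': "J' \<subseteq> J" "inj_on ?T J'" "B = ?T ` J'" using B(1) unfolding subset_image_inj by blast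
  have fJ': "finite J'" using J' fJ finite_subset by blast
  have cJ': "card J' = ?s" using B(3) J' by (simp add: card_image)
  obtain b where b: "bij_betw b {..<?s} J'"
    using ex_bij_betw_nat_finite[OF fJ'] cJ' by (auto simp: atLeast0LessThan)
  have bJ: "b u \<in> J'" if "u < ?s" for u using b that unfolding bij_betw_def by blast
  \<comment> \<open>The functionals dual to the chosen basis columns; their coefficients are the
    rows of the left inverse X.\<close>
  have "\<exists>g. Vector_Spaces.linear (\<lambda>c f i. c * f i) (*) g \<and> (\<forall>y\<in>B. g y = (if y = ?T (b t) then 1 else 0))" for t
    by (rule fvc.linear_independent_extend[OF B(2)])
  then obtain g where g: "\<And>t. Vector_Spaces.linear (\<lambda>c f i. c * f i) (*) (g t)"
    "\<And>t y. y \<in> B \<Longrightarrow> g t y = (if y = ?T (b t) then 1 else 0)" by metis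
  define X where "X t i = g t (unit_fun i)" for t i
  define Y where "Y N = mat ?s ?s (\<lambda>(t, u). \<Sum>i<h. X t i * N $$ (i, b u))" for N :: "complex mat"
  have "representable k n (\<lambda>j. if j \<in> b ` {..<?s} then 1 else 0) (\<lambda>N. det (Y N))"
    unfolding Y_def
    by (rule representable_det) (use b J J' h in \<open>auto simp: bij_betw_def\<close>)
  then obtain p where p: "multihomogeneous k n p" "\<forall>N. eval_entries p N = det (Y N)"
    by (rule representableD)
  have "Y M = 1\<^sub>m ?s"
  proof (rule eq_matI)
    fix t u assume "t < dim_row (1\<^sub>m ?s :: complex mat)" "u < dim_col (1\<^sub>m ?s :: complex mat)"
    then have tu: "t < ?s" "u < ?s" by auto
    have "(\<Sum>i<h. X t i * M $$ (i, b u)) = (\<Sum>i<h. g t (unit_fun i) * ?T (b u) i)"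
      by (rule sum.cong) (auto simp: X_def trunc_col_def)
    also have "\<dots> = g t (?T (b u))"
      by (rule functional_as_sum[OF g(1), symmetric]) (auto simp: trunc_col_def)
    also have "\<dots> = (if ?T (b u) = ?T (b t) then 1 else 0)"
      using g(2) bJ[OF tu(2)] J'(3) by simp
    also have "\<dots> = (if t = u then 1 else 0)"
    proof -
      have "?T (b u) = ?T (b t) \<longleftrightarrow> b u = b t" using inj_on_eq_iff[OF J'(2)] bJ tu by simp
      also have "\<dots> \<longleftrightarrow> t = u" using inj_on_eq_iff[OF bij_betw_imp_inj_on[OF b]] tu by auto
      finally show ?thesis by simp
    qed
    finally show "Y M $$ (t, u) = 1\<^sub>m ?s $$ (t, u)" using tu by (simp add: Y_def)
  qed (simp_all add: Y_def)
  then have "eval_entries p M \<noteq> 0" by (simp add: p(2))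
  moreover have "?s \<le> rk (entries N) h J" if N: "eval_entries p N \<noteq> 0" for N
  proof (rule ccontr)
    assume "\<not> ?s \<le> rk (entries N) h J"
    moreover have "rk (entries N) h J' \<le> rk (entries N) h J" by (rule rk_mono_cols[OF fJ J'(1)])
    moreover have "rk (lapp X h (entries N)) ?s J' \<le> rk (entries N) h J'" by (rule rk_lapp_le[OF fJ'])
    \<comment> \<open>A rank drop in N passes to X N', which then has a nontrivial row relation c;
      this contradicts the nonzero determinant.\<close>
    ultimately have "rk (lapp X h (entries N)) ?s J' < card {..<?s}" by simp
    then obtain c where c: "\<exists>i\<in>{..<?s}. c i \<noteq> 0"
      "\<And>j. j \<in> J' \<Longrightarrow> (\<Sum>i\<in>{..<?s}. c i * lapp X h (entries N) i j) = 0"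
      using exists_row_relation[OF fJ' order.refl, where thesis = thesis] by blast
    have Yc: "(Y N)\<^sup>T \<in> carrier_mat ?s ?s" by (simp add: Y_def)
    have "(Y N)\<^sup>T *\<^sub>v vec ?s c = 0\<^sub>v ?s"
    proof (rule eq_vecI)
      fix u assume "u < dim_vec (0\<^sub>v ?s :: complex vec)"
      then have u: "u < ?s" by simp
      have "((Y N)\<^sup>T *\<^sub>v vec ?s c) $ u = (\<Sum>t\<in>{0..<?s}. Y N $$ (t, u) * c t)"
        using u by (simp add: Y_def scalar_prod_def)
      also have "\<dots> = (\<Sum>t\<in>{..<?s}. c t * lapp X h (entries N) t (b u))"
        by (rule sum.cong) (use u in \<open>auto simp: Y_def lapp_def\<close>)
      also have "\<dots> = 0" by (rule c(2)[OF bJ[OF u]])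
      finally show "((Y N)\<^sup>T *\<^sub>v vec ?s c) $ u = 0\<^sub>v ?s $ u" using u by simp
    qed (simp add: Y_def)
    moreover have "vec ?s c \<noteq> 0\<^sub>v ?s" using c(1) by (metis index_vec index_zero_vec(1) lessThan_iff)
    ultimately have "det ((Y N)\<^sup>T) = 0"
      using det_0_iff_vec_prod_zero_field[OF Yc] by (metis vec_carrier)
    then show False using N p(2) det_transpose[of "Y N" ?s] by (simp add: Y_def)
  qed
  ultimately show thesis using that p(1) by blast
qed

section \<open>The closure of a cell as a locus of rank bounds\<close>

lemma torus_class_in_topspace:
  assumes "M \<in> full_mats k n"
  shows "torus_class k n M \<in> topspace (zariski k n)"
proof -
  have M: "M \<in> carrier_mat k n" using assms by (simp add: full_mats_def)
  \<comment> \<open>For h = 0 and no columns the detector is a determinant of size 0, that is, the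
    constant function 1.\<close>
  obtain p where "multihomogeneous k n p" "eval_entries p M \<noteq> 0"
    using exists_rank_detector[OF M, of 0 "{}" thesis] by blast
  then show ?thesis
    using torus_class_in_principal_open_iff[OF _ assms] by (auto simp: zariski_def)
qed

lemma cell_subset_topspace: "cell k n v \<subseteq> topspace (zariski k n)"
  unfolding cell_eq using torus_class_in_topspace by (auto simp: cell_mats_def)

lemma in_closure_cell_iff:
  assumes v: "v \<in> fubini_words n k" and M: "M \<in> full_mats k n"
  shows "torus_class k n M \<in> (zariski k n closure_of cell k n v) \<longleftrightarrow>
    (\<forall>h J. h \<le> k \<longrightarrow> J \<subseteq> {..<n} \<longrightarrow> rk (entries M) h J \<le> word_quilt k n v (h, J))"
proof
  assume cl: "torus_class k n M \<in> (zariski k n closure_of cell k n v)"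
  show "\<forall>h J. h \<le> k \<longrightarrow> J \<subseteq> {..<n} \<longrightarrow> rk (entries M) h J \<le> word_quilt k n v (h, J)"
  proof (intro allI impI)
    fix h J assume hJ: "h \<le> k" "J \<subseteq> {..<n}"
    have Mc: "M \<in> carrier_mat k n" using M by (simp add: full_mats_def)
    obtain p where p: "multihomogeneous k n p" "eval_entries p M \<noteq> 0"
      "\<And>N. eval_entries p N \<noteq> 0 \<Longrightarrow> rk (entries M) h J \<le> rk (entries N) h J"
      using exists_rank_detector[OF Mc hJ, of thesis] by blast
    have "openin (zariski k n) (principal_open k n p)"
      unfolding zariski_def by (rule topology_generated_by_Basis) (use p(1) in blast)
    moreover have "torus_class k n M \<in> principal_open k n p"
      using torus_class_in_principal_open_iff[OF p(1) M] p(2) by simp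
    ultimately obtain y where "y \<in> cell k n v" "y \<in> principal_open k n p"
      using cl unfolding in_closure_of by blast
    then obtain N where N: "N \<in> cell_mats k n v" "torus_class k n N \<in> principal_open k n p"
      by (auto simp: cell_eq)
    then have "eval_entries p N \<noteq> 0"
      using torus_class_in_principal_open_iff[OF p(1), of N] by (simp add: cell_mats_def)
    then show "rk (entries M) h J \<le> word_quilt k n v (h, J)"
      using p(3) rk_le_word_quilt[OF hJ N(1)] order.trans by blast
  qed
next
  assume le: "\<forall>h J. h \<le> k \<longrightarrow> J \<subseteq> {..<n} \<longrightarrow> rk (entries M) h J \<le> word_quilt k n v (h, J)"
  have Mc: "M \<in> carrier_mat k n" using M by (simp add: full_mats_def)
  \<comment> \<open>The assumed bounds enter only at the level sets, where a maximiser in the cell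
    shows the quilt value to be at most the permutation count.\<close>
  have rank: "rk (entries M) h {j. j < n \<and> level v j < a} \<le> nw (letter v) a h" if ah: "a \<le> k" "h \<le> k" for a h
  proof -
    let ?J = "{j. j < n \<and> level v j < a}"
    have J: "?J \<subseteq> {..<n}" by auto
    obtain N where N: "N \<in> cell_mats k n v" "word_quilt k n v (h, ?J) = rk (entries N) h ?J"
      using word_quilt_attained[OF v ah(2) J, of thesis] by blast
    have "rk (entries N) h ?J \<le> nw (letter v) a h"
      using cell_conds_rk_level[OF _ ah] cell_mats_iff[OF v] N(1) by blast
    moreover have "rk (entries M) h ?J \<le> word_quilt k n v (h, ?J)" using le ah(2) J by blast
    ultimately show ?thesis using N(2) by linarith
  qed
  show "torus_class k n M \<in> (zariski k n closure_of cell k n v)"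
    unfolding in_closure_of
  proof (intro conjI allI impI)
    show "torus_class k n M \<in> topspace (zariski k n)" by (rule torus_class_in_topspace[OF M])
    fix T assume T: "torus_class k n M \<in> T \<and> openin (zariski k n) T"
    \<comment> \<open>Reduces the neighbourhood to finitely many inequations, whose conjunction is
      an open condition along lines that holds at M.\<close>
    have "\<exists>P. finite P \<and> (\<forall>p\<in>P. multihomogeneous k n p \<and> torus_class k n M \<in> principal_open k n p) \<and>
      (\<forall>y. (\<forall>p\<in>P. y \<in> principal_open k n p) \<longrightarrow> y \<in> T)"
      by (rule generate_principal_open) (use T in \<open>simp_all only: zariski_def openin_topology_generated_by_iff\<close>)
    then obtain P where P': "finite P"
      "\<forall>p\<in>P. multihomogeneous k n p \<and> torus_class k n M \<in> principal_open k n p"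
      "\<forall>y. (\<forall>p\<in>P. y \<in> principal_open k n p) \<longrightarrow> y \<in> T"
      by (elim exE conjE)
    have P: "finite P" "\<And>p. p \<in> P \<Longrightarrow> multihomogeneous k n p \<and> torus_class k n M \<in> principal_open k n p"
      "\<And>y. (\<And>p. p \<in> P \<Longrightarrow> y \<in> principal_open k n p) \<Longrightarrow> y \<in> T"
      using P' by simp_all
    have U: "line_open (nonvanishing k n P)" by (rule line_open_nonvanishing) (use P in auto)
    have mat_M: "mat k n (\<lambda>(i, j). M $$ (i, j)) = M" using Mc by (intro eq_matI) auto
    have UM: "nonvanishing k n P (entries M)"
      unfolding nonvanishing_def mat_M using P(2) torus_class_in_principal_open_iff[OF _ M] by blast
    have cong: "nonvanishing k n P B"
      if "\<And>i j. i < k \<Longrightarrow> j < n \<Longrightarrow> A i j = B i j" "nonvanishing k n P A" for A B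
    proof -
      have "mat k n (\<lambda>(i, j). A i j) = mat k n (\<lambda>(i, j). B i j)" using that(1) by (intro cong_mat) auto
      then show ?thesis using that(2) by (simp add: nonvanishing_def)
    qed
    obtain N where N: "N \<in> cell_mats k n v" "nonvanishing k n P (entries N)"
      by (rule exists_cell_mat[OF v U UM cong rank])
    have mat_N: "mat k n (\<lambda>(i, j). N $$ (i, j)) = N" using cell_mats_carrier[OF N(1)] by (intro eq_matI) auto
    have "torus_class k n N \<in> T"
    proof (rule P(3))
      fix p assume p: "p \<in> P"
      then have "eval_entries p N \<noteq> 0" using N(2) unfolding nonvanishing_def mat_N by blast
      then show "torus_class k n N \<in> principal_open k n p"
        using torus_class_in_principal_open_iff[of k n p N] P(2)[OF p] N(1) by (simp add: cell_mats_def)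
    qed
    then show "\<exists>y. y \<in> cell k n v \<and> y \<in> T" using N(1) unfolding cell_eq by blast
  qed
qed

text \<open>Forward, the matrix attaining a value of the quilt of w lies in the closure of the cell
  of v and so obeys its bounds. Backward, every matrix in the cell of w satisfies the bounds of v,
  and closures are minimal.\<close>

theorem medium_roast_le_iff:
  assumes v: "v \<in> fubini_words n k" and w: "w \<in> fubini_words n k"
  shows "medium_roast_le k n v w \<longleftrightarrow> quilt_le k n (word_quilt k n w) (word_quilt k n v)"
proof
  assume "medium_roast_le k n v w"
  then have sub: "(zariski k n closure_of cell k n w) \<subseteq> (zariski k n closure_of cell k n v)"
    by (simp add: medium_roast_le_def)
  show "quilt_le k n (word_quilt k n w) (word_quilt k n v)"
    unfolding quilt_le_def
  proof
    fix p assume "p \<in> grid k n"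
    then obtain h J where p: "p = (h, J)" "h \<le> k" "J \<subseteq> {..<n}" by (auto simp: grid_def)
    obtain M where M: "M \<in> cell_mats k n w" "word_quilt k n w (h, J) = rk (entries M) h J"
      using word_quilt_attained[OF w p(2,3), of thesis] by blast
    have "torus_class k n M \<in> cell k n w" using M(1) by (simp add: cell_eq)
    then have "torus_class k n M \<in> (zariski k n closure_of cell k n v)"
      using sub closure_of_subset[OF cell_subset_topspace] by blast
    then show "word_quilt k n w p \<le> word_quilt k n v p"
      using in_closure_cell_iff[OF v, of M] M p by (simp add: cell_mats_def)
  qed
next
  assume le: "quilt_le k n (word_quilt k n w) (word_quilt k n v)"
  have "cell k n w \<subseteq> (zariski k n closure_of cell k n v)"
  proof
    fix x assume "x \<in> cell k n w"
    then obtain M where M: "M \<in> cell_mats k n w" "x = torus_class k n M" by (auto simp: cell_eq)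
    have "rk (entries M) h J \<le> word_quilt k n v (h, J)" if "h \<le> k" "J \<subseteq> {..<n}" for h J
    proof -
      have "word_quilt k n w (h, J) \<le> word_quilt k n v (h, J)" using le that by (simp add: quilt_le_def grid_def)
      then show ?thesis using rk_le_word_quilt[OF that M(1)] by simp
    qed
    then show "x \<in> (zariski k n closure_of cell k n v)"
      using in_closure_cell_iff[OF v, of M] M by (simp add: cell_mats_def)
  qed
  then show "medium_roast_le k n v w"
    unfolding medium_roast_le_def by (intro closure_of_minimal) simp_all
qed

section \<open>Quilts of words\<close>

text \<open>Raising p by a single row, or else by a single column, stays below q and differs from p,
  so by the covering property it is q.\<close>

lemma grid_covers_cases:
  assumes "grid_covers k n p q"
  obtains h J where "p = (h, J)" "q = (Suc h, J)" "Suc h \<le> k" "J \<subseteq> {..<n}"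
  | h J j where "p = (h, J)" "q = (h, insert j J)" "h \<le> k" "insert j J \<subseteq> {..<n}"
proof -
  obtain h J h' J' where pq: "p = (h, J)" "q = (h', J')" by (cases p, cases q)
  have grid: "p \<in> grid k n" "q \<in> grid k n" "grid_le p q" "p \<noteq> q"
    and between: "\<And>r. r \<in> grid k n \<Longrightarrow> grid_le p r \<Longrightarrow> grid_le r q \<Longrightarrow> r = p \<or> r = q"
    using assms unfolding grid_covers_def by blast+
  have c: "h \<le> k" "J \<subseteq> {..<n}" "h' \<le> k" "J' \<subseteq> {..<n}" "h \<le> h'" "J \<subseteq> J'" "h \<noteq> h' \<or> J \<noteq> J'"
    using grid by (simp_all add: pq grid_def grid_le_def)
  show thesis
  proof (cases "h < h'")
    case True
    have "(Suc h, J) = p \<or> (Suc h, J) = q"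
      by (rule between) (use c True in \<open>simp_all add: pq grid_def grid_le_def\<close>)
    then show thesis using that(1)[of h J] pq c by simp
  next
    case False
    then have "h = h'" "J \<noteq> J'" using c by auto
    then obtain j where j: "j \<in> J'" "j \<notin> J" using c(6) by blast
    have "(h, insert j J) = p \<or> (h, insert j J) = q"
      by (rule between) (use c j in \<open>simp_all add: pq grid_def grid_le_def subset_iff\<close>)
    moreover have "insert j J \<noteq> J" using j by blast
    ultimately show thesis using that(2)[of h J j] pq c by simp
  qed
qed

text \<open>The two maxima may be attained at different matrices; each inequality is obtained at the
  maximiser of its left-hand side.\<close>

lemma word_quilt_step:
  assumes v: "v \<in> fubini_words n k" and hJ: "h \<le> k" "J \<subseteq> {..<n}" "h' \<le> k" "J' \<subseteq> {..<n}"
    and step: "\<And>A. rk A h J \<le> rk A h' J' \<and> rk A h' J' \<le> Suc (rk A h J)"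
  shows "word_quilt k n v (h', J') = word_quilt k n v (h, J) \<or>
    word_quilt k n v (h', J') = word_quilt k n v (h, J) + 1"
proof -
  obtain M where M: "M \<in> cell_mats k n v" "word_quilt k n v (h, J) = rk (entries M) h J"
    using word_quilt_attained[OF v hJ(1,2), of thesis] by blast
  obtain N where N: "N \<in> cell_mats k n v" "word_quilt k n v (h', J') = rk (entries N) h' J'"
    using word_quilt_attained[OF v hJ(3,4), of thesis] by blast
  have "word_quilt k n v (h, J) \<le> word_quilt k n v (h', J')"
    using M step[of "entries M"] rk_le_word_quilt[OF hJ(3,4) M(1)] by simp
  moreover have "word_quilt k n v (h', J') \<le> Suc (word_quilt k n v (h, J))"
    using N step[of "entries N"] rk_le_word_quilt[OF hJ(1,2) N(1)] by simp
  ultimately show ?thesis by auto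
qed

theorem word_quilt_in_quilts:
  assumes v: "v \<in> fubini_words n k"
  shows "word_quilt k n v \<in> quilts k n"
  unfolding quilts_def
proof (intro CollectI conjI allI impI)
  show "word_quilt k n v \<in> grid k n \<rightarrow>\<^sub>E UNIV" unfolding word_quilt_def by (simp add: restrict_PiE_iff)
  show "word_quilt k n v (0, J) = 0" if J: "J \<subseteq> {..<n}" for J
    using word_quilt_attained[OF v _ J, of 0 "word_quilt k n v (0, J) = 0"] rk_le_rows[of _ 0 J] by simp
  show "word_quilt k n v (h, {}) = 0" if h: "h \<le> k" for h
    using word_quilt_attained[OF v h, of "{}" "word_quilt k n v (h, {}) = 0"] rk_le_card[of "{}" _ h] by simp
  show "word_quilt k n v (k, {..<n}) = k"
  proof -
    obtain M where M: "M \<in> cell_mats k n v" "word_quilt k n v (k, {..<n}) = rk (entries M) k {..<n}"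
      using word_quilt_attained[OF v order.refl order.refl, of thesis] by blast
    then show ?thesis using rank_eq_rk[OF cell_mats_carrier[OF M(1)]] by (simp add: cell_mats_def full_mats_def)
  qed
  fix p q assume "grid_covers k n p q"
  then show "word_quilt k n v q = word_quilt k n v p \<or> word_quilt k n v q = word_quilt k n v p + 1"
  proof (cases rule: grid_covers_cases)
    case (1 h J)
    then have "finite J" using finite_subset by blast
    then show ?thesis unfolding 1(1,2)
      by (intro word_quilt_step[OF v]) (use 1 rk_mono_rows[of J h "Suc h"] rk_Suc_le[of J _ h] in auto)
  next
    case (2 h J j)
    then have "finite J" using finite_subset[of "insert j J" "{..<n}"] by simp
    then show ?thesis unfolding 2(1,2)
      by (intro word_quilt_step[OF v]) (use 2 rk_mono_cols[of "insert j J" J] rk_insert_le[of J _ h j] in auto)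
  qed
qed

section \<open>Recovering a word from its quilt\<close>

lemma word_quilt_eq_const:
  assumes v: "v \<in> fubini_words n k" and "h \<le> k" "J \<subseteq> {..<n}"
    and "\<And>A. cell_conds k n v A \<Longrightarrow> rk A h J = r"
  shows "word_quilt k n v (h, J) = r"
proof -
  obtain M where M: "M \<in> cell_mats k n v" "word_quilt k n v (h, J) = rk (entries M) h J"
    using word_quilt_attained[OF v assms(2,3), of thesis] by blast
  then show ?thesis using assms(4) cell_mats_iff[OF v] by simp
qed

theorem inj_on_word_quilt: "inj_on (word_quilt k n) (fubini_words n k)"
proof (rule inj_onI)
  fix v w assume v: "v \<in> fubini_words n k" and w: "w \<in> fubini_words n k"
    and eq: "word_quilt k n v = word_quilt k n w"
  \<comment> \<open>With all rows present, the value on a prefix counts the first occurrences in it;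
    its jumps are the first occurrences.\<close>
  have prefix: "word_quilt k n u (k, {..<j}) = card {i \<in> set (firsts u). i < j}"
    if u: "u \<in> fubini_words n k" and j: "j \<le> n" for u j
    by (rule word_quilt_eq_const[OF u]) (use j cell_conds_rk_prefix[OF u _ j] in auto)
  have card_eq: "card {i \<in> set (firsts v). i < j} = card {i \<in> set (firsts w). i < j}" if "j \<le> n" for j
    using prefix[OF v that] prefix[OF w that] eq by simp
  have mem: "j \<in> set (firsts u) \<longleftrightarrow> card {i \<in> set (firsts u). i < Suc j} \<noteq> card {i \<in> set (firsts u). i < j}" for u j
  proof -
    have "{i \<in> set (firsts u). i < Suc j} = (if j \<in> set (firsts u) then {j} else {}) \<union> {i \<in> set (firsts u). i < j}"
      by (auto simp: less_Suc_eq)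
    then show ?thesis by simp
  qed
  have firsts: "firsts v = firsts w"
  proof (rule sorted_distinct_set_unique)
    have "j \<in> set (firsts v) \<longleftrightarrow> j \<in> set (firsts w)" if "j < n" for j
      using mem[of j v] mem[of j w] card_eq[of j] card_eq[of "Suc j"] that by simp
    moreover have "j < n" if "j \<in> set (firsts v) \<or> j \<in> set (firsts w)" for j
      using that firsts_less[of j v] firsts_less[of j w] length_word[OF v] length_word[OF w] by auto
    ultimately show "set (firsts v) = set (firsts w)" by blast
  qed (use sorted_firsts in \<open>simp_all add: strict_sorted_iff\<close>)
  \<comment> \<open>On the first a first occurrences, now known to be common to both words, the
    values are the corner counts of the letter permutations, which determine the letters.\<close>
  have nw_eq: "nw (letter v) a h = nw (letter w) a h" if ah: "a \<le> k" "h \<le> k" for a h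
  proof -
    have "word_quilt k n u (h, set (take a (firsts u))) = nw (letter u) a h" if u: "u \<in> fubini_words n k" for u
      by (rule word_quilt_eq_const[OF u ah(2) set_take_firsts_subset[OF u]]) (use ah in \<open>simp add: cell_conds_def\<close>)
    from this[OF v] this[OF w] show ?thesis using eq firsts by simp
  qed
  have letter: "letter v b = letter w b" if b: "b < k" for b
  proof -
    have "letter v b < h \<longleftrightarrow> letter w b < h" if h: "h \<le> k" for h
      using nw_eq[of b h] nw_eq[of "Suc b" h] nw_Suc[of "letter v" b h] nw_Suc[of "letter w" b h] b h
      by (auto split: if_splits)
    from this[of "Suc (letter v b)"] this[of "Suc (letter w b)"] show ?thesis
      using letter_less[OF v b] letter_less[OF w b] by auto
  qed
  have level: "level v j = level w j" if j: "j < n" for j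
  proof -
    have ins: "word_quilt k n u (k, insert j (set (take a (firsts u)))) = (if level u j < a then a else Suc a)"
      if u: "u \<in> fubini_words n k" and a: "a \<le> k" for u a
      by (rule word_quilt_eq_const[OF u order.refl])
        (use j set_take_firsts_subset[OF u] cell_conds_rk_insert[OF u _ a j] in auto)
    have "level v j < a \<longleftrightarrow> level w j < a" if a: "a \<le> k" for a
      using ins[OF v a] ins[OF w a] eq firsts by (auto split: if_splits)
    \<comment> \<open>Testing a at the successor of either level gives the two inequalities between
      the levels.\<close>
    from this[of "Suc (level v j)"] this[of "Suc (level w j)"] show ?thesis
      using level_props(1)[OF v j] level_props(1)[OF w j] by auto
  qed
  show "v = w"
  proof (rule nth_equalityI)
    show "length v = length w" by (simp add: length_word[OF v] length_word[OF w])
    fix j assume "j < length v"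
    then have j: "j < n" by (simp add: length_word[OF v])
    show "v ! j = w ! j"
      using level_props(1,2)[OF v j] level_props(2)[OF w j] level[OF j] letter[of "level v j"] by simp
  qed
qed

theorem corollary4p2:
  fixes k n :: nat
  assumes "1 \<le> k" and "k \<le> n"
  shows "(\<forall>w\<in>fubini_words n k. word_quilt k n w \<in> quilts k n) \<and>
    inj_on (word_quilt k n) (fubini_words n k) \<and>
    (\<forall>v\<in>fubini_words n k. \<forall>w\<in>fubini_words n k.
       medium_roast_le k n v w \<longleftrightarrow> quilt_le k n (word_quilt k n w) (word_quilt k n v))"
  using word_quilt_in_quilts inj_on_word_quilt medium_roast_le_iff by blast

end
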